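(* Let $d\ge1$ be an integer, $s\ge\frac d2$ real and $n=\lfloor s-\frac d2\rfloor$. Let $V\in\mathrm{C}_0^\infty(\mathbb{R}^d)$ be such that $V\ge0$, and let $v=V^{1/2}$. Then the operator $H_s=(-\Delta)^s-V$ on $L^2(\mathbb{R}^d)$ has at least $\dim\mathcal{F}_n$ negative eigenvalues, counted with multiplicity, where $$\mathcal{F}_n:=\mathrm{span}\big\{x^\alpha v\ \big|\ \alpha\in\mathbb{N}_0^d,\ |\alpha|\le n\big\}.$$
   Context: $\mathbb{N}_0=\{0,1,2,\dots\}$; for $\alpha\in\mathbb{N}_0^d$ and $x\in\mathbb{R}^d$, $x^\alpha=\prod_{j=1}^d x_j^{\alpha_j}$ and $|\alpha|=\sum_{j=1}^d\alpha_j$. $\mathrm{C}_0^\infty(\mathbb{R}^d)$ is the space of smooth compactly supported functions. Since $V$ is bounded, $H_s$ is self-adjoint on the domain $H^{2s}(\mathbb{R}^d)$ of $(-\Delta)^s$, the Fourier multiplier by $|\xi|^{2s}$. *)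

theory Defs
  imports "HOL-Analysis.Analysis"
begin

section \<open>The complex vector space $L^2(\mathbf{R}^d)$\<close>

text \<open>As usual, the elements of $L^2$ are the square-integrable functions modulo equality almost
  everywhere. Using Borel (instead of Lebesgue) measurable representatives gives the same space.\<close>

definition square_integrable :: "(real ^ 'd \<Rightarrow> complex) \<Rightarrow> bool" where
  "square_integrable f \<longleftrightarrow>
     f \<in> borel_measurable lborel \<and> (\<integral>\<^sup>+ x. ennreal ((cmod (f x))\<^sup>2) \<partial>lborel) < \<infinity>"

definition L2_eq :: "(real ^ 'd \<Rightarrow> complex) \<Rightarrow> (real ^ 'd \<Rightarrow> complex) \<Rightarrow> bool" where
  "L2_eq f g \<longleftrightarrow> square_integrable f \<and> square_integrable g \<and> (AE x in lborel. f x = g x)"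

lemma square_integrable_zero: "square_integrable (\<lambda>x. 0)"
  by (simp add: square_integrable_def)

lemma square_integrable_scale:
  assumes "square_integrable f"
  shows "square_integrable (\<lambda>x. c * f x)"
proof -
  have meas: "f \<in> borel_measurable lborel"
    and fin: "(\<integral>\<^sup>+ x. ennreal ((cmod (f x))\<^sup>2) \<partial>lborel) < \<infinity>"
    using assms by (auto simp: square_integrable_def)
  have "(\<integral>\<^sup>+ x. ennreal ((cmod (c * f x))\<^sup>2) \<partial>lborel)
      = (\<integral>\<^sup>+ x. ennreal ((cmod c)\<^sup>2) * ennreal ((cmod (f x))\<^sup>2) \<partial>lborel)"
    by (simp add: norm_mult power_mult_distrib ennreal_mult)
  also have "\<dots> = ennreal ((cmod c)\<^sup>2) * (\<integral>\<^sup>+ x. ennreal ((cmod (f x))\<^sup>2) \<partial>lborel)"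
    using meas by (simp add: nn_integral_cmult)
  also have "\<dots> < \<infinity>"
    using fin by (simp add: ennreal_mult_less_top)
  finally show ?thesis
    using meas by (auto simp: square_integrable_def)
qed

lemma square_integrable_add:
  assumes "square_integrable f" "square_integrable g"
  shows "square_integrable (\<lambda>x. f x + g x)"
proof -
  have meas: "f \<in> borel_measurable lborel" "g \<in> borel_measurable lborel"
    and fin: "(\<integral>\<^sup>+ x. ennreal ((cmod (f x))\<^sup>2) \<partial>lborel) < \<infinity>"
      "(\<integral>\<^sup>+ x. ennreal ((cmod (g x))\<^sup>2) \<partial>lborel) < \<infinity>"
    using assms by (auto simp: square_integrable_def)
  have bound: "(cmod (f x + g x))\<^sup>2 \<le> 2 * (cmod (f x))\<^sup>2 + 2 * (cmod (g x))\<^sup>2" for x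
  proof -
    have "(cmod (f x + g x))\<^sup>2 \<le> (cmod (f x) + cmod (g x))\<^sup>2"
      by (intro power_mono norm_triangle_ineq norm_ge_zero)
    also have "\<dots> \<le> 2 * (cmod (f x))\<^sup>2 + 2 * (cmod (g x))\<^sup>2"
      using zero_le_power2[of "cmod (f x) - cmod (g x)"]
      by (simp add: power2_sum power2_diff)
    finally show ?thesis .
  qed
  have "(\<integral>\<^sup>+ x. ennreal ((cmod (f x + g x))\<^sup>2) \<partial>lborel)
      \<le> (\<integral>\<^sup>+ x. 2 * ennreal ((cmod (f x))\<^sup>2) + 2 * ennreal ((cmod (g x))\<^sup>2) \<partial>lborel)"
  proof (rule nn_integral_mono)
    fix x
    show "ennreal ((cmod (f x + g x))\<^sup>2)
        \<le> 2 * ennreal ((cmod (f x))\<^sup>2) + 2 * ennreal ((cmod (g x))\<^sup>2)"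
      using ennreal_leI[OF bound[of x]] by (simp add: ennreal_plus ennreal_mult)
  qed
  also have "\<dots> = 2 * (\<integral>\<^sup>+ x. ennreal ((cmod (f x))\<^sup>2) \<partial>lborel)
      + 2 * (\<integral>\<^sup>+ x. ennreal ((cmod (g x))\<^sup>2) \<partial>lborel)"
    using meas by (simp add: nn_integral_add nn_integral_cmult)
  also have "\<dots> < \<infinity>"
    using fin by (simp add: ennreal_mult_less_top)
  finally show ?thesis
    using meas by (auto simp: square_integrable_def)
qed

lemma square_integrable_uminus: "square_integrable f \<Longrightarrow> square_integrable (\<lambda>x. - f x)"
  using square_integrable_scale[of f "-1"] by simp

lemma square_integrable_diff:
  "square_integrable f \<Longrightarrow> square_integrable g \<Longrightarrow> square_integrable (\<lambda>x. f x - g x)"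
  using square_integrable_add[of f "\<lambda>x. - g x"] square_integrable_uminus[of g] by simp

quotient_type 'd L2 = "real ^ ('d::finite) \<Rightarrow> complex" / partial: L2_eq
  morphisms rep_L2 to_L2
proof (rule part_equivpI)
  show "\<exists>f :: real ^ 'd \<Rightarrow> complex. L2_eq f f"
    by (rule exI[of _ "\<lambda>x. 0"]) (simp add: L2_eq_def square_integrable_zero)
  show "symp (L2_eq :: (real ^ 'd \<Rightarrow> complex) \<Rightarrow> _)"
    by (rule sympI) (auto simp: L2_eq_def)
  show "transp (L2_eq :: (real ^ 'd \<Rightarrow> complex) \<Rightarrow> _)"
    by (rule transpI) (auto simp: L2_eq_def)
qed

instantiation L2 :: (finite) ab_group_add
begin

lift_definition zero_L2 :: "'a L2" is "\<lambda>x. 0"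
  by (simp add: L2_eq_def square_integrable_zero)

lift_definition plus_L2 :: "'a L2 \<Rightarrow> 'a L2 \<Rightarrow> 'a L2" is "\<lambda>f g x. f x + g x"
  by (auto simp: L2_eq_def square_integrable_add)

lift_definition minus_L2 :: "'a L2 \<Rightarrow> 'a L2 \<Rightarrow> 'a L2" is "\<lambda>f g x. f x - g x"
  by (auto simp: L2_eq_def square_integrable_diff)

lift_definition uminus_L2 :: "'a L2 \<Rightarrow> 'a L2" is "\<lambda>f x. - f x"
  by (auto simp: L2_eq_def square_integrable_uminus)

instance
  by standard
    (transfer, auto simp: L2_eq_def algebra_simps
       intro: square_integrable_add square_integrable_diff square_integrable_uminus
              square_integrable_zero)+

end

lift_definition scale_L2 :: "complex \<Rightarrow> 'd::finite L2 \<Rightarrow> 'd L2" (infixr \<open>\<cdot>\<close> 75)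
  is "\<lambda>c f x. c * f x"
  by (auto simp: L2_eq_def square_integrable_scale)

global_interpretation L2: vector_space "scale_L2 :: complex \<Rightarrow> 'd::finite L2 \<Rightarrow> 'd L2"
  by standard
    (transfer, auto simp: L2_eq_def algebra_simps
       intro: square_integrable_add square_integrable_scale)+

text \<open>Multiplication of (the class of) a function by a fixed function. This is only meaningful if
  the product is again square-integrable.\<close>

definition mult_L2 :: "(real ^ 'd \<Rightarrow> complex) \<Rightarrow> 'd::finite L2 \<Rightarrow> 'd L2" where
  "mult_L2 m u = to_L2 (\<lambda>x. m x * rep_L2 u x)"


section \<open>Fourier transform, Sobolev spaces and the fractional Laplacian\<close>

definition fourier_integral :: "(real ^ 'd \<Rightarrow> complex) \<Rightarrow> real ^ 'd \<Rightarrow> complex" where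
  "fourier_integral f \<xi> =
     of_real ((2 * pi) powr (- real CARD('d) / 2)) * (\<integral>x. cis (- (x \<bullet> \<xi>)) * f x \<partial>lborel)"

text \<open>The Fourier transform on $L^2$ is the continuous extension of the Fourier integral from
  $L^1 \cap L^2$; it is well defined by Plancherel's theorem.\<close>

definition is_fourier_L2 :: "'d::finite L2 \<Rightarrow> 'd L2 \<Rightarrow> bool" where
  "is_fourier_L2 u w \<longleftrightarrow>
     (\<exists>\<phi> :: nat \<Rightarrow> real ^ 'd \<Rightarrow> complex.
        (\<forall>k. integrable lborel (\<phi> k) \<and> square_integrable (\<phi> k)) \<and>
        (\<lambda>k. \<integral>\<^sup>+ x. ennreal ((cmod (\<phi> k x - rep_L2 u x))\<^sup>2) \<partial>lborel) \<longlonglongrightarrow> 0 \<and>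
        (\<lambda>k. \<integral>\<^sup>+ \<xi>. ennreal ((cmod (fourier_integral (\<phi> k) \<xi> - rep_L2 w \<xi>))\<^sup>2) \<partial>lborel)
          \<longlonglongrightarrow> 0)"

definition fourier_L2 :: "'d::finite L2 \<Rightarrow> 'd L2" where
  "fourier_L2 u = (THE w. is_fourier_L2 u w)"

definition sobolev :: "real \<Rightarrow> 'd::finite L2 set" where
  "sobolev r = {u. (\<integral>\<^sup>+ \<xi>. ennreal ((1 + (norm \<xi>)\<^sup>2) powr r * (cmod (rep_L2 (fourier_L2 u) \<xi>))\<^sup>2)
                      \<partial>lborel) < \<infinity>}"

text \<open>$(-\Delta)^s$, to be used on its domain \<^term>\<open>sobolev (2 * s)\<close>.\<close>

definition frac_laplacian :: "real \<Rightarrow> 'd::finite L2 \<Rightarrow> 'd L2" where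
  "frac_laplacian s u =
     (THE w. fourier_L2 w = mult_L2 (\<lambda>\<xi>. of_real (norm \<xi> powr (2 * s))) (fourier_L2 u))"

text \<open>$H_s = (-\Delta)^s - V$, likewise with domain \<^term>\<open>sobolev (2 * s)\<close>.\<close>

definition schroedinger :: "real \<Rightarrow> (real ^ 'd \<Rightarrow> real) \<Rightarrow> 'd::finite L2 \<Rightarrow> 'd L2" where
  "schroedinger s V u = frac_laplacian s u - mult_L2 (\<lambda>x. of_real (V x)) u"


section \<open>Counting negative eigenvalues\<close>

text \<open>In the following, an operator is given by its domain \<open>D\<close> and its action \<open>A\<close>.\<close>

definition eigenspace :: "'d::finite L2 set \<Rightarrow> ('d L2 \<Rightarrow> 'd L2) \<Rightarrow> real \<Rightarrow> 'd L2 set" where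
  "eigenspace D A \<mu> = {u \<in> D. A u = of_real \<mu> \<cdot> u}"

definition eigenvalue :: "'d::finite L2 set \<Rightarrow> ('d L2 \<Rightarrow> 'd L2) \<Rightarrow> real \<Rightarrow> bool" where
  "eigenvalue D A \<mu> \<longleftrightarrow> (\<exists>u \<in> eigenspace D A \<mu>. u \<noteq> 0)"

text \<open>The library's \<open>dim\<close> is 0 for infinite-dimensional spaces, hence the following
  extended version.\<close>

definition edim :: "'d::finite L2 set \<Rightarrow> enat" where
  "edim S = (SUP B \<in> {B. finite B \<and> B \<subseteq> S \<and> L2.independent B}. enat (card B))"

definition num_neg_eigenvalues :: "'d::finite L2 set \<Rightarrow> ('d L2 \<Rightarrow> 'd L2) \<Rightarrow> enat" where
  "num_neg_eigenvalues D A =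
     (\<Sum>\<^sub>\<infinity>\<mu>\<in>{\<mu>. \<mu> < 0 \<and> eigenvalue D A \<mu>}. edim (eigenspace D A \<mu>))"


section \<open>Test functions and the space $\mathcal{F}_n$\<close>

fun C_k :: "nat \<Rightarrow> (real ^ 'd \<Rightarrow> real) \<Rightarrow> bool" where
  "C_k 0 f \<longleftrightarrow> continuous_on UNIV f"
| "C_k (Suc k) f \<longleftrightarrow>
     (\<forall>x. f differentiable (at x)) \<and>
     (\<forall>j. C_k k (\<lambda>x. frechet_derivative f (at x) (axis j 1)))"

definition test_function :: "(real ^ 'd \<Rightarrow> real) \<Rightarrow> bool" where
  "test_function f \<longleftrightarrow> (\<forall>k. C_k k f) \<and> compact (closure {x. f x \<noteq> 0})"

definition monomial :: "('d::finite \<Rightarrow> nat) \<Rightarrow> real ^ 'd \<Rightarrow> real" where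
  "monomial \<alpha> x = (\<Prod>j\<in>UNIV. (x $ j) ^ \<alpha> j)"

definition F_space :: "nat \<Rightarrow> (real ^ 'd \<Rightarrow> real) \<Rightarrow> 'd::finite L2 set" where
  "F_space n v = L2.span {to_L2 (\<lambda>x. of_real (monomial \<alpha> x * v x)) |\<alpha>. sum \<alpha> UNIV \<le> n}"

end

theory Submission
  imports Defs "HOL-Complex_Analysis.Great_Picard" "HOL-Probability.Characteristic_Functions"
begin

text \<open>The number of negative eigenvalues is bounded below by the dimension of any space of trial
  states on which the form of $H_s$ is negative: minimise the Rayleigh quotient successively on the
  orthogonal complements of the eigenvectors already found. A minimising sequence with limit value
  $E < 0$ is Cauchy, by the parallelogram identity for the non-negative form of $H_s - E$, because
  the potential is compact relative to the kinetic energy.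

  The trial states are $u = ((-\Delta)^s + \epsilon)^{-1} v f$ with $f \in \mathcal F_n$. By the
  Birman--Schwinger argument and the Cauchy--Schwarz inequality, their energy is negative as soon as
  $\int |\widehat{vf}|^2 / (|\xi|^{2s} + \epsilon) > \|f\|^2$. For $f \neq 0$ the left-hand side tends to
  infinity as $\epsilon \to 0$: otherwise $\int |\widehat{vf}|^2 / |\xi|^{2s} < \infty$, which forces all
  derivatives of $\widehat{vf}$ of order at most $n \le s - d/2$ to vanish at the origin, so that $vf$
  is orthogonal to all polynomials of degree at most $n$, whence $f = 0$. As the unit sphere of
  $\mathcal F_n$ is compact, one $\epsilon$ serves all $f$.

  Plancherel's theorem is obtained from the contractivity of the Fourier integral on
  $L^1 \cap L^2$, which follows by Gaussian regularisation, and its explicit action on modulated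
  Gaussians.\<close>

subsection \<open>Square-integrable functions and their classes\<close>

text \<open>The threshold s - d/2 is a matter of scaling. If the Taylor expansion of the Fourier
  transform of vf at the origin starts with a homogeneous polynomial p of degree m, then |p|^2 /
  |\<xi>|^(2s), homogeneous of degree 2m - 2s, would have to be integrable there; for 2s \<ge> d +
  2m this forces p = 0. Writing f = gv with a polynomial g, the orthogonality of vf = gV to all
  polynomials of degree at most n gives |f|^2 = \<integral>|g|^2 V = 0. For the trial state u =
  ((-\<Delta>)^s + \<epsilon>)^-1 vf, put N = \<integral>|F(vf)|^2 / (|\<xi>|^(2s) + \<epsilon>),
  with F the Fourier transform. Then N is both the form of (-\<Delta>)^s + \<epsilon> at u and the
  inner product of vu with f. Hence the potential energy |vu|^2 is at least N^2 / |f|^2, and the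
  form of H_s + \<epsilon> at u is at most N - N^2 / |f|^2, which is negative as soon as N > |f|^2.
  A single \<epsilon> is essential: the trial state depends linearly on f only for fixed \<epsilon>,
  and this linearity is what allows a trial state orthogonal to given eigenvectors to be found by
  counting dimensions.\<close>

lemma borel_measurable_cnj [measurable]:
  "f \<in> borel_measurable M \<Longrightarrow> (\<lambda>x. cnj (f x)) \<in> borel_measurable M"
  by (rule measurable_compose[OF _ borel_measurable_continuous_onI]) (auto intro: continuous_intros)

lemma square_integrableD:
  assumes "square_integrable f"
  shows "f \<in> borel_measurable borel" "integrable lborel (\<lambda>x. (cmod (f x))\<^sup>2)"
proof -
  show m: "f \<in> borel_measurable borel"
    using assms by (simp add: square_integrable_def)
  show "integrable lborel (\<lambda>x. (cmod (f x))\<^sup>2)"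
    using assms m by (intro integrableI_bounded) (auto simp: square_integrable_def)
qed

lemma square_integrableI:
  fixes f :: "real ^ 'd \<Rightarrow> complex"
  assumes [measurable]: "f \<in> borel_measurable borel" and "integrable lborel (\<lambda>x. (cmod (f x))\<^sup>2)"
  shows "square_integrable f"
  using assms(2) by (auto simp: square_integrable_def integrable_iff_bounded)

lemma square_integrable_bound:
  fixes f g :: "real ^ 'd \<Rightarrow> complex"
  assumes f: "square_integrable f" and g[measurable]: "g \<in> borel_measurable borel"
    and le: "\<And>x. cmod (g x) \<le> C * cmod (f x)"
  shows "square_integrable g"
proof (rule square_integrableI)
  show "integrable lborel (\<lambda>x. (cmod (g x))\<^sup>2)"
  proof (rule Bochner_Integration.integrable_bound)
    show "integrable lborel (\<lambda>x. C\<^sup>2 * (cmod (f x))\<^sup>2)"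
      using square_integrableD(2)[OF f] by simp
    show "AE x in lborel. norm ((cmod (g x))\<^sup>2) \<le> norm (C\<^sup>2 * (cmod (f x))\<^sup>2)"
      using power_mono[OF le norm_ge_zero, of _ 2] by (intro AE_I2) (simp add: power_mult_distrib)
  qed simp
qed fact

lemma integrable_mult_sq:
  fixes f g :: "real ^ 'd \<Rightarrow> complex"
  assumes "square_integrable f" "square_integrable g"
  shows "integrable lborel (\<lambda>x. f x * g x)"
proof (rule Bochner_Integration.integrable_bound)
  note [measurable] = square_integrableD(1)[OF assms(1)] square_integrableD(1)[OF assms(2)]
  show "integrable lborel (\<lambda>x. (cmod (f x))\<^sup>2 + (cmod (g x))\<^sup>2)"
    using assms by (intro Bochner_Integration.integrable_add square_integrableD(2))
  show "(\<lambda>x. f x * g x) \<in> borel_measurable lborel"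
    by measurable
  show "AE x in lborel. norm (f x * g x) \<le> norm ((cmod (f x))\<^sup>2 + (cmod (g x))\<^sup>2)"
  proof (rule AE_I2)
    fix x
    show "norm (f x * g x) \<le> norm ((cmod (f x))\<^sup>2 + (cmod (g x))\<^sup>2)"
      using sum_squares_bound[of "cmod (f x)" "cmod (g x)"]
        mult_nonneg_nonneg[OF norm_ge_zero norm_ge_zero, of "f x" "g x"]
      unfolding norm_mult real_norm_def by linarith
  qed
qed

lemma square_integrable_cnj: "square_integrable f \<Longrightarrow> square_integrable (\<lambda>x. cnj (f x))"
  by (rule square_integrable_bound[where C = 1 and f = f])
    (auto dest!: square_integrableD(1))

lemma square_integrable_rep: "square_integrable (rep_L2 u)"
  using Quotient3_rep_reflp[OF Quotient3_L2, of u] by (simp add: L2_eq_def)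

lemma to_L2_rep [simp]: "to_L2 (rep_L2 u) = u"
  by (rule Quotient3_abs_rep[OF Quotient3_L2])

lemma to_L2_eq_iff:
  assumes "square_integrable f" "square_integrable g"
  shows "to_L2 f = to_L2 g \<longleftrightarrow> (AE x in lborel. f x = g x)"
  using Quotient3_rel[OF Quotient3_L2, of f g] assms by (auto simp: L2_eq_def)

lemma to_L2_cong:
  assumes "square_integrable f" "square_integrable g" "AE x in lborel. f x = g x"
  shows "to_L2 f = to_L2 g"
  using assms to_L2_eq_iff by blast

lemma rep_to_L2:
  assumes "square_integrable f"
  shows "AE x in lborel. rep_L2 (to_L2 f) x = f x"
  using to_L2_eq_iff[OF square_integrable_rep assms, of "to_L2 f"] by simp

lemma L2_cases:
  obtains f where "square_integrable f" "u = to_L2 f"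
  using square_integrable_rep to_L2_rep by metis

lemma zero_to_L2: "0 = to_L2 (\<lambda>x. 0)"
  by (simp add: zero_L2_def)

lemma add_to_L2:
  assumes "square_integrable f" "square_integrable g"
  shows "to_L2 f + to_L2 g = to_L2 (\<lambda>x. f x + g x)"
  using plus_L2.abs_eq[of f g] assms by (simp add: L2_eq_def)

lemma diff_to_L2:
  assumes "square_integrable f" "square_integrable g"
  shows "to_L2 f - to_L2 g = to_L2 (\<lambda>x. f x - g x)"
  using minus_L2.abs_eq[of f g] assms by (simp add: L2_eq_def)

lemma scale_to_L2:
  assumes "square_integrable f"
  shows "c \<cdot> to_L2 f = to_L2 (\<lambda>x. c * f x)"
  using scale_L2.abs_eq[of f c] assms by (simp add: L2_eq_def)

subsection \<open>The Hilbert space structure\<close>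

definition cinner :: "'d::finite L2 \<Rightarrow> 'd L2 \<Rightarrow> complex" where
  "cinner u w = (\<integral>x. rep_L2 u x * cnj (rep_L2 w x) \<partial>lborel)"

lemma cinner_to_L2:
  assumes "square_integrable f" "square_integrable g"
  shows "cinner (to_L2 f) (to_L2 g) = (\<integral>x. f x * cnj (g x) \<partial>lborel)"
  unfolding cinner_def
proof (rule integral_cong_AE)
  note [measurable] = square_integrableD(1)[OF square_integrable_rep]
    square_integrableD(1)[OF assms(1)] square_integrableD(1)[OF assms(2)]
  show "(\<lambda>x. rep_L2 (to_L2 f) x * cnj (rep_L2 (to_L2 g) x)) \<in> borel_measurable lborel"
    "(\<lambda>x. f x * cnj (g x)) \<in> borel_measurable lborel"
    by measurable
  show "AE x in lborel. rep_L2 (to_L2 f) x * cnj (rep_L2 (to_L2 g) x) = f x * cnj (g x)"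
    using rep_to_L2[OF assms(1)] rep_to_L2[OF assms(2)] by eventually_elim simp
qed

lemma cinner_add_left: "cinner (u + v) w = cinner u w + cinner v w"
proof -
  obtain f g h where *: "square_integrable f" "square_integrable g" "square_integrable h"
    "u = to_L2 f" "v = to_L2 g" "w = to_L2 h"
    using L2_cases by metis
  show ?thesis
    unfolding * using *(1-3)
    by (simp add: add_to_L2 cinner_to_L2 square_integrable_add ring_distribs integrable_mult_sq
        square_integrable_cnj)
qed

lemma cinner_scale_left: "cinner (c \<cdot> u) w = c * cinner u w"
proof -
  obtain f h where *: "square_integrable f" "square_integrable h" "u = to_L2 f" "w = to_L2 h"
    using L2_cases by metis
  show ?thesis
    unfolding * using *(1-2)
    by (simp add: scale_to_L2 cinner_to_L2 square_integrable_scale mult.assoc)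
qed

lemma cinner_commute: "cinner w u = cnj (cinner u w)"
  unfolding cinner_def by (simp add: mult.commute flip: Bochner_Integration.integral_cnj)

lemma cinner_add_right: "cinner w (u + v) = cinner w u + cinner w v"
  by (metis cinner_add_left cinner_commute complex_cnj_add)

lemma cinner_scale_right: "cinner w (c \<cdot> u) = cnj c * cinner w u"
  by (metis cinner_scale_left cinner_commute complex_cnj_mult)

lemma cinner_zero_left [simp]: "cinner 0 w = 0"
  using cinner_scale_left[of 0 0 w] by simp

lemma cinner_zero_right [simp]: "cinner w 0 = 0"
  using cinner_scale_right[of w 0 0] by simp

lemma cinner_diff_left: "cinner (u - v) w = cinner u w - cinner v w"
  using cinner_add_left[of "u - v" v w] by simp

lemma cinner_diff_right: "cinner w (u - v) = cinner w u - cinner w v"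
  using cinner_add_right[of w "u - v" v] by simp

lemma cinner_sum_left: "cinner (\<Sum>i\<in>I. f i) w = (\<Sum>i\<in>I. cinner (f i) w)"
  by (induction I rule: infinite_finite_induct) (auto simp: cinner_add_left)

lemma cinner_sum_right: "cinner w (\<Sum>i\<in>I. f i) = (\<Sum>i\<in>I. cinner w (f i))"
  by (induction I rule: infinite_finite_induct) (auto simp: cinner_add_right)

lemma cinner_self_to_L2:
  assumes "square_integrable f"
  shows "cinner (to_L2 f) (to_L2 f) = of_real (\<integral>x. (cmod (f x))\<^sup>2 \<partial>lborel)"
  by (simp add: cinner_to_L2 assms flip: complex_norm_square of_real_power integral_complex_of_real)

lemma Im_cinner_self [simp]: "Im (cinner u u) = 0"
  by (metis L2_cases cinner_self_to_L2 Im_complex_of_real)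

lemma Re_cinner_self_to_L2:
  assumes "square_integrable f"
  shows "Re (cinner (to_L2 f) (to_L2 f)) = (\<integral>x. (cmod (f x))\<^sup>2 \<partial>lborel)"
  by (simp only: cinner_self_to_L2[OF assms] Re_complex_of_real)

text \<open>The real part of \<open>cinner\<close> makes L^2 a real Hilbert space, so that norms,
  limits and bounded linear maps come from the type classes. The complex structure is kept apart, in
  \<open>scale_L2\<close> and \<open>cinner\<close>.\<close>

instantiation L2 :: (finite) real_vector
begin

definition scaleR_L2 :: "real \<Rightarrow> 'a L2 \<Rightarrow> 'a L2" where
  "scaleR_L2 r u = of_real r \<cdot> u"

instance
  by standard (simp_all add: scaleR_L2_def L2.scale_left_distrib L2.scale_right_distrib)

end

instantiation L2 :: (finite) real_inner
begin

definition inner_L2 :: "'a L2 \<Rightarrow> 'a L2 \<Rightarrow> real" where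
  "inner_L2 u w = Re (cinner u w)"

definition norm_L2 :: "'a L2 \<Rightarrow> real" where
  "norm_L2 u = sqrt (inner u u)"

definition sgn_L2 :: "'a L2 \<Rightarrow> 'a L2" where
  "sgn_L2 u = u /\<^sub>R norm u"

definition dist_L2 :: "'a L2 \<Rightarrow> 'a L2 \<Rightarrow> real" where
  "dist_L2 u w = norm (u - w)"

definition uniformity_L2 :: "('a L2 \<times> 'a L2) filter" where
  "uniformity_L2 = (INF e\<in>{0<..}. principal {(x, y). dist x y < e})"

definition open_L2 :: "'a L2 set \<Rightarrow> bool" where
  "open_L2 S \<longleftrightarrow> (\<forall>x\<in>S. \<forall>\<^sub>F (x', y) in uniformity. x' = x \<longrightarrow> y \<in> S)"

instance
proof
  fix x y z :: "'a L2" and a b r :: real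
  show "inner x y = inner y x"
    using cinner_commute[of x y] by (simp add: inner_L2_def)
  show "inner (x + y) z = inner x z + inner y z"
    by (simp add: inner_L2_def cinner_add_left)
  show "inner (r *\<^sub>R x) y = r * inner x y"
    by (simp add: inner_L2_def cinner_scale_left scaleR_L2_def)
  obtain f where f: "square_integrable f" "x = to_L2 f"
    using L2_cases by metis
  show "0 \<le> inner x x"
    using f by (simp add: inner_L2_def Re_cinner_self_to_L2)
  show "inner x x = 0 \<longleftrightarrow> x = 0"
    using f square_integrableD(2)[OF f(1)]
    by (simp add: inner_L2_def Re_cinner_self_to_L2 integral_nonneg_eq_0_iff_AE zero_to_L2
        to_L2_eq_iff square_integrable_zero)
  show "norm x = sqrt (inner x x)" by (simp add: norm_L2_def)
qed (simp_all add: sgn_L2_def dist_L2_def uniformity_L2_def open_L2_def)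

end

lemma norm_L2_sq: "(norm (u :: 'd::finite L2))\<^sup>2 = Re (cinner u u)"
  by (metis inner_L2_def power2_norm_eq_inner)

lemma cinner_self: "cinner u u = of_real ((norm u)\<^sup>2)"
  by (simp add: complex_eq_iff norm_L2_sq)

lemma norm_L2_to_L2:
  assumes "square_integrable f"
  shows "(norm (to_L2 f))\<^sup>2 = (\<integral>x. (cmod (f x))\<^sup>2 \<partial>lborel)"
  by (simp add: norm_L2_sq Re_cinner_self_to_L2 assms)

lemma ennreal_norm_L2:
  assumes "square_integrable f"
  shows "(\<integral>\<^sup>+ x. ennreal ((cmod (f x))\<^sup>2) \<partial>lborel) = ennreal ((norm (to_L2 f))\<^sup>2)"
  using nn_integral_eq_integral[OF square_integrableD(2)[OF assms]] by (simp add: norm_L2_to_L2 assms)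

lemma norm_scale_L2 [simp]: "norm (c \<cdot> u :: 'd::finite L2) = cmod c * norm u"
proof -
  have "(norm (c \<cdot> u))\<^sup>2 = Re ((c * cnj c) * cinner u u)"
    by (simp add: norm_L2_sq cinner_scale_left cinner_scale_right mult_ac)
  also have "\<dots> = (cmod c * norm u)\<^sup>2"
    by (simp add: complex_norm_square[symmetric] cinner_self power_mult_distrib)
  finally show ?thesis
    by (simp add: power2_eq_iff_nonneg)
qed

lemma cinner_Cauchy_Schwarz: "cmod (cinner u w) \<le> norm u * norm w"
proof (cases "cinner u w = 0")
  case False
  \<comment> \<open>Rotating u by this phase makes the complex product real and positive, which
    reduces the claim to the real Cauchy-Schwarz inequality.\<close>
  define c where "c = cnj (cinner u w) / cmod (cinner u w)"
  have c: "cmod c = 1" "c * cinner u w = cmod (cinner u w)"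
    using False complex_norm_square[of "cinner u w"]
    by (auto simp: c_def norm_divide power2_eq_square field_simps)
  have "cmod (cinner u w) = inner (c \<cdot> u) w"
    using c(2) by (simp add: inner_L2_def cinner_scale_left)
  also have "\<dots> \<le> norm (c \<cdot> u) * norm w"
    by (rule norm_cauchy_schwarz)
  finally show ?thesis using c by simp
qed simp

lemma bounded_bilinear_cinner: "bounded_bilinear (cinner :: 'd::finite L2 \<Rightarrow> 'd L2 \<Rightarrow> complex)"
proof
  show "\<exists>K. \<forall>(a::'d L2) b. norm (cinner a b) \<le> norm a * norm b * K"
    using cinner_Cauchy_Schwarz by (intro exI[of _ 1]) auto
qed (auto simp: cinner_add_left cinner_add_right scaleR_L2_def cinner_scale_left
    cinner_scale_right scaleR_conv_of_real)

lemmas tendsto_cinner = bounded_bilinear.tendsto[OF bounded_bilinear_cinner]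

lemma bounded_linear_scale_L2: "bounded_linear (\<lambda>u. c \<cdot> u :: 'd::finite L2)"
  by (rule bounded_linear_intro[where K = "cmod c"])
    (auto simp: L2.scale_right_distrib scaleR_L2_def mult.commute)

lemma cinner_ext:
  assumes "\<And>w. cinner u w = cinner v w"
  shows "u = v"
proof -
  have "cinner (u - v) (u - v) = 0"
    using assms by (simp add: cinner_diff_left)
  then show ?thesis by (simp add: cinner_self)
qed

text \<open>If the squared increments of a sequence are at most \<open>4\<^sup>-\<^sup>j\<close>, then the sum of
  \<open>2\<^sup>j \<bar>f\<^sub>j\<^sub>+\<^sub>1 - f\<^sub>j\<bar>\<^sup>2\<close> is integrable, whence pointwise convergence almost everywhere.\<close>

lemma AE_convergent_of_fast_Cauchy:
  fixes f :: "nat \<Rightarrow> real ^ 'd \<Rightarrow> complex"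
  assumes [measurable]: "\<And>j. f j \<in> borel_measurable borel"
    and fast: "\<And>j. (\<integral>\<^sup>+ x. ennreal ((cmod (f (Suc j) x - f j x))\<^sup>2) \<partial>lborel) \<le> ennreal ((1/4) ^ j)"
  shows "AE x in lborel. convergent (\<lambda>j. f j x)"
proof -
  define g where "g x = (\<Sum>j. ennreal (2 ^ j * (cmod (f (Suc j) x - f j x))\<^sup>2))" for x
  have [measurable]: "g \<in> borel_measurable borel"
    unfolding g_def by measurable
  have "(\<integral>\<^sup>+ x. g x \<partial>lborel) = (\<Sum>j. \<integral>\<^sup>+ x. ennreal (2 ^ j * (cmod (f (Suc j) x - f j x))\<^sup>2) \<partial>lborel)"
    unfolding g_def by (rule nn_integral_suminf) measurable
  also have "\<dots> = (\<Sum>j. ennreal (2 ^ j) * (\<integral>\<^sup>+ x. ennreal ((cmod (f (Suc j) x - f j x))\<^sup>2) \<partial>lborel))"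
    by (subst nn_integral_cmult[symmetric]) (auto simp: ennreal_mult)
  also have "\<dots> \<le> (\<Sum>j. ennreal (2 ^ j) * ennreal ((1/4) ^ j))"
    by (intro suminf_le mult_left_mono fast) auto
  also have "\<dots> = (\<Sum>j. ennreal ((1/2) ^ j))"
    by (simp add: ennreal_mult[symmetric] power_mult_distrib[symmetric] del: ennreal_power)
  also have "\<dots> = ennreal (\<Sum>j. (1/2) ^ j)"
    by (rule suminf_ennreal2) (auto intro: summable_geometric)
  finally have "(\<integral>\<^sup>+ x. g x \<partial>lborel) \<noteq> \<infinity>"
    using le_less_trans[OF _ ennreal_less_top] by fastforce
  then have "AE x in lborel. g x \<noteq> \<infinity>"
    by (intro nn_integral_PInf_AE) auto
  then show ?thesis
  proof eventually_elim
    case (elim x)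
    define C where "C = enn2real (g x)"
    have gC: "g x = ennreal C"
      using elim by (simp add: C_def top.not_eq_extremum less_top)
    have le: "cmod (f (Suc j) x - f j x) \<le> sqrt C * (sqrt (1/2)) ^ j" for j
    proof -
      have "(\<Sum>i\<in>{j}. ennreal (2 ^ i * (cmod (f (Suc i) x - f i x))\<^sup>2)) \<le> g x"
        unfolding g_def by (rule sum_le_suminf) auto
      then have "ennreal (2 ^ j * (cmod (f (Suc j) x - f j x))\<^sup>2) \<le> ennreal C"
        by (simp add: gC)
      then have "2 ^ j * (cmod (f (Suc j) x - f j x))\<^sup>2 \<le> C"
        using C_def by (simp add: ennreal_le_iff)
      then have "(cmod (f (Suc j) x - f j x))\<^sup>2 \<le> C * (1/2) ^ j"
        by (simp add: field_simps power_one_over)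
      then have "cmod (f (Suc j) x - f j x) \<le> sqrt (C * (1/2) ^ j)"
        by (rule real_le_rsqrt)
      then show ?thesis by (simp add: real_sqrt_mult real_sqrt_power)
    qed
    have "summable (\<lambda>j. sqrt C * (sqrt (1/2)) ^ j)"
      by (intro summable_mult summable_geometric) (simp add: real_sqrt_divide)
    then have "summable (\<lambda>j. cmod (f (Suc j) x - f j x))"
      by (rule summable_comparison_test'[where N = 0]) (use le in auto)
    then have "summable (\<lambda>j. f (Suc j) x - f j x)"
      by (rule summable_norm_cancel)
    then have "convergent (\<lambda>n. \<Sum>j<n. f (Suc j) x - f j x)"
      by (simp add: summable_iff_convergent)
    then have "convergent (\<lambda>n. f n x - f 0 x)"
      unfolding sum_lessThan_telescope[of "\<lambda>j. f j x"] .
    then have "convergent (\<lambda>n. (f n x - f 0 x) + f 0 x)"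
      by (intro convergent_add convergent_const)
    then show ?case by simp
  qed
qed

lemma fast_Cauchy_subseq:
  fixes X :: "nat \<Rightarrow> 'a::metric_space"
  assumes "Cauchy X" and e: "\<And>j :: nat. e j > 0"
  obtains r where "strict_mono r" "\<And>j m n. m \<ge> r j \<Longrightarrow> n \<ge> r j \<Longrightarrow> dist (X m) (X n) < e j"
proof -
  have "\<forall>j. \<exists>M. \<forall>m\<ge>M. \<forall>n\<ge>M. dist (X m) (X n) < e j"
    using assms unfolding Cauchy_def by blast
  then obtain M where M: "\<And>j m n. m \<ge> M j \<Longrightarrow> n \<ge> M j \<Longrightarrow> dist (X m) (X n) < e j"
    by metis
  \<comment> \<open>The sum makes \<open>r j\<close> at least \<open>M j\<close>, and the summand j
    makes r strictly increasing.\<close>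
  define r where "r j = j + (\<Sum>i\<le>j. M i)" for j :: nat
  have "strict_mono r"
    by (rule strict_mono_Suc_iff[THEN iffD2]) (simp add: r_def)
  moreover have "M j \<le> r j" for j
    unfolding r_def using member_le_sum[of j "{..j}" M] by simp
  ultimately show ?thesis
    using that[of r] M by (meson le_trans)
qed

text \<open>Riesz-Fischer: a rapidly Cauchy subsequence converges almost everywhere, Fatou's lemma
  shows that its pointwise limit is also its limit in norm, and a Cauchy sequence with a convergent
  subsequence converges.\<close>

instance L2 :: (finite) complete_space
proof
  fix X :: "nat \<Rightarrow> 'a L2"
  assume X: "Cauchy X"
  obtain r where r: "strict_mono r"
      "\<And>j m n. m \<ge> r j \<Longrightarrow> n \<ge> r j \<Longrightarrow> dist (X m) (X n) < (1/2) ^ j"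
    using fast_Cauchy_subseq[OF X, of "\<lambda>j. (1/2) ^ j"] by auto
  have quarter: "((1/2) ^ j)\<^sup>2 = (1/4 :: real) ^ j" for j
    unfolding power2_eq_square power_mult_distrib[symmetric] by simp
  define f where "f j = rep_L2 (X (r j))" for j
  have f: "square_integrable (f j)" "X (r j) = to_L2 (f j)" for j
    by (auto simp: f_def square_integrable_rep)
  note [measurable] = square_integrableD(1)[OF f(1)]
  have diff: "(\<integral>\<^sup>+ x. ennreal ((cmod (f k x - f j x))\<^sup>2) \<partial>lborel)
      = ennreal ((dist (X (r k)) (X (r j)))\<^sup>2)"
    for k j
    unfolding dist_norm f(2) diff_to_L2[OF f(1) f(1)]
    by (rule ennreal_norm_L2[OF square_integrable_diff[OF f(1) f(1)]])
  have le: "(\<integral>\<^sup>+ x. ennreal ((cmod (f k x - f j x))\<^sup>2) \<partial>lborel) \<le> ennreal ((1/4) ^ j)" if "k \<ge> j"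
      for k j
  proof -
    have "dist (X (r k)) (X (r j)) < (1/2) ^ j"
      using r that by (simp add: strict_mono_less_eq)
    then have "(dist (X (r k)) (X (r j)))\<^sup>2 \<le> ((1/2) ^ j)\<^sup>2"
      by (intro power_mono) auto
    also have "\<dots> = (1/4) ^ j"
      by (rule quarter)
    finally show ?thesis
      unfolding diff by (rule ennreal_leI)
  qed
  \<comment> \<open>Since \<open>lim\<close> is total, g is defined everywhere and remains Borel;
    its values where the sequence diverges do not matter.\<close>
  define g where "g x = lim (\<lambda>j. f j x)" for x
  have [measurable]: "g \<in> borel_measurable borel"
    unfolding g_def by (rule borel_measurable_lim_metric) measurable
  have conv: "AE x in lborel. (\<lambda>j. f j x) \<longlonglongrightarrow> g x"
    using AE_convergent_of_fast_Cauchy[of f, OF _ le] by (auto simp: g_def convergent_LIMSEQ_iff)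
  \<comment> \<open>Fatou's lemma in k, with j fixed.\<close>
  have gle: "(\<integral>\<^sup>+ x. ennreal ((cmod (g x - f j x))\<^sup>2) \<partial>lborel) \<le> ennreal ((1/4) ^ j)" for j
  proof -
    have "(\<integral>\<^sup>+ x. ennreal ((cmod (g x - f j x))\<^sup>2) \<partial>lborel)
        = (\<integral>\<^sup>+ x. liminf (\<lambda>k. ennreal ((cmod (f k x - f j x))\<^sup>2)) \<partial>lborel)"
    proof (rule nn_integral_cong_AE, use conv in eventually_elim)
      case (elim x)
      have "(\<lambda>k. ennreal ((cmod (f k x - f j x))\<^sup>2)) \<longlonglongrightarrow> ennreal ((cmod (g x - f j x))\<^sup>2)"
        by (intro tendsto_intros elim)
      then show ?case
        by (metis lim_imp_Liminf trivial_limit_sequentially)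
    qed
    also have "\<dots> \<le> liminf (\<lambda>k. \<integral>\<^sup>+ x. ennreal ((cmod (f k x - f j x))\<^sup>2) \<partial>lborel)"
      by (rule nn_integral_liminf) measurable
    also have "\<dots> \<le> limsup (\<lambda>k. \<integral>\<^sup>+ x. ennreal ((cmod (f k x - f j x))\<^sup>2) \<partial>lborel)"
      by (rule Liminf_le_Limsup) simp
    also have "\<dots> \<le> ennreal ((1/4) ^ j)"
      by (rule Limsup_bounded) (use le in \<open>auto intro: eventually_sequentiallyI[of j]\<close>)
    finally show ?thesis .
  qed
  have "square_integrable (\<lambda>x. g x - f 0 x)"
    using le_less_trans[OF gle[of 0] ennreal_less_top]
    by (simp add: square_integrable_def)
  then have "square_integrable (\<lambda>x. (g x - f 0 x) + f 0 x)"
    using f by (intro square_integrable_add)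
  then have g: "square_integrable g"
    by simp
  have "dist (X (r j)) (to_L2 g) \<le> (1/2) ^ j" for j
  proof -
    have "ennreal ((norm (to_L2 g - X (r j)))\<^sup>2) \<le> ennreal ((1/4) ^ j)"
      using gle[of j] ennreal_norm_L2[OF square_integrable_diff[OF g f(1)], of j]
      unfolding f(2) diff_to_L2[OF g f(1)] by simp
    then have "(norm (to_L2 g - X (r j)))\<^sup>2 \<le> ((1/2) ^ j)\<^sup>2"
      unfolding quarter by (subst (asm) ennreal_le_iff) auto
    then have "norm (to_L2 g - X (r j)) \<le> (1/2) ^ j"
      by (rule power2_le_imp_le) auto
    then show ?thesis
      by (simp only: dist_norm norm_minus_commute)
  qed
  then have "(\<lambda>j. dist (X (r j)) (to_L2 g)) \<longlonglongrightarrow> 0"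
    by (intro tendsto_sandwich[OF _ _ tendsto_const LIMSEQ_power_zero[of "1/2::real"]])
      (simp_all add: always_eventually del: eventually_sequentially)
  then have "(X \<circ> r) \<longlonglongrightarrow> to_L2 g"
    by (subst tendsto_dist_iff) (simp only: o_def)
  then have "X \<longlonglongrightarrow> to_L2 g"
    by (rule Cauchy_converges_subseq[OF X r(1)])
  then show "convergent X"
    by (rule convergentI)
qed

subsection \<open>Multiplication by bounded functions and complex conjugation\<close>

definition bounded_measurable :: "(real ^ 'd \<Rightarrow> complex) \<Rightarrow> bool" where
  "bounded_measurable m \<longleftrightarrow> m \<in> borel_measurable borel \<and> (\<exists>C. \<forall>x. cmod (m x) \<le> C)"

lemma bounded_measurableI:
  "m \<in> borel_measurable borel \<Longrightarrow> (\<And>x. cmod (m x) \<le> C) \<Longrightarrow> bounded_measurable m"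
  by (auto simp: bounded_measurable_def)

lemma square_integrable_mult:
  assumes "bounded_measurable m" "square_integrable f"
  shows "square_integrable (\<lambda>x. m x * f x)"
proof -
  obtain C where C: "\<And>x. cmod (m x) \<le> C" and [measurable]: "m \<in> borel_measurable borel"
    using assms by (auto simp: bounded_measurable_def)
  note [measurable] = square_integrableD(1)[OF assms(2)]
  show ?thesis
    by (rule square_integrable_bound[OF assms(2), where C = C])
      (auto simp: norm_mult intro!: mult_right_mono C)
qed

text \<open>Boundedness of m is replaced by square-integrability of the product, because the
  unbounded symbol of the fractional Laplacian has to be applied to elements of its domain.\<close>

lemma mult_to_L2:
  assumes "square_integrable f" "m \<in> borel_measurable borel" "square_integrable (\<lambda>x. m x * f x)"
  shows "mult_L2 m (to_L2 f) = to_L2 (\<lambda>x. m x * f x)"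
  unfolding mult_L2_def
proof (rule to_L2_cong)
  note [measurable] = assms(2) square_integrableD(1)[OF square_integrable_rep]
  have AE: "AE x in lborel. m x * rep_L2 (to_L2 f) x = m x * f x"
    using rep_to_L2[OF assms(1)] by eventually_elim simp
  have "(\<integral>\<^sup>+ x. ennreal ((cmod (m x * rep_L2 (to_L2 f) x))\<^sup>2) \<partial>lborel)
      = (\<integral>\<^sup>+ x. ennreal ((cmod (m x * f x))\<^sup>2) \<partial>lborel)"
    by (rule nn_integral_cong_AE) (use AE in eventually_elim, metis)
  then show "square_integrable (\<lambda>x. m x * rep_L2 (to_L2 f) x)"
    using assms by (simp add: square_integrable_def)
qed (use rep_to_L2[OF assms(1)] assms in auto)

lemma bmult_to_L2:
  assumes "bounded_measurable m" "square_integrable f"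
  shows "mult_L2 m (to_L2 f) = to_L2 (\<lambda>x. m x * f x)"
  using assms square_integrable_mult[OF assms] by (intro mult_to_L2) (auto simp: bounded_measurable_def)

lemma
  assumes m: "bounded_measurable m"
  shows mult_L2_add: "mult_L2 m (u + w) = mult_L2 m u + mult_L2 m w"
    and mult_L2_diff: "mult_L2 m (u - w) = mult_L2 m u - mult_L2 m w"
    and mult_L2_scale: "mult_L2 m (c \<cdot> u) = c \<cdot> mult_L2 m u"
proof -
  obtain f g where *: "square_integrable f" "square_integrable g" "u = to_L2 f" "w = to_L2 g"
    using L2_cases by metis
  show "mult_L2 m (u + w) = mult_L2 m u + mult_L2 m w"
    unfolding * using * m
    by (simp add: add_to_L2 bmult_to_L2 square_integrable_add square_integrable_mult distrib_left)
  show "mult_L2 m (u - w) = mult_L2 m u - mult_L2 m w"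
    unfolding * using * m
    by (simp add: diff_to_L2 bmult_to_L2 square_integrable_diff square_integrable_mult
        right_diff_distrib)
  show "mult_L2 m (c \<cdot> u) = c \<cdot> mult_L2 m u"
    unfolding * using * m
    by (simp add: scale_to_L2 bmult_to_L2 square_integrable_scale square_integrable_mult
        mult.left_commute)
qed

lemma bounded_measurable_mult:
  assumes "bounded_measurable l" "bounded_measurable m"
  shows "bounded_measurable (\<lambda>x. l x * m x)"
proof -
  obtain C D where "\<And>x. cmod (l x) \<le> C" "\<And>x. cmod (m x) \<le> D"
    using assms by (auto simp: bounded_measurable_def)
  then have "cmod (l x * m x) \<le> C * D" for x
    by (simp add: norm_mult mult_mono' order_trans[OF norm_ge_zero])
  then show ?thesis
    using assms by (intro bounded_measurableI[where C = "C * D"]) (auto simp: bounded_measurable_def)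
qed

lemma mult_L2_mult:
  assumes "bounded_measurable l" "bounded_measurable m"
  shows "mult_L2 l (mult_L2 m u) = mult_L2 (\<lambda>x. l x * m x) u"
proof -
  obtain f where *: "square_integrable f" "u = to_L2 f"
    using L2_cases by metis
  show ?thesis
    unfolding * using * assms
    by (simp add: bmult_to_L2 square_integrable_mult bounded_measurable_mult mult.assoc)
qed

lemma cinner_mult_L2_right:
  assumes m: "bounded_measurable m"
  shows "cinner u (mult_L2 m w) = cinner (mult_L2 (\<lambda>x. cnj (m x)) u) w"
proof -
  have m': "bounded_measurable (\<lambda>x. cnj (m x))"
    using m by (auto simp: bounded_measurable_def)
  obtain f g where *: "square_integrable f" "square_integrable g" "u = to_L2 f" "w = to_L2 g"
    using L2_cases by metis
  have "cinner u (mult_L2 m w) = (\<integral>x. f x * cnj (m x * g x) \<partial>lborel)"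
    using * m by (simp only: bmult_to_L2 square_integrable_mult cinner_to_L2)
  also have "\<dots> = (\<integral>x. (cnj (m x) * f x) * cnj (g x) \<partial>lborel)"
    by (simp add: mult_ac)
  also have "\<dots> = cinner (mult_L2 (\<lambda>x. cnj (m x)) u) w"
    using * m' by (simp only: bmult_to_L2 square_integrable_mult cinner_to_L2)
  finally show ?thesis .
qed

lemma norm_mult_L2_le:
  assumes "m \<in> borel_measurable borel" "\<And>x. cmod (m x) \<le> C"
  shows "norm (mult_L2 m u) \<le> C * norm u"
proof -
  have m: "bounded_measurable m"
    using assms by (rule bounded_measurableI)
  have "0 \<le> C"
    using assms(2)[of undefined] norm_ge_zero order_trans by blast
  obtain f where *: "square_integrable f" "u = to_L2 f"
    using L2_cases by metis
  have "(norm (mult_L2 m u))\<^sup>2 = (\<integral>x. (cmod (m x * f x))\<^sup>2 \<partial>lborel)"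
    by (simp add: * m bmult_to_L2 norm_L2_to_L2 square_integrable_mult)
  also have "\<dots> \<le> (\<integral>x. C\<^sup>2 * (cmod (f x))\<^sup>2 \<partial>lborel)"
    using square_integrableD(2)[OF *(1)] square_integrableD(2)[OF square_integrable_mult[OF m *(1)]]
    by (intro integral_mono) (auto simp: norm_mult power_mult_distrib intro!: mult_right_mono
        power_mono assms)
  also have "\<dots> = (C * norm u)\<^sup>2"
    by (simp add: * norm_L2_to_L2 power_mult_distrib)
  finally show ?thesis
    using \<open>0 \<le> C\<close> by (simp add: power2_le_iff_abs_le)
qed

lemma bounded_linear_mult_L2:
  assumes "bounded_measurable m"
  shows "bounded_linear (mult_L2 m)"
proof -
  obtain C where C: "\<And>x. cmod (m x) \<le> C" and m: "m \<in> borel_measurable borel"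
    using assms by (auto simp: bounded_measurable_def)
  show ?thesis
    by (rule bounded_linear_intro[where K = C])
      (auto simp: assms mult_L2_add mult_L2_scale scaleR_L2_def mult.commute[of _ C]
          norm_mult_L2_le[OF m C])
qed

section \<open>Complex conjugation on L^2\<close>

definition cnj_L2 :: "'d::finite L2 \<Rightarrow> 'd L2" where
  "cnj_L2 u = to_L2 (\<lambda>x. cnj (rep_L2 u x))"

lemma cnj_to_L2:
  assumes "square_integrable f"
  shows "cnj_L2 (to_L2 f) = to_L2 (\<lambda>x. cnj (f x))"
  unfolding cnj_L2_def
  by (rule to_L2_cong) (use rep_to_L2[OF assms]
      in \<open>auto intro: assms square_integrable_cnj square_integrable_rep\<close>)

lemma cnj_cnj_L2 [simp]: "cnj_L2 (cnj_L2 u) = u"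
  by (rule L2_cases[of u]) (simp add: cnj_to_L2 square_integrable_cnj)

lemma cnj_L2_add: "cnj_L2 (u + w) = cnj_L2 u + cnj_L2 w"
  by (rule L2_cases[of u], rule L2_cases[of w])
    (simp add: cnj_to_L2 add_to_L2 square_integrable_cnj square_integrable_add)

lemma cnj_L2_scale: "cnj_L2 (c \<cdot> u) = cnj c \<cdot> cnj_L2 u"
  by (rule L2_cases[of u]) (simp add: cnj_to_L2 scale_to_L2 square_integrable_cnj
      square_integrable_scale)

lemma norm_cnj_L2 [simp]: "norm (cnj_L2 u) = norm u"
proof (rule L2_cases[of u])
  fix f assume f: "square_integrable f" "u = to_L2 f"
  then have "(norm (cnj_L2 u))\<^sup>2 = (norm u)\<^sup>2"
    by (simp only: cnj_to_L2 square_integrable_cnj norm_L2_to_L2 complex_mod_cnj)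
  then show ?thesis by (simp add: power2_eq_iff_nonneg)
qed

lemma bounded_linear_cnj_L2: "bounded_linear (cnj_L2 :: 'd::finite L2 \<Rightarrow> 'd L2)"
  by (rule bounded_linear_intro[where K = 1]) (auto simp: cnj_L2_add cnj_L2_scale scaleR_L2_def)

subsection \<open>Gaussian integrals\<close>

text \<open>Lebesgue measure is the image of a product of one-dimensional measures under the
  coordinate map. This reduces Gaussian integrals to dimension one.\<close>

lemma lborel_prod_Bochner:
  fixes f :: "'a::euclidean_space \<Rightarrow> real \<Rightarrow> complex"
  assumes f: "\<And>b. b \<in> Basis \<Longrightarrow> integrable lborel (f b)"
  shows "integrable lborel (\<lambda>x. \<Prod>b\<in>Basis. f b (x \<bullet> b))"
    and "(\<integral>x. (\<Prod>b\<in>Basis. f b (x \<bullet> b)) \<partial>lborel) = (\<Prod>b\<in>Basis. \<integral>x. f b x \<partial>lborel)"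
proof -
  interpret product_sigma_finite "\<lambda>_::'a. lborel :: real measure" ..
  let ?T = "\<lambda>x. \<Sum>b\<in>(Basis :: 'a set). x b *\<^sub>R b"
  let ?P = "Pi\<^sub>M (Basis :: 'a set) (\<lambda>_. lborel :: real measure)"
  have [measurable]: "b \<in> Basis \<Longrightarrow> f b \<in> borel_measurable borel" for b
    using f by (auto dest: borel_measurable_integrable)
  have T [measurable]: "?T \<in> measurable ?P borel"
    by measurable
  have F [measurable]: "(\<lambda>x. \<Prod>b\<in>Basis. f b (x \<bullet> b)) \<in> borel_measurable borel"
    by measurable
  have [simp]: "(\<Prod>b\<in>Basis. f b (?T x \<bullet> b)) = (\<Prod>b\<in>Basis. f b (x b))" for x
    by (intro prod.cong) auto
  show "integrable lborel (\<lambda>x. \<Prod>b\<in>Basis. f b (x \<bullet> b))"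
    by (subst lborel_eq, subst integrable_distr_eq[OF T F]) (auto intro!: product_integrable_prod f)
  show "(\<integral>x. (\<Prod>b\<in>Basis. f b (x \<bullet> b)) \<partial>lborel) = (\<Prod>b\<in>Basis. \<integral>x. f b x \<partial>lborel)"
    by (subst lborel_eq, subst integral_distr[OF T F]) (auto intro!: product_integral_prod f)
qed

text \<open>This is the characteristic function of the standard normal distribution at
  \<open>- \<xi>\<close>, freed of the normalisation of the density.\<close>

lemma Gaussian_1d:
  "integrable lborel (\<lambda>x. cis (- (x * \<xi>)) * of_real (exp (- x\<^sup>2 / 2)))"
  "(\<integral>x. cis (- (x * \<xi>)) * of_real (exp (- x\<^sup>2 / 2)) \<partial>lborel)
      = of_real (sqrt (2 * pi) * exp (- \<xi>\<^sup>2 / 2))"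
proof -
  have eq: "cis (- (x * \<xi>)) * of_real (exp (- x\<^sup>2 / 2))
      = of_real (sqrt (2 * pi)) * (std_normal_density x *\<^sub>R iexp ((- \<xi>) * x))" for x
    by (simp add: std_normal_density_def cis_conv_exp scaleR_conv_of_real mult_ac)
  have m: "(\<lambda>x. iexp ((- \<xi>) * x)) \<in> borel_measurable lborel"
    by measurable
  have "integrable lborel (\<lambda>x. std_normal_density x *\<^sub>R iexp ((- \<xi>) * x))"
    by (rule Bochner_Integration.integrable_bound[OF integrable_normal_density[of 1 0]]) auto
  then show "integrable lborel (\<lambda>x. cis (- (x * \<xi>)) * of_real (exp (- x\<^sup>2 / 2)))"
    unfolding eq by (rule integrable_mult_right)
  have "(\<integral>x. std_normal_density x *\<^sub>R iexp ((- \<xi>) * x) \<partial>lborel)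
      = (\<integral>x. iexp ((- \<xi>) * x) \<partial>std_normal_distribution)"
    by (subst integral_density[OF m]) auto
  also have "\<dots> = char std_normal_distribution (- \<xi>)"
    by (simp add: char_def)
  also have "\<dots> = of_real (exp (- \<xi>\<^sup>2 / 2))"
    by (simp add: char_std_normal_distribution)
  finally show "(\<integral>x. cis (- (x * \<xi>)) * of_real (exp (- x\<^sup>2 / 2)) \<partial>lborel)
      = of_real (sqrt (2 * pi) * exp (- \<xi>\<^sup>2 / 2))"
    unfolding eq by (simp only: integral_mult_right_zero of_real_mult)
qed

lemma cis_sum: "finite I \<Longrightarrow> cis (\<Sum>i\<in>I. f i) = (\<Prod>i\<in>I. cis (f i))"
  by (induction I rule: finite_induct) (auto simp: cis_mult[symmetric])

lemma Gaussian_integral: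
  fixes \<xi> :: "'a::euclidean_space"
  shows "integrable lborel (\<lambda>x. cis (- (x \<bullet> \<xi>)) * of_real (exp (- (norm x)\<^sup>2 / 2)))"
    and "(\<integral>x. cis (- (x \<bullet> \<xi>)) * of_real (exp (- (norm x)\<^sup>2 / 2)) \<partial>lborel)
      = of_real (sqrt (2 * pi) ^ DIM('a) * exp (- (norm \<xi>)\<^sup>2 / 2))"
proof -
  define f where "f b x = cis (- (x * (\<xi> \<bullet> b))) * of_real (exp (- x\<^sup>2 / 2))" for b x
  have n: "(norm x)\<^sup>2 = (\<Sum>b\<in>Basis. (x \<bullet> b)\<^sup>2)" for x :: 'a
    unfolding power2_norm_eq_inner by (subst euclidean_inner) (simp add: power2_eq_square)
  have e: "exp (- (norm x)\<^sup>2 / 2) = (\<Prod>b\<in>Basis. exp (- (x \<bullet> b)\<^sup>2 / 2))" for x :: 'a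
    by (simp add: n exp_sum[symmetric] sum_divide_distrib sum_negf)
  have eq: "cis (- (x \<bullet> \<xi>)) * of_real (exp (- (norm x)\<^sup>2 / 2)) = (\<Prod>b\<in>Basis. f b (x \<bullet> b))" for x :: 'a
    unfolding f_def prod.distrib e
    by (simp add: euclidean_inner[of x \<xi>] sum_negf[symmetric] cis_sum)
  note P = lborel_prod_Bochner[of f, OF Gaussian_1d(1)[of "\<xi> \<bullet> b" for b, folded f_def]]
  show "integrable lborel (\<lambda>x. cis (- (x \<bullet> \<xi>)) * of_real (exp (- (norm x)\<^sup>2 / 2)))"
    unfolding eq by (rule P)
  have "(\<Prod>b\<in>Basis. \<integral>x. f b x \<partial>lborel) = of_real (sqrt (2 * pi) ^ DIM('a) * exp (- (norm \<xi>)\<^sup>2 / 2))"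
    unfolding f_def Gaussian_1d(2) e by (simp add: prod.distrib)
  then show "(\<integral>x. cis (- (x \<bullet> \<xi>)) * of_real (exp (- (norm x)\<^sup>2 / 2)) \<partial>lborel)
      = of_real (sqrt (2 * pi) ^ DIM('a) * exp (- (norm \<xi>)\<^sup>2 / 2))"
    unfolding eq P(2) .
qed

section \<open>Affine changes of variables\<close>

lemma nn_integral_lborel_affine:
  fixes t :: "'a::euclidean_space"
  assumes "c \<noteq> 0" and [measurable]: "f \<in> borel_measurable borel"
  shows "(\<integral>\<^sup>+ x. f x \<partial>lborel) = ennreal (\<bar>c\<bar> ^ DIM('a)) * (\<integral>\<^sup>+ x. f (t + c *\<^sub>R x) \<partial>lborel)"
  by (subst lborel_affine[OF assms(1), of t])
    (simp add: nn_integral_density nn_integral_distr nn_integral_cmult)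

lemma integral_lborel_affine:
  fixes t :: "'a::euclidean_space" and f :: "'a \<Rightarrow> 'b::{banach, second_countable_topology}"
  assumes "c \<noteq> 0" and [measurable]: "f \<in> borel_measurable borel"
  shows "(\<integral>x. f x \<partial>lborel) = (\<bar>c\<bar> ^ DIM('a)) *\<^sub>R (\<integral>x. f (t + c *\<^sub>R x) \<partial>lborel)"
proof -
  have "(\<integral>x. f x \<partial>lborel)
      = (\<integral>x. f x \<partial>density (distr lborel borel (\<lambda>x. t + c *\<^sub>R x)) (\<lambda>_. ennreal (\<bar>c\<bar> ^ DIM('a))))"
    using lborel_affine[OF assms(1), of t] by simp
  also have "\<dots> = (\<integral>x. (\<bar>c\<bar> ^ DIM('a)) *\<^sub>R f x \<partial>distr lborel borel (\<lambda>x. t + c *\<^sub>R x))"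
    by (subst integral_density) auto
  also have "\<dots> = (\<bar>c\<bar> ^ DIM('a)) *\<^sub>R (\<integral>x. f (t + c *\<^sub>R x) \<partial>lborel)"
    by (subst integral_distr) auto
  finally show ?thesis .
qed

lemma integrable_lborel_affine:
  fixes t :: "'a::euclidean_space" and f :: "'a \<Rightarrow> 'b::{banach, second_countable_topology}"
  assumes "c \<noteq> 0" "integrable lborel f"
  shows "integrable lborel (\<lambda>x. f (t + c *\<^sub>R x))"
proof -
  have [measurable]: "f \<in> borel_measurable borel"
    using assms(2) by (auto dest: borel_measurable_integrable)
  have "(\<integral>\<^sup>+ x. ennreal (norm (f x)) \<partial>lborel)
      = ennreal (\<bar>c\<bar> ^ DIM('a)) * (\<integral>\<^sup>+ x. ennreal (norm (f (t + c *\<^sub>R x))) \<partial>lborel)"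
    by (rule nn_integral_lborel_affine[OF assms(1)]) measurable
  moreover have "(\<integral>\<^sup>+ x. ennreal (norm (f x)) \<partial>lborel) < \<infinity>"
    using assms(2) by (simp add: integrable_iff_bounded)
  ultimately have "(\<integral>\<^sup>+ x. ennreal (norm (f (t + c *\<^sub>R x))) \<partial>lborel) < \<infinity>"
    using assms(1) by (auto simp: ennreal_mult_less_top)
  then show ?thesis
    by (intro integrableI_bounded) auto
qed

text \<open>Up to a constant, \<open>heat t\<close> is the Fourier transform of \<open>gauss t\<close>, and it is an approximate
  identity as \<open>t\<close> tends to 0.\<close>

definition gauss :: "real \<Rightarrow> real ^ 'd \<Rightarrow> real" where
  "gauss t \<xi> = exp (- (norm (t *\<^sub>R \<xi>))\<^sup>2 / 2)"

definition heat :: "real \<Rightarrow> real ^ 'd \<Rightarrow> real" where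
  "heat t x = (2 * pi) powr (- real CARD('d) / 2) * (1 / t) ^ CARD('d) * gauss (1 / t) x"

lemma gauss_measurable [measurable]: "gauss t \<in> borel_measurable borel"
  unfolding gauss_def by measurable

lemma heat_measurable [measurable]: "heat t \<in> borel_measurable borel"
  unfolding heat_def by measurable

lemma gauss_pos: "gauss t x > 0" and gauss_le_1: "gauss t x \<le> 1"
  by (auto simp: gauss_def)

lemma heat_nonneg: "t > 0 \<Longrightarrow> heat t x \<ge> 0"
  by (auto simp: heat_def intro!: mult_nonneg_nonneg less_imp_le[OF gauss_pos])

lemma fourier_normalization: "((2 * pi) powr (- real CARD('d) / 2)) * sqrt
    (2 * pi) ^ CARD('d::finite) = 1"
proof -
  have "sqrt (2 * pi) ^ CARD('d) = (2 * pi) powr (real CARD('d) / 2)"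
    by (simp add: powr_half_sqrt[symmetric] powr_realpow[symmetric] powr_powr)
  then show ?thesis
    by (simp add: powr_add[symmetric])
qed

lemma fourier_gauss_1:
  "fourier_integral (\<lambda>x. of_real (gauss 1 x)) \<xi> = of_real (gauss 1 \<xi>)"
  unfolding fourier_integral_def gauss_def
  using Gaussian_integral(2)[of \<xi>] fourier_normalization[where 'd='a]
  by (simp add: mult.assoc[symmetric] flip: of_real_mult)

lemma integrable_modulated_gauss:
  assumes "t > 0"
  shows "integrable lborel (\<lambda>\<xi>. cis (a \<bullet> \<xi>) * of_real (gauss t \<xi>))"
proof -
  have "integrable lborel (\<lambda>x. cis (- (x \<bullet> (- (a /\<^sub>R t)))) * of_real (exp (- (norm x)\<^sup>2 / 2)))"
    by (rule Gaussian_integral(1))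
  from integrable_lborel_affine[OF _ this, of t 0] show ?thesis
    using assms by (simp add: gauss_def inner_commute field_simps)
qed

lemma integrable_gauss: "t > 0 \<Longrightarrow> integrable lborel (gauss t)"
  using integrable_modulated_gauss[of t 0] by (simp add: complex_of_real_integrable_eq)

text \<open>The substitution \<xi> / t reduces this to the standard Gaussian, and modulation by a
  turns into translation by a. The power of 2 \<pi> appears because \<open>heat\<close> is
  normalised to have integral one.\<close>

lemma fourier_modulated_gauss:
  fixes a :: "real ^ 'd"
  assumes "t > 0"
  shows "fourier_integral (\<lambda>\<xi>. cis (a \<bullet> \<xi>) * of_real (gauss t \<xi>)) x
      = of_real (heat t (x - a) * (2 * pi) powr (real CARD('d) / 2))"
proof -
  have "(\<integral>\<xi>. cis (- (\<xi> \<bullet> x)) * (cis (a \<bullet> \<xi>) * of_real (gauss t \<xi>)) \<partial>lborel)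
      = (\<bar>1/t\<bar> ^ DIM(real ^ 'd)) *\<^sub>R
        (\<integral>\<xi>. cis (- (((1/t) *\<^sub>R \<xi>) \<bullet> x)) * (cis (a \<bullet> ((1/t) *\<^sub>R \<xi>)) * of_real
            (gauss t ((1/t) *\<^sub>R \<xi>))) \<partial>lborel)"
    using integral_lborel_affine[of "1/t" "\<lambda>\<xi>. cis (- (\<xi> \<bullet> x)) * (cis (a \<bullet> \<xi>) * of_real (gauss t \<xi>))" 0]
      assms by (auto simp: cis_conv_exp)
  also have "(\<integral>\<xi>. cis (- (((1/t) *\<^sub>R \<xi>) \<bullet> x)) * (cis (a \<bullet> ((1/t) *\<^sub>R \<xi>)) * of_real
      (gauss t ((1/t) *\<^sub>R \<xi>))) \<partial>lborel)
      = (\<integral>\<xi>. cis (- (\<xi> \<bullet> ((1/t) *\<^sub>R (x - a)))) * of_real (exp (- (norm \<xi>)\<^sup>2 / 2)) \<partial>lborel)"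
    using assms
    by (simp add: gauss_def mult.assoc[symmetric] cis_mult inner_commute[of a] inner_diff_right
        diff_divide_distrib)
  also have "\<dots> = of_real (sqrt (2 * pi) ^ CARD('d) * exp (- (norm ((1/t) *\<^sub>R (x - a)))\<^sup>2 / 2))"
    by (subst Gaussian_integral(2)) simp
  finally have "fourier_integral (\<lambda>\<xi>. cis (a \<bullet> \<xi>) * of_real (gauss t \<xi>)) x
      = of_real ((((2 * pi) powr (- real CARD('d) / 2)) * sqrt
          (2 * pi) ^ CARD('d)) * ((1 / t) ^ CARD('d) * gauss (1/t) (x - a)))"
    using assms unfolding fourier_integral_def
    by (simp add: gauss_def scaleR_conv_of_real mult_ac)
  also have "\<dots> = of_real (heat t (x - a) * (2 * pi) powr (real CARD('d) / 2))"
    unfolding fourier_normalization by (simp add: heat_def powr_minus divide_simps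
        powr_add[symmetric] mult_ac)
  finally show ?thesis .
qed

lemma heat_integral:
  assumes "t > 0"
  shows "integrable lborel (heat t :: real ^ 'a \<Rightarrow> real)"
    and "(\<integral>x. heat t x \<partial>(lborel :: (real ^ 'a) measure)) = 1"
proof -
  show "integrable lborel (heat t :: real ^ 'a \<Rightarrow> real)"
    unfolding heat_def[abs_def] using integrable_gauss[of "1/t"] assms by auto
  \<comment> \<open>The total mass of a Gaussian is its Fourier integral at the origin, up to
    normalisation.\<close>
  have "complex_of_real ((2 * pi) powr (- real CARD('a) / 2) * (\<integral>x. gauss (1/t)
      x \<partial>(lborel :: (real ^ 'a) measure)))
      = fourier_integral (\<lambda>\<xi>. cis (0 \<bullet> \<xi>) * of_real (gauss (1/t) \<xi>)) (0 :: real ^ 'a)"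
    by (simp add: fourier_integral_def cis_zero integral_complex_of_real)
  also have "\<dots> = of_real (t ^ CARD('a))"
    using assms by (subst fourier_modulated_gauss)
      (auto simp: heat_def gauss_def powr_minus divide_simps powr_add[symmetric])
  finally have "(2 * pi) powr (- real CARD('a) / 2) * (\<integral>x. gauss (1/t)
      x \<partial>(lborel :: (real ^ 'a) measure)) = t ^ CARD('a)"
    using of_real_eq_iff by blast
  then show "(\<integral>x. heat t x \<partial>(lborel :: (real ^ 'a) measure)) = 1"
    using assms unfolding heat_def by (simp add: mult_ac power_one_over)
qed

lemma nn_integral_heat:
  fixes a :: "real ^ 'd"
  assumes "t > 0"
  shows "(\<integral>\<^sup>+ x. ennreal (heat t (x - a)) \<partial>lborel) = 1" "(\<integral>\<^sup>+ x. ennreal (heat t (a - x)) \<partial>lborel) = 1"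
proof -
  have "(\<integral>\<^sup>+ x. ennreal (heat t x) \<partial>(lborel :: (real ^ 'd) measure))
      = ennreal (\<integral>x. heat t x \<partial>(lborel :: (real ^ 'd) measure))"
    by (rule nn_integral_eq_integral[OF heat_integral(1)[OF assms]]) (simp add: heat_nonneg assms)
  then have 1: "(\<integral>\<^sup>+ x. ennreal (heat t x) \<partial>(lborel :: (real ^ 'd) measure)) = 1"
    by (simp add: heat_integral(2)[OF assms])
  show "(\<integral>\<^sup>+ x. ennreal (heat t (x - a)) \<partial>lborel) = 1"
    using nn_integral_lborel_affine[of 1 "\<lambda>x. ennreal (heat t x)" "-a"] 1 by simp
  show "(\<integral>\<^sup>+ x. ennreal (heat t (a - x)) \<partial>lborel) = 1"
    using nn_integral_lborel_affine[of "-1" "\<lambda>x. ennreal (heat t x)" a] 1 by simp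
qed

subsection \<open>The Fourier integral on $L^1$\<close>

lemma cis_measurable [measurable]: "f \<in> borel_measurable M \<Longrightarrow> (\<lambda>x. cis (f x)) \<in> borel_measurable M"
  unfolding cis_conv_exp by measurable

lemma fourier_integral_bound:
  fixes f :: "real ^ 'd \<Rightarrow> complex"
  assumes "integrable lborel f"
  shows "cmod (fourier_integral f \<xi>) \<le> (2 * pi) powr (- real CARD('d) / 2) * (\<integral>x. cmod (f x) \<partial>lborel)"
proof -
  have "cmod (\<integral>x. cis (- (x \<bullet> \<xi>)) * f x \<partial>lborel) \<le> (\<integral>x. cmod (f x) \<partial>lborel)"
    using integral_norm_bound[of lborel "\<lambda>x. cis (- (x \<bullet> \<xi>)) * f x"] by (simp add: norm_mult)
  then show ?thesis
    by (simp add: fourier_integral_def norm_mult mult_left_mono)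
qed

lemma integrable_cis_mult:
  assumes "integrable lborel f"
  shows "integrable lborel (\<lambda>x. cis (- (x \<bullet> \<xi>)) * f x)" "integrable lborel (\<lambda>x. cis (x \<bullet> \<xi>) * f x)"
proof -
  have [measurable]: "f \<in> borel_measurable borel"
    using assms by (auto dest: borel_measurable_integrable)
  show "integrable lborel (\<lambda>x. cis (- (x \<bullet> \<xi>)) * f x)" "integrable lborel (\<lambda>x. cis (x \<bullet> \<xi>) * f x)"
    by (rule Bochner_Integration.integrable_bound[OF assms]; simp add: norm_mult)+
qed

lemma fourier_integral_diff:
  assumes "integrable lborel f" "integrable lborel g"
  shows "fourier_integral (\<lambda>x. f x - g x) \<xi> = fourier_integral f \<xi> - fourier_integral g \<xi>"
  using integrable_cis_mult(1)[OF assms(1)] integrable_cis_mult(1)[OF assms(2)]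
  by (simp add: fourier_integral_def right_diff_distrib)

lemma fourier_integral_add:
  assumes "integrable lborel f" "integrable lborel g"
  shows "fourier_integral (\<lambda>x. f x + g x) \<xi> = fourier_integral f \<xi> + fourier_integral g \<xi>"
  using integrable_cis_mult(1)[OF assms(1)] integrable_cis_mult(1)[OF assms(2)]
  by (simp add: fourier_integral_def distrib_left)

lemma fourier_integral_scale: "fourier_integral (\<lambda>x. c * f x) \<xi> = c * fourier_integral f \<xi>"
  by (simp add: fourier_integral_def mult.left_commute)

lemma fourier_integral_measurable [measurable]:
  assumes [measurable]: "f \<in> borel_measurable borel"
  shows "fourier_integral f \<in> borel_measurable borel"
  unfolding fourier_integral_def[abs_def] by measurable

lemma integrable_bounded_mult:
  fixes f g :: "real ^ 'd \<Rightarrow> complex"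
  assumes "integrable lborel f" "bounded_measurable g"
  shows "integrable lborel (\<lambda>x. f x * g x)"
proof -
  obtain C where C: "\<And>x. cmod (g x) \<le> C" and [measurable]: "g \<in> borel_measurable borel"
    using assms by (auto simp: bounded_measurable_def)
  have [measurable]: "f \<in> borel_measurable borel"
    using assms by (auto dest: borel_measurable_integrable)
  show ?thesis
  proof (rule Bochner_Integration.integrable_bound)
    show "integrable lborel (\<lambda>x. C * cmod (f x))"
      using assms by auto
    have "cmod (f x * g x) \<le> norm (C * cmod (f x))" for x
      using mult_right_mono[OF order_trans[OF C abs_ge_self], of "cmod (f x)" x]
      by (simp add: norm_mult abs_mult mult.commute[of "cmod (f x)"])
    then show "AE x in lborel. cmod (f x * g x) \<le> norm (C * cmod (f x))"
      by simp
  qed measurable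
qed

lemma bounded_measurable_fourier_integral:
  assumes "integrable lborel f"
  shows "bounded_measurable (fourier_integral f)"
  using assms fourier_integral_bound[OF assms]
  by (intro bounded_measurableI) (auto dest: borel_measurable_integrable)

lemma integrable_tensor:
  fixes f :: "real ^ 'd \<Rightarrow> complex" and g :: "real ^ 'd \<Rightarrow> complex"
    and k :: "(real ^ 'd) \<times> (real ^ 'd) \<Rightarrow> complex"
  assumes "integrable lborel f" "integrable lborel g"
    and [measurable]: "k \<in> borel_measurable (borel \<Otimes>\<^sub>M borel)"
    and k: "\<And>z. cmod (k z) \<le> 1"
  shows "integrable (lborel \<Otimes>\<^sub>M lborel) (\<lambda>(x, y). k (x, y) * (f x * g y))"
proof -
  have [measurable]: "f \<in> borel_measurable borel" "g \<in> borel_measurable borel"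
    using assms by (auto dest: borel_measurable_integrable)
  have "integrable (lborel \<Otimes>\<^sub>M lborel) (\<lambda>(x, y). f x * g y)"
    by (rule lborel_pair.Fubini_integrable) (use assms in \<open>auto simp: norm_mult\<close>)
  then show ?thesis
    by (rule Bochner_Integration.integrable_bound)
      (auto simp: norm_mult split_beta intro!: mult_left_le_one_le k mult_nonneg_nonneg)
qed

text \<open>Fubini's theorem, as the kernel is symmetric in its two variables. It moves the
  transform from one factor to the other, which yields both the pairing with Gaussians and the
  adjoint of the L^2 transform.\<close>

theorem fourier_multiplication_formula:
  fixes f h :: "real ^ 'd \<Rightarrow> complex"
  assumes "integrable lborel f" "integrable lborel h"
  shows "(\<integral>\<xi>. fourier_integral f \<xi> * h \<xi> \<partial>lborel) = (\<integral>x. f x * fourier_integral h x \<partial>lborel)"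
proof -
  define c where "c = complex_of_real ((2 * pi) powr (- real CARD('d) / 2))"
  have int: "integrable (lborel \<Otimes>\<^sub>M lborel) (\<lambda>(x, y). cis (- (x \<bullet> y)) * (f x * h y))"
    using integrable_tensor[OF assms, of "\<lambda>z. cis (- (fst z \<bullet> snd z))"] by simp
  have "(\<integral>y. fourier_integral f y * h y \<partial>lborel)
      = (\<integral>y. c * (\<integral>x. cis (- (x \<bullet> y)) * (f x * h y) \<partial>lborel) \<partial>lborel)"
    unfolding fourier_integral_def c_def
    by (intro Bochner_Integration.integral_cong refl)
        (simp add: mult.assoc flip: integral_mult_left_zero)
  also have "\<dots> = c * (\<integral>x. (\<integral>y. cis (- (x \<bullet> y)) * (f x * h y) \<partial>lborel) \<partial>lborel)"
    using lborel_pair.Fubini_integral[OF int] by simp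
  also have "\<dots> = (\<integral>x. f x * fourier_integral h x \<partial>lborel)"
    unfolding fourier_integral_def c_def integral_mult_right_zero[symmetric]
    by (intro Bochner_Integration.integral_cong refl) (simp add: mult_ac inner_commute)
  finally show ?thesis .
qed

section \<open>Gaussian regularisation and the contraction property\<close>

lemma heat_uminus: "heat t (- x) = heat t x"
  by (simp add: heat_def gauss_def)

text \<open>A regularised inversion formula: a damped plane wave with parameter a extracts from
  \<open>fourier_integral f\<close> the heat smoothing of f at a. Contractivity and injectivity both
  rest on it.\<close>

lemma fourier_gauss_pairing:
  fixes f :: "real ^ 'd \<Rightarrow> complex"
  assumes f: "integrable lborel f" and t: "t > 0"
  shows "(\<integral>\<xi>. fourier_integral f \<xi> * (cis (a \<bullet> \<xi>) * of_real (gauss t \<xi>)) \<partial>lborel)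
    = of_real ((2 * pi) powr (real CARD('d) / 2)) * (\<integral>x. f x * of_real (heat t (x - a)) \<partial>lborel)"
  unfolding fourier_multiplication_formula[OF f integrable_modulated_gauss[OF t]]
    fourier_modulated_gauss[OF t]
  unfolding integral_mult_right_zero[symmetric]
  by (simp add: mult_ac)

text \<open>Schur's test: the product of f x and f y is split by the inequality between the
  geometric and arithmetic means, and the heat kernel has mass one in each variable.\<close>

lemma heat_tensor_le:
  fixes f :: "real ^ 'd \<Rightarrow> complex"
  assumes [measurable]: "f \<in> borel_measurable borel" and t: "t > 0"
  shows "(\<integral>\<^sup>+ x. (\<integral>\<^sup>+ y. ennreal (cmod (f x) * cmod (f y) * heat t (y - x)) \<partial>lborel) \<partial>lborel)
    \<le> (\<integral>\<^sup>+ x. ennreal ((cmod (f x))\<^sup>2) \<partial>lborel)"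
proof -
  let ?I = "\<integral>\<^sup>+ x. ennreal ((cmod (f x))\<^sup>2) \<partial>lborel"
  let ?q = "\<lambda>x. ennreal ((cmod (f x))\<^sup>2 / 2)"
  have le: "ennreal (cmod (f x) * cmod (f y) * heat t (y - x))
      \<le> ?q x * ennreal (heat t (y - x)) + ?q y * ennreal (heat t (y - x))" for x y
  proof -
    have "cmod (f x) * cmod (f y) * heat t (y - x)
        \<le> ((cmod (f x))\<^sup>2 / 2 + (cmod (f y))\<^sup>2 / 2) * heat t (y - x)"
      using sum_squares_bound[of "cmod (f x)" "cmod (f y)"]
      by (intro mult_right_mono heat_nonneg t) auto
    then have "ennreal (cmod (f x) * cmod (f y) * heat t (y - x))
        \<le> ennreal (((cmod (f x))\<^sup>2 / 2 + (cmod (f y))\<^sup>2 / 2) * heat t (y - x))"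
      by (rule ennreal_leI)
    also have "\<dots> = (?q x + ?q y) * ennreal (heat t (y - x))"
      by (subst ennreal_mult) (simp_all add: heat_nonneg t ennreal_plus)
    finally show ?thesis
      by (simp only: distrib_right)
  qed
  have "(\<integral>\<^sup>+ x. (\<integral>\<^sup>+ y. ennreal (cmod (f x) * cmod (f y) * heat t (y - x)) \<partial>lborel) \<partial>lborel)
      \<le> (\<integral>\<^sup>+ x. (\<integral>\<^sup>+ y. ?q x * ennreal (heat t (y - x))
          + ?q y * ennreal (heat t (y - x)) \<partial>lborel) \<partial>lborel)"
    by (intro nn_integral_mono le)
  also have "\<dots> = (\<integral>\<^sup>+ x. (\<integral>\<^sup>+ y. ?q x * ennreal (heat t (y - x)) \<partial>lborel) \<partial>lborel)
      + (\<integral>\<^sup>+ x. (\<integral>\<^sup>+ y. ?q y * ennreal (heat t (y - x)) \<partial>lborel) \<partial>lborel)"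
    by (simp add: nn_integral_add)
  also have "(\<integral>\<^sup>+ x. (\<integral>\<^sup>+ y. ?q x * ennreal (heat t (y - x)) \<partial>lborel) \<partial>lborel) = (\<integral>\<^sup>+ x. ?q x \<partial>lborel)"
    by (simp add: nn_integral_cmult nn_integral_heat t)
  also have "(\<integral>\<^sup>+ x. (\<integral>\<^sup>+ y. ?q y * ennreal (heat t (y - x)) \<partial>lborel) \<partial>lborel)
      = (\<integral>\<^sup>+ y. (\<integral>\<^sup>+ x. ?q y * ennreal (heat t (y - x)) \<partial>lborel) \<partial>lborel)"
    by (rule lborel_pair.Fubini'[symmetric]) measurable
  also have "\<dots> = (\<integral>\<^sup>+ x. ?q x \<partial>lborel)"
    by (simp add: nn_integral_cmult nn_integral_heat t)
  also have "(\<integral>\<^sup>+ x. ?q x \<partial>lborel) + (\<integral>\<^sup>+ x. ?q x \<partial>lborel) = (\<integral>\<^sup>+ x. ?q x + ?q x \<partial>lborel)"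
    by (rule nn_integral_add[symmetric]) measurable
  also have "\<dots> = (\<integral>\<^sup>+ x. ennreal ((cmod (f x))\<^sup>2) \<partial>lborel)"
    by (simp flip: ennreal_plus)
  finally show ?thesis .
qed

text \<open>The damped integral is the pairing of the transform of f with h, its damped conjugate.
  Moving the transform onto h produces a heat smoothing of the conjugate of f, and the resulting
  double integral is controlled by \<open>heat_tensor_le\<close>.\<close>

lemma fourier_integral_gauss_le:
  fixes f :: "real ^ 'd \<Rightarrow> complex"
  assumes f: "integrable lborel f" and t: "t > 0"
  shows "(\<integral>\<^sup>+ \<xi>. ennreal ((cmod (fourier_integral f \<xi>))\<^sup>2 * gauss t \<xi>) \<partial>lborel)
    \<le> (\<integral>\<^sup>+ x. ennreal ((cmod (f x))\<^sup>2) \<partial>lborel)"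
proof -
  have [measurable]: "f \<in> borel_measurable borel"
    using f by (auto dest: borel_measurable_integrable)
  define h where "h \<xi> = cnj (fourier_integral f \<xi>) * of_real (gauss t \<xi>)" for \<xi>
  have bm: "bounded_measurable (\<lambda>\<xi>. cnj (fourier_integral f \<xi>))"
    using bounded_measurable_fourier_integral[OF f] by (auto simp: bounded_measurable_def)
  have h: "integrable lborel h"
    using integrable_bounded_mult[OF _ bm, of "\<lambda>\<xi>. of_real (gauss t \<xi>)"] integrable_gauss[OF t]
    by (simp add: h_def[abs_def] mult.commute complex_of_real_integrable_eq)
  have hx: "fourier_integral h x = (\<integral>y. cnj (f y) * of_real (heat t (y - x)) \<partial>lborel)" for x
  proof -
    have "(\<integral>\<xi>. cis (- (\<xi> \<bullet> x)) * h \<xi> \<partial>lborel)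
        = cnj (\<integral>\<xi>. fourier_integral f \<xi> * (cis (x \<bullet> \<xi>) * of_real (gauss t \<xi>)) \<partial>lborel)"
      unfolding Bochner_Integration.integral_cnj[symmetric]
      by (simp add: h_def cis_cnj inner_commute mult_ac)
    also have "\<dots> = of_real ((2 * pi) powr (real CARD('d) / 2)) * (\<integral>y. cnj (f y) * of_real
        (heat t (y - x)) \<partial>lborel)"
      unfolding fourier_gauss_pairing[OF f t] by (simp flip: Bochner_Integration.integral_cnj)
    finally show ?thesis
      unfolding fourier_integral_def
      by (simp add: powr_minus field_simps)
  qed
  have "ennreal (\<integral>\<xi>. (cmod (fourier_integral f \<xi>))\<^sup>2 * gauss t \<xi> \<partial>lborel)
      = ennreal (cmod (\<integral>\<xi>. fourier_integral f \<xi> * h \<xi> \<partial>lborel))"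
  proof -
    have "fourier_integral f \<xi> * h \<xi> = of_real ((cmod (fourier_integral f \<xi>))\<^sup>2 * gauss t \<xi>)" for \<xi>
      unfolding h_def mult.assoc[symmetric] complex_norm_square[symmetric] by simp
    then show ?thesis
      by (simp only: integral_complex_of_real norm_of_real)
        (simp add: abs_of_nonneg integral_nonneg_AE less_imp_le[OF gauss_pos])
  qed
  also have "\<dots> = ennreal (cmod (\<integral>x. f x * fourier_integral h x \<partial>lborel))"
    by (simp add: fourier_multiplication_formula f h)
  also have "\<dots> \<le> (\<integral>\<^sup>+ x. ennreal (cmod (f x * fourier_integral h x)) \<partial>lborel)"
    by (intro integral_norm_bound_ennreal integrable_bounded_mult f
        bounded_measurable_fourier_integral h)
  also have "\<dots> \<le> (\<integral>\<^sup>+ x. (\<integral>\<^sup>+ y. ennreal (cmod (f x) * cmod (f y) * heat t (y - x)) \<partial>lborel) \<partial>lborel)"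
  proof (intro nn_integral_mono)
    fix x
    have "ennreal (cmod (fourier_integral h x))
        \<le> (\<integral>\<^sup>+ y. ennreal (cmod (cnj (f y) * of_real (heat t (y - x)))) \<partial>lborel)"
    \<comment> \<open>If the integrand is not integrable, its Bochner integral is 0 by convention
      and the bound is trivial.\<close>
    proof (cases "integrable lborel (\<lambda>y. cnj (f y) * of_real (heat t (y - x)))")
      case True
      then show ?thesis unfolding hx by (rule integral_norm_bound_ennreal)
    qed (simp add: hx not_integrable_integral_eq)
    also have "\<dots> = (\<integral>\<^sup>+ y. ennreal (cmod (f y) * heat t (y - x)) \<partial>lborel)"
      by (simp add: norm_mult abs_of_nonneg heat_nonneg t)
    finally have "ennreal (cmod (f x)) * ennreal (cmod (fourier_integral h x))
        \<le> ennreal (cmod (f x)) * (\<integral>\<^sup>+ y. ennreal (cmod (f y) * heat t (y - x)) \<partial>lborel)"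
      by (intro mult_left_mono) auto
    also have "\<dots> = (\<integral>\<^sup>+ y. ennreal (cmod (f x) * cmod (f y) * heat t (y - x)) \<partial>lborel)"
      by (subst nn_integral_cmult[symmetric]) (auto simp: ennreal_mult'[symmetric] mult.assoc)
    finally show "ennreal (cmod (f x * fourier_integral h x))
        \<le> (\<integral>\<^sup>+ y. ennreal (cmod (f x) * cmod (f y) * heat t (y - x)) \<partial>lborel)"
      by (simp add: norm_mult ennreal_mult)
  qed
  also have "\<dots> \<le> (\<integral>\<^sup>+ x. ennreal ((cmod (f x))\<^sup>2) \<partial>lborel)"
    by (rule heat_tensor_le) (use t in auto)
  also have "ennreal (\<integral>\<xi>. (cmod (fourier_integral f \<xi>))\<^sup>2 * gauss t \<xi> \<partial>lborel)
      = (\<integral>\<^sup>+ \<xi>. ennreal ((cmod (fourier_integral f \<xi>))\<^sup>2 * gauss t \<xi>) \<partial>lborel)"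
  proof (rule nn_integral_eq_integral[symmetric])
    have "integrable lborel (\<lambda>\<xi>. fourier_integral f \<xi> * h \<xi>)"
      using integrable_bounded_mult[OF h bounded_measurable_fourier_integral[OF f]]
          by (simp add: mult.commute)
    then have "integrable lborel (\<lambda>\<xi>. cmod (fourier_integral f \<xi> * h \<xi>))"
      by (rule integrable_norm)
    moreover have "cmod (fourier_integral f \<xi> * h \<xi>)
        = (cmod (fourier_integral f \<xi>))\<^sup>2 * gauss t \<xi>" for \<xi>
      using gauss_pos[of t \<xi>] by (simp add: h_def norm_mult power2_eq_square)
    ultimately show "integrable lborel (\<lambda>\<xi>. (cmod (fourier_integral f \<xi>))\<^sup>2 * gauss t \<xi>)"
      by simp
  qed (simp add: less_imp_le[OF gauss_pos])
  finally show ?thesis .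
qed

text \<open>Fatou's lemma as the Gaussian damping is removed. An inequality suffices for extending
  the transform to L^2; equality of norms follows later from the inversion formula.\<close>

theorem fourier_integral_contraction:
  fixes f :: "real ^ 'd \<Rightarrow> complex"
  assumes f: "integrable lborel f"
  shows "(\<integral>\<^sup>+ \<xi>. ennreal ((cmod (fourier_integral f \<xi>))\<^sup>2) \<partial>lborel)
    \<le> (\<integral>\<^sup>+ x. ennreal ((cmod (f x))\<^sup>2) \<partial>lborel)"
proof -
  have [measurable]: "f \<in> borel_measurable borel"
    using f by (auto dest: borel_measurable_integrable)
  have lim: "(\<lambda>n. ennreal ((cmod (fourier_integral f \<xi>))\<^sup>2 * gauss (1 / Suc n) \<xi>))
      \<longlonglongrightarrow> ennreal ((cmod (fourier_integral f \<xi>))\<^sup>2)" for \<xi>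
  proof -
    have "(\<lambda>n. gauss (1 / Suc n) \<xi>) \<longlonglongrightarrow> exp (- (norm (0 *\<^sub>R \<xi>))\<^sup>2 / 2)"
      unfolding gauss_def by (intro tendsto_intros LIMSEQ_Suc[OF lim_1_over_n]) auto
    then have "(\<lambda>n. (cmod (fourier_integral f \<xi>))\<^sup>2 * gauss (1 / Suc n) \<xi>)
        \<longlonglongrightarrow> (cmod (fourier_integral f \<xi>))\<^sup>2 * 1"
      by (intro tendsto_intros) simp
    then show ?thesis
      by (intro tendsto_ennrealI) simp
  qed
  have "(\<integral>\<^sup>+ \<xi>. ennreal ((cmod (fourier_integral f \<xi>))\<^sup>2) \<partial>lborel)
      = (\<integral>\<^sup>+ \<xi>. liminf (\<lambda>n. ennreal ((cmod (fourier_integral f \<xi>))\<^sup>2 * gauss (1 / Suc n) \<xi>)) \<partial>lborel)"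
    using lim by (intro nn_integral_cong) (metis lim_imp_Liminf trivial_limit_sequentially)
  also have "\<dots> \<le> liminf (\<lambda>n. \<integral>\<^sup>+ \<xi>. ennreal ((cmod (fourier_integral f \<xi>))\<^sup>2 * gauss (1 / Suc n)
      \<xi>) \<partial>lborel)"
    by (rule nn_integral_liminf) measurable
  also have "\<dots> \<le> limsup (\<lambda>n. \<integral>\<^sup>+ \<xi>. ennreal ((cmod (fourier_integral f \<xi>))\<^sup>2 * gauss (1 / Suc n)
      \<xi>) \<partial>lborel)"
    by (rule Liminf_le_Limsup) simp
  also have "\<dots> \<le> (\<integral>\<^sup>+ x. ennreal ((cmod (f x))\<^sup>2) \<partial>lborel)"
    by (intro Limsup_bounded always_eventually allI fourier_integral_gauss_le f) simp
  finally show ?thesis .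
qed

subsection \<open>Injectivity of the Fourier integral\<close>

text \<open>Continuous functions approximate indicators of closed sets; these sets are stable under
  intersection and generate the Borel sets, so Dynkin's theorem yields a vanishing integral over
  every Borel set. The sets where w is positive and where it is negative then decide the
  claim.\<close>

lemma AE_zero_of_continuous_tests:
  fixes w :: "'a::euclidean_space \<Rightarrow> real"
  assumes w: "integrable lborel w"
    and h: "\<And>h. continuous_on UNIV h \<Longrightarrow> (\<And>x. \<bar>h x\<bar> \<le> 1) \<Longrightarrow> (\<integral>x. w x * h x \<partial>lborel) = 0"
  shows "AE x in lborel. w x = 0"
proof -
  have [measurable]: "w \<in> borel_measurable borel"
    using w by (auto dest: borel_measurable_integrable)
  have wA: "integrable lborel (\<lambda>x. w x * indicator A x)" if "A \<in> sets borel" for A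
    using integrable_mult_indicator[of A lborel w] w that by (simp add: mult.commute)
  have closed: "(\<integral>x. w x * indicator C x \<partial>lborel) = 0" if C: "closed C" for C
  \<comment> \<open>The distance to the empty set is 0 by convention, and the cutoffs below would
    not converge to its indicator.\<close>
  proof (cases "C = {}")
    case False
    \<comment> \<open>Equal to 1 on C, and 0 at distance at least 1/n from C when n is
      positive.\<close>
    define g where "g n x = max 0 (1 - real n * infdist x C)" for n :: nat and x
    have gc: "continuous_on UNIV (g n)" for n
      unfolding g_def by (intro continuous_intros)
    then have [measurable]: "g n \<in> borel_measurable borel" for n
      by (rule borel_measurable_continuous_onI)
    have g1: "\<bar>g n x\<bar> \<le> 1" for n x
      by (auto simp: g_def infdist_nonneg)
    have lim: "(\<lambda>n. g n x) \<longlonglongrightarrow> indicator C x" for x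
    proof (cases "x \<in> C")
      case False
      then have pos: "infdist x C > 0"
        using C \<open>C \<noteq> {}\<close> in_closed_iff_infdist_zero[of C x] infdist_nonneg[of x C] by force
      obtain N :: nat where N: "1 / infdist x C < N"
        using reals_Archimedean2 by blast
      have "g n x = 0" if "n \<ge> N" for n
      proof -
        have "1 < real N * infdist x C"
          using N pos by (simp add: field_simps)
        also have "\<dots> \<le> real n * infdist x C"
          using that pos by (intro mult_right_mono) auto
        finally show ?thesis by (simp add: g_def)
      qed
      then show ?thesis
        using False by (intro tendsto_eventually eventually_sequentiallyI[of N]) auto
    qed (simp add: g_def)
    have "(\<lambda>n. \<integral>x. w x * g n x \<partial>lborel) \<longlonglongrightarrow> (\<integral>x. w x * indicator C x \<partial>lborel)"
    proof (rule integral_dominated_convergence[where w = "\<lambda>x. \<bar>w x\<bar>"])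
      show "AE x in lborel. (\<lambda>n. w x * g n x) \<longlonglongrightarrow> w x * indicator C x"
        by (intro AE_I2 tendsto_intros lim)
      show "AE x in lborel. norm (w x * g n x) \<le> \<bar>w x\<bar>" for n
        using g1 by (intro AE_I2) (simp add: abs_mult mult_left_le)
    qed (use w C in auto)
    moreover have "(\<integral>x. w x * g n x \<partial>lborel) = 0" for n
      by (rule h[OF gc g1])
    ultimately show ?thesis
      by (simp add: LIMSEQ_const_iff)
  qed simp
  have all: "(\<integral>x. w x * indicator A x \<partial>lborel) = 0" if "A \<in> sets borel" for A
  proof -
    have "Int_stable (Collect (closed :: 'a set \<Rightarrow> bool))" "Collect closed \<subseteq> Pow (UNIV :: 'a set)"
      by (auto simp: Int_stable_def)
    moreover have "A \<in> sigma_sets UNIV (Collect closed)"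
      using that by (simp add: borel_eq_closed)
    ultimately show ?thesis
    proof (induction rule: sigma_sets_induct_disjoint)
      case (basic A)
      then show ?case using closed by simp
    next
      case (compl A)
      then have A: "A \<in> sets borel" by (simp add: borel_eq_closed)
      have "(\<integral>x. w x * indicator (UNIV - A) x \<partial>lborel)
          = (\<integral>x. w x * indicator UNIV x - w x * indicator A x \<partial>lborel)"
        by (intro Bochner_Integration.integral_cong) (auto split: split_indicator)
      also have "\<dots> = 0"
        using compl closed[of UNIV] wA[of UNIV] wA[OF A]
            by (subst Bochner_Integration.integral_diff) auto
      finally show ?case .
    next
      case (union A)
      then have A: "A i \<in> sets borel" for i by (auto simp: borel_eq_closed)
      have "(\<lambda>n. \<integral>x. w x * (\<Sum>i<n. indicator (A i) x) \<partial>lborel)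
          \<longlonglongrightarrow> (\<integral>x. w x * indicator (\<Union>i. A i) x \<partial>lborel)"
      proof (rule integral_dominated_convergence[where w = "\<lambda>x. \<bar>w x\<bar>"])
        have s: "(\<lambda>i. indicator (A i) x) sums (indicator (\<Union>i. A i) x :: real)" for x
          using indicator_sums[of A x] union(1) by (auto simp: disjoint_family_on_def)
        then show "AE x in lborel. (\<lambda>n. w x * (\<Sum>i<n. indicator (A i) x)) \<longlonglongrightarrow> w x * indicator (\<Union>i. A i) x"
          by (intro AE_I2 tendsto_intros) (simp add: sums_def)
        have "(\<Sum>i<n. indicator (A i) x) \<le> (1 :: real)" for n x
        proof -
          have "(\<Sum>i<n. indicator (A i) x) \<le> (\<Sum>i. indicator (A i) x :: real)"
            by (rule sum_le_suminf[OF sums_summable[OF s]]) auto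
          also have "\<dots> = indicator (\<Union>i. A i) x"
            by (rule sums_unique[OF s, symmetric])
          also have "\<dots> \<le> (1 :: real)"
            by (rule indicator_le_1)
          finally show ?thesis .
        qed
        then show "AE x in lborel. norm (w x * (\<Sum>i<n. indicator (A i) x)) \<le> \<bar>w x\<bar>" for n
          by (intro AE_I2) (simp add: abs_mult mult_left_le sum_nonneg)
      qed (use w A in auto)
      moreover have "(\<integral>x. w x * (\<Sum>i<n. indicator (A i) x) \<partial>lborel) = 0" for n
        unfolding sum_distrib_left using union wA[OF A] by (subst Bochner_Integration.integral_sum) auto
      ultimately show ?case
        by (simp add: LIMSEQ_const_iff)
    qed auto
  qed
  have P: "{x. w x > 0} \<in> sets borel" and N: "{x. w x < 0} \<in> sets borel"
    by measurable
  have "AE x in lborel. 0 \<le> w x * indicator {x. w x > 0} x"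
    by (auto simp: indicator_def)
  from integral_nonneg_eq_0_iff_AE[OF wA[OF P] this] all[OF P]
  have "AE x in lborel. w x * indicator {x. w x > 0} x = 0"
    by simp
  moreover have "AE x in lborel. 0 \<le> - (w x * indicator {x. w x < 0} x)"
    by (auto simp: indicator_def)
  from integral_nonneg_eq_0_iff_AE[OF Bochner_Integration.integrable_minus[OF wA[OF N]] this] all[OF N]
  have "AE x in lborel. w x * indicator {x. w x < 0} x = 0"
    by simp
  ultimately show ?thesis
  proof eventually_elim
    case (elim x)
    then show ?case
      by (cases "w x > 0"; cases "w x < 0") auto
  qed
qed

lemma heat_scale:
  fixes z :: "real ^ 'd"
  assumes "t > 0"
  shows "t ^ CARD('d) * heat t (t *\<^sub>R z) = heat 1 z"
  using assms by (simp add: heat_def gauss_def power_one_over)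

text \<open>All heat smoothings of W vanish by \<open>fourier_gauss_pairing\<close>. By Fubini's
  theorem the smoothing moves from W to a continuous bounded test function, where it disappears in
  the limit of small times. Hence W integrates to zero against every such function.\<close>

theorem fourier_integral_injective:
  fixes W :: "real ^ 'd \<Rightarrow> complex"
  assumes W: "integrable lborel W" and zero: "\<And>\<xi>. fourier_integral W \<xi> = 0"
  shows "AE x in lborel. W x = 0"
proof -
  have [measurable]: "W \<in> borel_measurable borel"
    using W by (auto dest: borel_measurable_integrable)
  have conv0: "(\<integral>x. W x * of_real (heat t (x - a)) \<partial>lborel) = 0" if "t > 0" for t a
    using fourier_gauss_pairing[OF W that, of a] by (simp add: zero)
  have test: "(\<integral>x. W x * of_real (h x) \<partial>lborel) = 0"
    if hc: "continuous_on UNIV h" and h1: "\<And>x. \<bar>h x\<bar> \<le> 1" for h :: "real ^ 'd \<Rightarrow> real"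
  proof -
    have [measurable]: "h \<in> borel_measurable borel"
      using hc by (rule borel_measurable_continuous_onI)
    \<comment> \<open>The heat smoothing of h, rescaled so that the kernel no longer depends on t;
      this makes dominated convergence available as t tends to 0.\<close>
    define S where "S t x = (\<integral>z. h (x + t *\<^sub>R z) * heat 1 z \<partial>lborel)" for t x
    have [measurable]: "S t \<in> borel_measurable borel" for t
      unfolding S_def by measurable
    have ih: "integrable lborel (\<lambda>z. h (x + t *\<^sub>R z) * heat 1 z)" for x t
      by (rule Bochner_Integration.integrable_bound[OF heat_integral(1)[of 1]])
        (auto simp: abs_mult heat_nonneg h1 mult_le_cancel_right1 intro!: mult_left_le_one_le)
    have S1: "\<bar>S t x\<bar> \<le> 1" for t x
    proof -
      have "\<bar>S t x\<bar> \<le> (\<integral>z. \<bar>h (x + t *\<^sub>R z) * heat 1 z\<bar> \<partial>lborel)"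
        unfolding S_def by (rule integral_abs_bound)
      also have "\<dots> \<le> (\<integral>z. heat 1 (z :: real ^ 'd) \<partial>lborel)"
        by (intro integral_mono integrable_abs ih heat_integral)
          (auto simp: abs_mult heat_nonneg h1 intro!: mult_left_le_one_le)
      finally show ?thesis by (simp add: heat_integral)
    qed
    have Slim: "(\<lambda>n. S (1 / Suc n) x) \<longlonglongrightarrow> h x" for x
    proof -
      have "(\<lambda>n. S (1 / Suc n) x) \<longlonglongrightarrow> (\<integral>z. h x * heat 1 (z :: real ^ 'd) \<partial>lborel)"
        unfolding S_def
      proof (rule integral_dominated_convergence[where w = "heat 1 :: real ^ 'd \<Rightarrow> real"])
        show "AE z in lborel. (\<lambda>n. h (x + (1 / Suc n) *\<^sub>R z) * heat 1 z) \<longlonglongrightarrow> h x * heat 1 z"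
        proof (intro AE_I2 tendsto_intros)
          fix z
          have "(\<lambda>n. x + (1 / Suc n) *\<^sub>R z) \<longlonglongrightarrow> x + 0 *\<^sub>R z"
            by (intro tendsto_intros LIMSEQ_Suc[OF lim_1_over_n])
          then show "(\<lambda>n. h (x + (1 / Suc n) *\<^sub>R z)) \<longlonglongrightarrow> h x"
            using continuous_on_tendsto_compose[OF hc, of _ x] by simp
        qed
        show "AE z in lborel. norm (h (x + (1 / Suc n) *\<^sub>R z) * heat 1 z) \<le> heat 1 z" for n
          using h1 by (intro AE_I2) (auto simp: abs_mult heat_nonneg intro!: mult_left_le_one_le)
      qed (auto simp: heat_integral)
      then show ?thesis by (simp add: heat_integral)
    qed
    have S0: "(\<integral>x. W x * of_real (S t x) \<partial>lborel) = 0" if t: "t > 0" for t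
    proof -
      \<comment> \<open>The same smoothing in the original variable a, which is the form that
        Fubini's theorem needs.\<close>
      have Seq: "S t x = (\<integral>a. h a * heat t (x - a) \<partial>lborel)" for x
      proof -
        have "(\<integral>a. h a * heat t (x - a) \<partial>lborel)
            = (\<bar>t\<bar> ^ DIM(real ^ 'd)) *\<^sub>R (\<integral>z. h (x + t *\<^sub>R z) * heat t (x - (x + t *\<^sub>R z)) \<partial>lborel)"
          using t by (intro integral_lborel_affine) auto
        also have "\<dots> = (\<integral>z. h (x + t *\<^sub>R z) * (t ^ CARD('d) * heat t (t *\<^sub>R z)) \<partial>lborel)"
          using t by (simp add: heat_uminus mult_ac flip: integral_mult_right_zero)
        finally show ?thesis
          unfolding S_def heat_scale[OF t] by simp
      qed
      have inta: "integrable lborel (\<lambda>a. h a * heat t (x - a))" for x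
      proof (rule Bochner_Integration.integrable_bound)
        show "integrable lborel (\<lambda>a. heat t (x - a))"
          using integrable_lborel_affine[OF _ heat_integral(1)[OF t], of "-1" x] by simp
      qed (auto simp: abs_mult heat_nonneg t h1 intro!: mult_left_le_one_le)
      have le: "(\<integral>a. \<bar>h a * heat t (x - a)\<bar> \<partial>lborel) \<le> 1" for x
      proof -
        have "(\<integral>a. \<bar>h a * heat t (x - a)\<bar> \<partial>lborel) \<le> (\<integral>a. heat t (x - a) \<partial>lborel)"
          using integrable_lborel_affine[OF _ heat_integral(1)[OF t], of "-1" x]
          by (intro integral_mono integrable_abs inta)
            (auto simp: abs_mult heat_nonneg t h1 intro!: mult_left_le_one_le)
        also have "\<dots> = 1"
          using integral_lborel_affine[of "-1" "heat t" x] heat_integral(2)[OF t, where 'a='d] by simp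
        finally show ?thesis .
      qed
      \<comment> \<open>Integrating out a first leaves at most \<open>cmod (W x)\<close>, which
        gives integrability on the product space.\<close>
      have Keq: "(\<integral>a. norm (W x * of_real (h a * heat t (x - a))) \<partial>lborel)
          = cmod (W x) * (\<integral>a. \<bar>h a * heat t (x - a)\<bar> \<partial>lborel)" for x
        unfolding norm_mult norm_of_real by (rule integral_mult_right_zero)
      have Kle: "norm (cmod (W x) * (\<integral>a. \<bar>h a * heat t (x - a)\<bar> \<partial>lborel)) \<le> norm (W x)" for x
        using le by (simp add: abs_mult mult_left_le)
      have I: "integrable (lborel \<Otimes>\<^sub>M lborel) (\<lambda>(x, a). W x * of_real (h a * heat t (x - a)))"
      proof (rule lborel_pair.Fubini_integrable, goal_cases)
        case 1
        show ?case
          unfolding case_prod_beta by measurable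
      next
        case 2
        show ?case
          unfolding prod.case Keq
          by (rule Bochner_Integration.integrable_bound[OF W])
            (auto simp only: Kle intro!: AE_I2 borel_measurable_times measurable_lborel2
                lborel.borel_measurable_lebesgue_integral, measurable)
      next
        case 3
        show ?case
          unfolding prod.case using inta by (intro AE_I2 integrable_mult_right integrable_of_real)
      qed
      have "(\<integral>x. W x * of_real (S t x) \<partial>lborel)
          = (\<integral>x. (\<integral>a. W x * of_real (h a * heat t (x - a)) \<partial>lborel) \<partial>lborel)"
        unfolding Seq by (simp only: integral_mult_right_zero integral_complex_of_real)
      also have "\<dots> = (\<integral>a. (\<integral>x. W x * of_real (h a * heat t (x - a)) \<partial>lborel) \<partial>lborel)"
        using lborel_pair.Fubini_integral[OF I] by simp
      also have "\<dots> = (\<integral>a. of_real (h a) * (\<integral>x. W x * of_real (heat t (x - a)) \<partial>lborel) \<partial>lborel)"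
        by (simp add: mult_ac flip: integral_mult_right_zero)
      finally show ?thesis
        by (simp add: conv0 t)
    qed
    have "(\<lambda>n. \<integral>x. W x * of_real (S (1 / Suc n) x) \<partial>lborel) \<longlonglongrightarrow> (\<integral>x. W x * of_real (h x) \<partial>lborel)"
    proof (rule integral_dominated_convergence[where w = "\<lambda>x. cmod (W x)"])
      show "AE x in lborel. (\<lambda>n. W x * of_real (S (1 / Suc n) x)) \<longlonglongrightarrow> W x * of_real (h x)"
        by (intro AE_I2 tendsto_intros Slim)
      show "AE x in lborel. norm (W x * of_real (S (1 / Suc n) x)) \<le> cmod (W x)" for n
        using S1 by (intro AE_I2) (simp add: norm_mult mult_left_le)
    qed (use W in auto)
    moreover have "(\<integral>x. W x * of_real (S (1 / Suc n) x) \<partial>lborel) = 0" for n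
      by (rule S0) simp
    ultimately show ?thesis
      by (simp add: LIMSEQ_const_iff)
  qed
  have int: "integrable lborel (\<lambda>x. W x * of_real (h x))"
    if "continuous_on UNIV h" and "\<And>x. \<bar>h x\<bar> \<le> 1" for h :: "real ^ 'd \<Rightarrow> real"
  proof (intro integrable_bounded_mult W bounded_measurableI[where C = 1])
    have [measurable]: "h \<in> borel_measurable borel"
      using that(1) by (rule borel_measurable_continuous_onI)
    show "(\<lambda>x. complex_of_real (h x)) \<in> borel_measurable borel"
      by measurable
  qed (simp add: that(2))
  \<comment> \<open>The test lemma concerns real functions, so real and imaginary parts are treated
    separately.\<close>
  have "AE x in lborel. Re (W x) = 0"
  proof (rule AE_zero_of_continuous_tests)
    fix h :: "real ^ 'd \<Rightarrow> real" assume h: "continuous_on UNIV h" "\<And>x. \<bar>h x\<bar> \<le> 1"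
    show "(\<integral>x. Re (W x) * h x \<partial>lborel) = 0"
      using arg_cong[OF test[OF h], of Re] integral_Re[OF int[OF h]] by simp
  qed (use W in auto)
  moreover have "AE x in lborel. Im (W x) = 0"
  proof (rule AE_zero_of_continuous_tests)
    fix h :: "real ^ 'd \<Rightarrow> real" assume h: "continuous_on UNIV h" "\<And>x. \<bar>h x\<bar> \<le> 1"
    show "(\<integral>x. Im (W x) * h x \<partial>lborel) = 0"
      using arg_cong[OF test[OF h], of Im] integral_Im[OF int[OF h]] by simp
  qed (use W in auto)
  ultimately show ?thesis
    by eventually_elim (rule complex_eqI, simp_all)
qed

subsection \<open>Plancherel's theorem\<close>

lemma square_integrable_fourier_integral:
  assumes "integrable lborel f" "square_integrable f"
  shows "square_integrable (fourier_integral f)"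
  using fourier_integral_contraction[OF assms(1)] assms
  by (auto simp: square_integrable_def intro: le_less_trans dest: borel_measurable_integrable)

lemma norm_fourier_integral_le:
  assumes "integrable lborel f" "square_integrable f"
  shows "norm (to_L2 (fourier_integral f)) \<le> norm (to_L2 f)"
proof -
  have "ennreal ((norm (to_L2 (fourier_integral f)))\<^sup>2) \<le> ennreal ((norm (to_L2 f))\<^sup>2)"
    using fourier_integral_contraction[OF assms(1)]
    by (simp only: ennreal_norm_L2[OF square_integrable_fourier_integral[OF assms]]
        ennreal_norm_L2[OF assms(2)])
  then have "(norm (to_L2 (fourier_integral f)))\<^sup>2 \<le> (norm (to_L2 f))\<^sup>2"
    by (subst (asm) ennreal_le_iff) auto
  then show ?thesis
    by (rule power2_le_imp_le) simp
qed

text \<open>Translates the integrals in the definition of \<open>is_fourier_L2\<close> into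
  convergence in norm, so that completeness and continuity arguments apply.\<close>

lemma tendsto_to_L2_iff:
  assumes "\<And>k. square_integrable (\<phi> k)"
  shows "(\<lambda>k. \<integral>\<^sup>+ x. ennreal ((cmod (\<phi> k x - rep_L2 u x))\<^sup>2) \<partial>lborel) \<longlonglongrightarrow> 0
    \<longleftrightarrow> (\<lambda>k. to_L2 (\<phi> k)) \<longlonglongrightarrow> u"
proof -
  have "(\<integral>\<^sup>+ x. ennreal ((cmod (\<phi> k x - rep_L2 u x))\<^sup>2) \<partial>lborel)
      = ennreal ((norm (to_L2 (\<phi> k) - u))\<^sup>2)" for k
    using ennreal_norm_L2[OF square_integrable_diff[OF assms square_integrable_rep], of k u]
      diff_to_L2[OF assms square_integrable_rep, of k u] by simp
  then have "(\<lambda>k. \<integral>\<^sup>+ x. ennreal ((cmod (\<phi> k x - rep_L2 u x))\<^sup>2) \<partial>lborel) \<longlonglongrightarrow> 0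
    \<longleftrightarrow> (\<lambda>k. ennreal ((norm (to_L2 (\<phi> k) - u))\<^sup>2)) \<longlonglongrightarrow> ennreal 0"
    by simp
  also have "\<dots> \<longleftrightarrow> (\<lambda>k. (norm (to_L2 (\<phi> k) - u))\<^sup>2) \<longlonglongrightarrow> 0"
    by (rule tendsto_ennreal_iff) auto
  also have "\<dots> \<longleftrightarrow> (\<lambda>k. norm (to_L2 (\<phi> k) - u)) \<longlonglongrightarrow> 0"
  proof
    assume "(\<lambda>k. (norm (to_L2 (\<phi> k) - u))\<^sup>2) \<longlonglongrightarrow> 0"
    then have "(\<lambda>k. sqrt ((norm (to_L2 (\<phi> k) - u))\<^sup>2)) \<longlonglongrightarrow> sqrt 0"
      by (rule tendsto_real_sqrt)
    then show "(\<lambda>k. norm (to_L2 (\<phi> k) - u)) \<longlonglongrightarrow> 0" by simp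
  next
    assume "(\<lambda>k. norm (to_L2 (\<phi> k) - u)) \<longlonglongrightarrow> 0"
    from tendsto_power[OF this, of 2] show "(\<lambda>k. (norm (to_L2 (\<phi> k) - u))\<^sup>2) \<longlonglongrightarrow> 0" by simp
  qed
  also have "\<dots> \<longleftrightarrow> (\<lambda>k. to_L2 (\<phi> k)) \<longlonglongrightarrow> u"
    by (simp add: tendsto_dist_iff[of _ u] dist_norm)
  finally show ?thesis .
qed

lemma is_fourier_L2_iff:
  "is_fourier_L2 u w \<longleftrightarrow> (\<exists>\<phi>. (\<forall>k. integrable lborel (\<phi> k) \<and> square_integrable (\<phi> k))
    \<and> (\<lambda>k. to_L2 (\<phi> k)) \<longlonglongrightarrow> u \<and> (\<lambda>k. to_L2 (fourier_integral (\<phi> k))) \<longlonglongrightarrow> w)"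
proof -
  have *: "((\<forall>k. integrable lborel (\<phi> k) \<and> square_integrable (\<phi> k)) \<and>
        (\<lambda>k. \<integral>\<^sup>+ x. ennreal ((cmod (\<phi> k x - rep_L2 u x))\<^sup>2) \<partial>lborel) \<longlonglongrightarrow> 0 \<and>
        (\<lambda>k. \<integral>\<^sup>+ \<xi>. ennreal ((cmod (fourier_integral (\<phi> k) \<xi> - rep_L2 w \<xi>))\<^sup>2) \<partial>lborel)
          \<longlonglongrightarrow> 0)
    \<longleftrightarrow> ((\<forall>k. integrable lborel (\<phi> k) \<and> square_integrable (\<phi> k))
    \<and> (\<lambda>k. to_L2 (\<phi> k)) \<longlonglongrightarrow> u \<and> (\<lambda>k. to_L2 (fourier_integral (\<phi> k))) \<longlonglongrightarrow> w)" for \<phi>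
  proof (cases "\<forall>k. integrable lborel (\<phi> k) \<and> square_integrable (\<phi> k)")
    case True
    then have sq: "\<And>k. square_integrable (\<phi> k)"
        and sqF: "\<And>k. square_integrable (fourier_integral (\<phi> k))"
      by (auto intro: square_integrable_fourier_integral)
    show ?thesis
      by (simp only: tendsto_to_L2_iff[of \<phi>, OF sq]
          tendsto_to_L2_iff[of "\<lambda>k. fourier_integral (\<phi> k)", OF sqF])
  qed blast
  show ?thesis
    unfolding is_fourier_L2_def by (intro arg_cong[where f = Ex] ext *)
qed

text \<open>Truncation to balls: on a set of finite measure a square-integrable function is
  integrable, and the truncations converge by dominated convergence.\<close>

lemma L1_approximation:
  obtains \<phi> where "\<And>k. integrable lborel (\<phi> k)" "\<And>k. square_integrable (\<phi> k)"
    "(\<lambda>k :: nat. to_L2 (\<phi> k)) \<longlonglongrightarrow> (u :: 'd::finite L2)"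
proof -
  note [measurable] = square_integrableD(1)[OF square_integrable_rep[of u]]
  have [measurable]: "cball 0 (real k) \<in> sets (borel :: (real ^ 'd) measure)" for k :: nat
    by simp
  define \<phi> where "\<phi> k x = of_real (indicator (cball 0 (real k)) x) * rep_L2 u x" for k :: nat and x
  have [measurable]: "\<phi> k \<in> borel_measurable borel" for k
    unfolding \<phi>_def by measurable
  have I: "square_integrable (\<lambda>x :: real ^ 'd. of_real (indicator (cball 0 (real k)) x))" for k :: nat
  proof (rule square_integrableI)
    have "(cmod (of_real (indicator (cball 0 (real k)) x)))\<^sup>2 = indicator (cball 0 (real k)) x"
        for x :: "real ^ 'd"
      by (simp add: indicator_def)
    then show "integrable lborel (\<lambda>x :: real ^ 'd. (cmod (of_real (indicator (cball 0 (real k)) x)))\<^sup>2)"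
      by (simp only:) (intro integrable_real_indicator emeasure_compact_finite, auto)
  qed measurable
  have int: "integrable lborel (\<phi> k)" for k
    unfolding \<phi>_def by (rule integrable_mult_sq[OF I square_integrable_rep])
  have bm: "bounded_measurable (\<lambda>x :: real ^ 'd. of_real (indicator (cball 0 (real k)) x))" for k :: nat
    using I[of k, THEN square_integrableD(1)]
        by (rule bounded_measurableI[where C = 1]) (simp add: indicator_def)
  have sq: "square_integrable (\<phi> k)" for k
    unfolding \<phi>_def by (rule square_integrable_mult[OF bm square_integrable_rep])
  have "(\<lambda>k. \<integral>\<^sup>+ x. ennreal ((cmod (\<phi> k x - rep_L2 u x))\<^sup>2) \<partial>lborel)
      \<longlonglongrightarrow> (\<integral>\<^sup>+ (x :: real ^ 'd). 0 \<partial>lborel)"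
  proof (rule nn_integral_dominated_convergence[where w = "\<lambda>x. ennreal ((cmod (rep_L2 u x))\<^sup>2)"])
    show "(\<integral>\<^sup>+ x. ennreal ((cmod (rep_L2 u x))\<^sup>2) \<partial>lborel) < \<infinity>"
      using square_integrable_rep[of u] by (simp add: square_integrable_def)
    show "AE x in lborel. ennreal ((cmod (\<phi> k x - rep_L2 u x))\<^sup>2)
        \<le> ennreal ((cmod (rep_L2 u x))\<^sup>2)" for k
      by (auto simp: \<phi>_def split: split_indicator)
    show "AE x in lborel. (\<lambda>k. ennreal ((cmod (\<phi> k x - rep_L2 u x))\<^sup>2)) \<longlonglongrightarrow> 0"
    proof (rule AE_I2)
      fix x :: "real ^ 'd"
      obtain N :: nat where N: "norm x \<le> N"
        using real_arch_simple by blast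
      show "(\<lambda>k. ennreal ((cmod (\<phi> k x - rep_L2 u x))\<^sup>2)) \<longlonglongrightarrow> 0"
        using N by (intro tendsto_eventually eventually_sequentiallyI[of N])
          (simp add: \<phi>_def)
    qed
  qed simp_all
  then have "(\<lambda>k. \<integral>\<^sup>+ x. ennreal ((cmod (\<phi> k x - rep_L2 u x))\<^sup>2) \<partial>lborel) \<longlonglongrightarrow> 0"
    by (simp only: nn_integral_const mult_zero_left)
  then have "(\<lambda>k. to_L2 (\<phi> k)) \<longlonglongrightarrow> u"
    by (simp only: tendsto_to_L2_iff[of \<phi> u, OF sq])
  then show ?thesis
    using that int sq by blast
qed

lemma fourier_diff_to_L2:
  assumes "integrable lborel f" "square_integrable f" "integrable lborel g" "square_integrable g"
  shows "norm (to_L2 (fourier_integral f) - to_L2 (fourier_integral g)) \<le> norm (to_L2 f - to_L2 g)"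
proof -
  have "to_L2 (fourier_integral f) - to_L2 (fourier_integral g)
      = to_L2 (fourier_integral (\<lambda>x. f x - g x))"
    using assms by (simp add: diff_to_L2 square_integrable_fourier_integral
        fourier_integral_diff[OF assms(1,3), abs_def])
  then show ?thesis
    using norm_fourier_integral_le[of "\<lambda>x. f x - g x"] assms
    by (simp add: diff_to_L2 square_integrable_diff)
qed

text \<open>By contractivity the transforms of two sequences with the same limit differ by a null
  sequence. This makes the extension independent of the approximation.\<close>

lemma fourier_L2_limit:
  assumes "\<And>k. integrable lborel (\<phi> k)" "\<And>k. square_integrable (\<phi> k)"
    and "\<And>k. integrable lborel (\<psi> k)" "\<And>k. square_integrable (\<psi> k)"
    and "(\<lambda>k. to_L2 (\<phi> k)) \<longlonglongrightarrow> u" "(\<lambda>k. to_L2 (\<psi> k)) \<longlonglongrightarrow> u"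
    and "(\<lambda>k. to_L2 (fourier_integral (\<phi> k))) \<longlonglongrightarrow> w"
  shows "(\<lambda>k. to_L2 (fourier_integral (\<psi> k))) \<longlonglongrightarrow> w"
proof -
  have "(\<lambda>k. to_L2 (\<phi> k) - to_L2 (\<psi> k)) \<longlonglongrightarrow> 0"
    using tendsto_diff[OF assms(5,6)] by simp
  then have "(\<lambda>k. to_L2 (fourier_integral (\<phi> k)) - to_L2 (fourier_integral (\<psi> k))) \<longlonglongrightarrow> 0"
    by (rule Lim_transform_bound[rotated]) (auto intro!: always_eventually fourier_diff_to_L2 assms)
  from tendsto_diff[OF assms(7) this] show ?thesis by simp
qed

lemma is_fourier_L2_exists: "\<exists>w. is_fourier_L2 u w"
proof -
  obtain \<phi> where \<phi>: "\<And>k. integrable lborel (\<phi> k)" "\<And>k. square_integrable (\<phi> k)"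
    "(\<lambda>k. to_L2 (\<phi> k)) \<longlonglongrightarrow> u"
    using L1_approximation[of u] by blast
  have "Cauchy (\<lambda>k. to_L2 (\<phi> k))"
    using \<phi>(3) by (rule LIMSEQ_imp_Cauchy)
  then have "Cauchy (\<lambda>k. to_L2 (fourier_integral (\<phi> k)))"
    unfolding Cauchy_def dist_norm
    by (meson \<phi>(1,2) fourier_diff_to_L2 le_less_trans)
  then obtain w where "(\<lambda>k. to_L2 (fourier_integral (\<phi> k))) \<longlonglongrightarrow> w"
    using Cauchy_convergent convergent_def by blast
  then show ?thesis
    unfolding is_fourier_L2_iff using \<phi> by blast
qed

lemma is_fourier_L2_unique:
  assumes "is_fourier_L2 u w" "is_fourier_L2 u w'"
  shows "w = w'"
proof -
  obtain \<phi> where \<phi>: "\<And>k. integrable lborel (\<phi> k)" "\<And>k. square_integrable (\<phi> k)"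
      "(\<lambda>k. to_L2 (\<phi> k)) \<longlonglongrightarrow> u" "(\<lambda>k. to_L2 (fourier_integral (\<phi> k))) \<longlonglongrightarrow> w"
    using assms(1) unfolding is_fourier_L2_iff by blast
  obtain \<psi> where \<psi>: "\<And>k. integrable lborel (\<psi> k)" "\<And>k. square_integrable (\<psi> k)"
      "(\<lambda>k. to_L2 (\<psi> k)) \<longlonglongrightarrow> u" "(\<lambda>k. to_L2 (fourier_integral (\<psi> k))) \<longlonglongrightarrow> w'"
    using assms(2) unfolding is_fourier_L2_iff by blast
  show ?thesis
    by (rule LIMSEQ_unique[OF fourier_L2_limit[OF \<phi>(1,2) \<psi>(1,2) \<phi>(3) \<psi>(3) \<phi>(4)] \<psi>(4)])
qed

lemma is_fourier_L2_fourier_L2: "is_fourier_L2 u (fourier_L2 u)"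
  unfolding fourier_L2_def
  by (rule theI') (use is_fourier_L2_exists is_fourier_L2_unique in blast)

lemma tendsto_fourier_L2:
  assumes "\<And>k. integrable lborel (\<phi> k)" "\<And>k. square_integrable (\<phi> k)"
    and "(\<lambda>k. to_L2 (\<phi> k)) \<longlonglongrightarrow> u"
  shows "(\<lambda>k. to_L2 (fourier_integral (\<phi> k))) \<longlonglongrightarrow> fourier_L2 u"
proof -
  obtain \<psi> where "\<And>k. integrable lborel (\<psi> k)" "\<And>k. square_integrable (\<psi> k)"
    "(\<lambda>k. to_L2 (\<psi> k)) \<longlonglongrightarrow> u" "(\<lambda>k. to_L2 (fourier_integral (\<psi> k))) \<longlonglongrightarrow> fourier_L2 u"
    using is_fourier_L2_fourier_L2[of u] unfolding is_fourier_L2_iff by blast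
  then show ?thesis
    using fourier_L2_limit assms by blast
qed

lemma fourier_to_L2:
  assumes "integrable lborel f" "square_integrable f"
  shows "fourier_L2 (to_L2 f) = to_L2 (fourier_integral f)"
  using tendsto_fourier_L2[of "\<lambda>_. f" "to_L2 f"] assms by (simp add: LIMSEQ_const_iff)

lemma fourier_L2_add: "fourier_L2 (u + w) = fourier_L2 u + fourier_L2 w"
proof -
  obtain \<phi> where \<phi>: "\<And>k. integrable lborel (\<phi> k)" "\<And>k. square_integrable (\<phi> k)"
      "(\<lambda>k. to_L2 (\<phi> k)) \<longlonglongrightarrow> u"
    using L1_approximation[of u] by blast
  obtain \<psi> where \<psi>: "\<And>k. integrable lborel (\<psi> k)" "\<And>k. square_integrable (\<psi> k)"
      "(\<lambda>k. to_L2 (\<psi> k)) \<longlonglongrightarrow> w"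
    using L1_approximation[of w] by blast
  have "(\<lambda>k. to_L2 (\<lambda>x. \<phi> k x + \<psi> k x)) \<longlonglongrightarrow> u + w"
    using tendsto_add[OF \<phi>(3) \<psi>(3)] by (simp add: add_to_L2 \<phi>(2) \<psi>(2))
  then have "(\<lambda>k. to_L2 (fourier_integral (\<lambda>x. \<phi> k x + \<psi> k x))) \<longlonglongrightarrow> fourier_L2 (u + w)"
    by (intro tendsto_fourier_L2 Bochner_Integration.integrable_add square_integrable_add \<phi> \<psi>)
  moreover have "to_L2 (fourier_integral (\<lambda>x. \<phi> k x + \<psi> k x))
      = to_L2 (fourier_integral (\<phi> k)) + to_L2 (fourier_integral (\<psi> k))" for k
    using \<phi> \<psi> by (simp add: add_to_L2 square_integrable_fourier_integral
        fourier_integral_add[OF \<phi>(1) \<psi>(1), abs_def])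
  ultimately show ?thesis
    using LIMSEQ_unique[OF _ tendsto_add[OF tendsto_fourier_L2[OF \<phi>] tendsto_fourier_L2[OF \<psi>]]] by simp
qed

lemma fourier_L2_scale: "fourier_L2 (c \<cdot> u) = c \<cdot> fourier_L2 u"
proof -
  obtain \<phi> where \<phi>: "\<And>k. integrable lborel (\<phi> k)" "\<And>k. square_integrable (\<phi> k)"
      "(\<lambda>k. to_L2 (\<phi> k)) \<longlonglongrightarrow> u"
    using L1_approximation[of u] by blast
  have "(\<lambda>k. to_L2 (\<lambda>x. c * \<phi> k x)) \<longlonglongrightarrow> c \<cdot> u"
    using bounded_linear.tendsto[OF bounded_linear_scale_L2 \<phi>(3), of c] by (simp add: scale_to_L2 \<phi>(2))
  then have "(\<lambda>k. to_L2 (fourier_integral (\<lambda>x. c * \<phi> k x))) \<longlonglongrightarrow> fourier_L2 (c \<cdot> u)"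
    by (intro tendsto_fourier_L2 integrable_mult_right square_integrable_scale \<phi>)
  moreover have "to_L2 (fourier_integral (\<lambda>x. c * \<phi> k x)) = c \<cdot> to_L2 (fourier_integral (\<phi> k))" for k
    using \<phi> by (simp add: scale_to_L2 square_integrable_fourier_integral
        fourier_integral_scale[abs_def])
  ultimately show ?thesis
    using LIMSEQ_unique[OF _ bounded_linear.tendsto[OF bounded_linear_scale_L2
        tendsto_fourier_L2[OF \<phi>], of c]] by simp
qed

lemma norm_fourier_L2_le: "norm (fourier_L2 u) \<le> norm u"
proof -
  obtain \<phi> where \<phi>: "\<And>k. integrable lborel (\<phi> k)" "\<And>k. square_integrable (\<phi> k)"
      "(\<lambda>k. to_L2 (\<phi> k)) \<longlonglongrightarrow> u"
    using L1_approximation[of u] by blast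
  show ?thesis
    by (rule tendsto_le[OF _ tendsto_norm[OF \<phi>(3)] tendsto_norm[OF tendsto_fourier_L2[OF \<phi>]]])
      (auto intro!: always_eventually norm_fourier_integral_le \<phi>)
qed

lemma bounded_linear_fourier_L2: "bounded_linear (fourier_L2 :: 'd::finite L2 \<Rightarrow> 'd L2)"
  by (rule bounded_linear_intro[where K = 1])
    (auto simp: fourier_L2_add fourier_L2_scale scaleR_L2_def norm_fourier_L2_le)

text \<open>The inverse transform has the conjugate kernel, so it is the transform itself conjugated
  by complex conjugation. It is first identified as the adjoint and only then as the
  inverse.\<close>

definition inv_fourier_L2 :: "'d::finite L2 \<Rightarrow> 'd L2" where
  "inv_fourier_L2 w = cnj_L2 (fourier_L2 (cnj_L2 w))"

lemma bounded_linear_inv_fourier_L2: "bounded_linear (inv_fourier_L2 :: 'd::finite L2 \<Rightarrow> 'd L2)"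
  unfolding inv_fourier_L2_def[abs_def]
  by (intro bounded_linear_compose[OF bounded_linear_cnj_L2]
      bounded_linear_compose[OF bounded_linear_fourier_L2]
      bounded_linear_cnj_L2)

lemma cinner_fourier_L2_left: "cinner (fourier_L2 u) w = cinner u (inv_fourier_L2 w)"
proof -
  obtain \<phi> where \<phi>: "\<And>k. integrable lborel (\<phi> k)" "\<And>k. square_integrable (\<phi> k)"
      "(\<lambda>k. to_L2 (\<phi> k)) \<longlonglongrightarrow> u"
    using L1_approximation[of u] by blast
  obtain \<psi> where \<psi>: "\<And>k. integrable lborel (\<psi> k)" "\<And>k. square_integrable (\<psi> k)"
      "(\<lambda>k. to_L2 (\<psi> k)) \<longlonglongrightarrow> w"
    using L1_approximation[of w] by blast
  have eq: "cinner (fourier_L2 (to_L2 (\<phi> k))) (to_L2 (\<psi> k))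
      = cinner (to_L2 (\<phi> k)) (inv_fourier_L2 (to_L2 (\<psi> k)))" for k
  proof -
    have c: "integrable lborel (\<lambda>x. cnj (\<psi> k x))" "square_integrable (\<lambda>x. cnj (\<psi> k x))"
      using \<psi> by (auto intro: square_integrable_cnj)
    have "cinner (fourier_L2 (to_L2 (\<phi> k))) (to_L2 (\<psi> k))
        = (\<integral>\<xi>. fourier_integral (\<phi> k) \<xi> * cnj (\<psi> k \<xi>) \<partial>lborel)"
      by (simp add: fourier_to_L2 \<phi> cinner_to_L2 square_integrable_fourier_integral \<psi>)
    also have "\<dots> = (\<integral>x. \<phi> k x * fourier_integral (\<lambda>x. cnj (\<psi> k x)) x \<partial>lborel)"
      by (rule fourier_multiplication_formula[OF \<phi>(1) c(1)])
    also have "\<dots> = cinner (to_L2 (\<phi> k)) (inv_fourier_L2 (to_L2 (\<psi> k)))"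
      using c by (simp add: inv_fourier_L2_def cnj_to_L2 \<psi> \<phi> fourier_to_L2 cinner_to_L2
          square_integrable_cnj
          square_integrable_fourier_integral)
    finally show ?thesis .
  qed
  have "(\<lambda>k. cinner (fourier_L2 (to_L2 (\<phi> k))) (to_L2 (\<psi> k))) \<longlonglongrightarrow> cinner (fourier_L2 u) w"
    by (intro tendsto_cinner bounded_linear.tendsto[OF bounded_linear_fourier_L2] \<phi> \<psi>)
  moreover have "(\<lambda>k. cinner (to_L2 (\<phi> k)) (inv_fourier_L2 (to_L2 (\<psi> k))))
      \<longlonglongrightarrow> cinner u (inv_fourier_L2 w)"
    by (intro tendsto_cinner bounded_linear.tendsto[OF bounded_linear_inv_fourier_L2] \<phi> \<psi>)
  ultimately show ?thesis
    unfolding eq by (rule LIMSEQ_unique)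
qed

section \<open>Inversion by testing on modulated Gaussians\<close>

lemma square_integrable_modulated_gauss:
  "square_integrable (\<lambda>x. cis (b \<bullet> x) * of_real (gauss 1 (x - a)))"
proof (rule square_integrableI)
  show "integrable lborel (\<lambda>x. (cmod (cis (b \<bullet> x) * of_real (gauss 1 (x - a))))\<^sup>2)"
  proof (rule Bochner_Integration.integrable_bound)
    show "integrable lborel (\<lambda>x. gauss 1 (x - a))"
      using integrable_lborel_affine[OF _ integrable_gauss[of 1], of 1 "-a"] by simp
    show "AE x in lborel. norm ((cmod (cis (b \<bullet> x) * of_real (gauss 1 (x - a))))\<^sup>2)
        \<le> norm (gauss 1 (x - a))"
      by (intro AE_I2)
        (simp add: norm_mult power2_eq_square mult_left_le gauss_le_1 abs_of_pos gauss_pos less_imp_le)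
  qed measurable
qed measurable

lemma fourier_modulated_gauss_L2:
  "fourier_L2 (to_L2 (\<lambda>x. cis (b \<bullet> x) * of_real (gauss 1 x))) = to_L2 (\<lambda>\<xi>. of_real (gauss 1 (\<xi> - b)))"
proof -
  have "heat 1 x * (2 * pi) powr (real CARD('a) / 2) = gauss 1 x" for x :: "real ^ 'a"
    by (simp add: heat_def powr_minus)
  then have "fourier_integral (\<lambda>x. cis (b \<bullet> x) * of_real (gauss 1 x)) = (\<lambda>\<xi>. of_real (gauss 1 (\<xi> - b)))"
    by (intro ext) (simp add: fourier_modulated_gauss del: of_real_mult)
  then show ?thesis
    using fourier_to_L2[OF integrable_modulated_gauss[of 1 b]
        square_integrable_modulated_gauss[of b 0, simplified]]
    by simp
qed

lemma fourier_integral_translate: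
  assumes [measurable]: "f \<in> borel_measurable borel"
  shows "fourier_integral (\<lambda>x. f (x - b)) \<xi> = cis (- (b \<bullet> \<xi>)) * fourier_integral f \<xi>"
proof -
  have "(\<integral>x. cis (- (x \<bullet> \<xi>)) * f (x - b) \<partial>lborel) = (\<integral>x. cis (- ((b + x) \<bullet> \<xi>)) * f x \<partial>lborel)"
    using integral_lborel_affine[of 1 "\<lambda>x. cis (- (x \<bullet> \<xi>)) * f (x - b)" b] by simp
  also have "\<dots> = cis (- (b \<bullet> \<xi>)) * (\<integral>x. cis (- (x \<bullet> \<xi>)) * f x \<partial>lborel)"
    unfolding integral_mult_right_zero[symmetric] mult.assoc[symmetric] cis_mult
    by (simp add: inner_add_left)
  finally show ?thesis
    by (simp add: fourier_integral_def)
qed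

text \<open>The only family on which inversion is computed explicitly: the transform turns
  modulation into translation, and the adjoint turns it back.\<close>

lemma inv_fourier_modulated_gauss_L2:
  "inv_fourier_L2 (fourier_L2 (to_L2 (\<lambda>x. cis (b \<bullet> x) * of_real (gauss 1 x))))
    = to_L2 (\<lambda>x. cis (b \<bullet> x) * of_real (gauss 1 x))"
proof -
  have sq: "square_integrable (\<lambda>x. complex_of_real (gauss 1 (x - b)))"
    using square_integrable_modulated_gauss[of 0 b] by simp
  have int: "integrable lborel (\<lambda>x. complex_of_real (gauss 1 (x - b)))"
    using integrable_lborel_affine[OF _ integrable_gauss[of 1], of 1 "-b"]
        by (simp add: complex_of_real_integrable_eq)
  have "fourier_integral (\<lambda>x. complex_of_real (gauss 1 (x - b)))
      = (\<lambda>\<xi>. cis ((-b) \<bullet> \<xi>) * of_real (gauss 1 \<xi>))"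
    using fourier_integral_translate[of "\<lambda>x. complex_of_real (gauss 1 x)" b]
    by (intro ext) (simp add: fourier_gauss_1)
  then have "inv_fourier_L2 (to_L2 (\<lambda>\<xi>. of_real (gauss 1 (\<xi> - b))))
      = cnj_L2 (to_L2 (\<lambda>\<xi>. cis ((-b) \<bullet> \<xi>) * of_real (gauss 1 \<xi>)))"
    by (simp add: inv_fourier_L2_def cnj_to_L2 sq fourier_to_L2 int)
  also have "\<dots> = to_L2 (\<lambda>x. cis (b \<bullet> x) * of_real (gauss 1 x))"
    using square_integrable_modulated_gauss[of "-b" 0] by (simp add: cnj_to_L2 cis_cnj)
  finally show ?thesis
    by (simp only: fourier_modulated_gauss_L2)
qed

text \<open>Testing against the modulated Gaussians amounts to computing the Fourier integral of the
  product with a Gaussian, which determines an \<open>L\<^sup>2\<close> function.\<close>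

lemma modulated_gauss_total:
  assumes "\<And>b. cinner w (to_L2 (\<lambda>x. cis (b \<bullet> x) * of_real (gauss 1 x))) = 0"
  shows "w = 0"
proof -
  have sq: "square_integrable (\<lambda>x. cis (b \<bullet> x) * of_real (gauss 1 x))" for b
    using square_integrable_modulated_gauss[of b 0] by simp
  define W where "W x = rep_L2 w x * of_real (gauss 1 x)" for x
  have W: "integrable lborel W"
    unfolding W_def using integrable_mult_sq[OF square_integrable_rep sq[of 0]] by simp
  have "fourier_integral W b = 0" for b
  proof -
    have "(\<integral>x. cis (- (x \<bullet> b)) * W x \<partial>lborel)
        = cinner (to_L2 (rep_L2 w)) (to_L2 (\<lambda>x. cis (b \<bullet> x) * of_real (gauss 1 x)))"
      by (subst cinner_to_L2[OF square_integrable_rep sq])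
          (simp add: W_def cis_cnj inner_commute mult_ac)
    then show ?thesis
      using assms[of b] by (simp add: fourier_integral_def)
  qed
  from fourier_integral_injective[OF W this] have "AE x in lborel. rep_L2 w x = 0"
    by eventually_elim (simp add: W_def less_imp_neq[OF gauss_pos, symmetric])
  then have "to_L2 (rep_L2 w) = to_L2 (\<lambda>x. 0)"
    by (intro to_L2_cong square_integrable_rep square_integrable_zero)
  then show ?thesis
    by (simp add: zero_to_L2)
qed

lemma cinner_inv_fourier_L2_left: "cinner (inv_fourier_L2 u) w = cinner u (fourier_L2 w)"
  by (metis cinner_commute cinner_fourier_L2_left)

text \<open>The composition of the transform with its adjoint is symmetric and fixes the modulated
  Gaussians. Hence its difference from the identity has range orthogonal to a total family.\<close>

theorem inv_fourier_fourier_L2 [simp]: "inv_fourier_L2 (fourier_L2 u) = u"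
proof -
  have "inv_fourier_L2 (fourier_L2 u) - u = 0"
    by (rule modulated_gauss_total)
      (simp add: cinner_diff_left cinner_inv_fourier_L2_left cinner_fourier_L2_left
          inv_fourier_modulated_gauss_L2)
  then show ?thesis by simp
qed

theorem fourier_inv_fourier_L2 [simp]: "fourier_L2 (inv_fourier_L2 w) = w"
proof -
  \<comment> \<open>Conjugating the left inverse law by complex conjugation exchanges the roles of
    the transform and its adjoint, which gives the right inverse law.\<close>
  have "cnj_L2 (inv_fourier_L2 (fourier_L2 (cnj_L2 w))) = w"
    by simp
  then show ?thesis
    by (simp only: inv_fourier_L2_def cnj_cnj_L2)
qed

lemma cinner_fourier_L2 [simp]: "cinner (fourier_L2 u) (fourier_L2 w) = cinner u w"
  by (simp add: cinner_fourier_L2_left)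

lemma cinner_inv_fourier_L2 [simp]: "cinner (inv_fourier_L2 u) (inv_fourier_L2 w) = cinner u w"
  by (simp add: cinner_inv_fourier_L2_left)

lemma norm_fourier_L2 [simp]: "norm (fourier_L2 u) = norm u"
  by (simp add: norm_eq_sqrt_inner inner_L2_def)

lemma norm_inv_fourier_L2 [simp]: "norm (inv_fourier_L2 u) = norm u"
  by (simp add: norm_eq_sqrt_inner inner_L2_def)

subsection \<open>The Schroedinger form\<close>

lemma L2_dominated_convergence:
  fixes f :: "nat \<Rightarrow> real ^ 'd \<Rightarrow> complex"
  assumes f: "\<And>k. square_integrable (f k)" and [measurable]: "l \<in> borel_measurable borel"
    and g: "square_integrable g"
    and le: "\<And>k x. cmod (f k x) \<le> cmod (g x)"
    and lim: "\<And>x. (\<lambda>k. f k x) \<longlonglongrightarrow> l x"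
  shows "square_integrable l" "(\<lambda>k. to_L2 (f k)) \<longlonglongrightarrow> to_L2 l"
proof -
  note [measurable] = square_integrableD(1)[OF f] square_integrableD(1)[OF g]
  have lle: "cmod (l x) \<le> cmod (g x)" for x
    using tendsto_norm[OF lim] by (rule tendsto_upperbound) (auto simp: le)
  show sql: "square_integrable l"
    by (rule square_integrable_bound[OF g, where C = 1]) (auto simp: lle)
  note [measurable] = square_integrableD(1)[OF square_integrable_rep[of "to_L2 l"]]
  have "(\<lambda>k. \<integral>\<^sup>+ x. ennreal ((cmod (f k x - l x))\<^sup>2) \<partial>lborel) \<longlonglongrightarrow> (\<integral>\<^sup>+ (x :: real ^ 'd). 0 \<partial>lborel)"
  proof (rule nn_integral_dominated_convergence[where w = "\<lambda>x. ennreal ((cmod (2 * g x))\<^sup>2)"])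
    show "(\<integral>\<^sup>+ x. ennreal ((cmod (2 * g x))\<^sup>2) \<partial>lborel) < \<infinity>"
      using square_integrable_scale[OF g, of 2] by (simp add: square_integrable_def)
    have "cmod (f k x - l x) \<le> cmod (2 * g x)" for k x
      using norm_triangle_ineq4[of "f k x" "l x"] le[of k x] lle[of x] by (simp add: norm_mult)
    then show "AE x in lborel. ennreal ((cmod (f k x - l x))\<^sup>2) \<le> ennreal ((cmod (2 * g x))\<^sup>2)" for k
      by (intro AE_I2 ennreal_leI power_mono) auto
    show "AE x in lborel. (\<lambda>k. ennreal ((cmod (f k x - l x))\<^sup>2)) \<longlonglongrightarrow> 0"
    proof (rule AE_I2)
      fix x
      have "(\<lambda>k. ennreal ((cmod (f k x - l x))\<^sup>2)) \<longlonglongrightarrow> ennreal ((cmod (l x - l x))\<^sup>2)"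
        by (intro tendsto_ennrealI tendsto_intros lim)
      then show "(\<lambda>k. ennreal ((cmod (f k x - l x))\<^sup>2)) \<longlonglongrightarrow> 0" by simp
    qed
  qed simp_all
  then have *: "(\<lambda>k. \<integral>\<^sup>+ x. ennreal ((cmod (f k x - l x))\<^sup>2) \<partial>lborel) \<longlonglongrightarrow> 0"
    by (simp only: nn_integral_const mult_zero_left)
  have "(\<integral>\<^sup>+ x. ennreal ((cmod (f k x - rep_L2 (to_L2 l) x))\<^sup>2) \<partial>lborel)
      = (\<integral>\<^sup>+ x. ennreal ((cmod (f k x - l x))\<^sup>2) \<partial>lborel)" for k
    by (rule nn_integral_cong_AE) (use rep_to_L2[OF sql] in eventually_elim, simp)
  with * show "(\<lambda>k. to_L2 (f k)) \<longlonglongrightarrow> to_L2 l"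
    using tendsto_to_L2_iff[of f "to_L2 l", OF f] by simp
qed

lemma norm_cis_diff_le: "cmod (cis a - cis b) \<le> \<bar>a - b\<bar>"
proof -
  have "cis a - cis b = cis b * (iexp (a - b) - 1)"
    by (simp add: cis_conv_exp right_diff_distrib mult_exp_exp)
  then show ?thesis
    using iexp_approx1[of "a - b" 0] by (simp add: norm_mult)
qed

text \<open>\<open>R\<close> may be negative, which forces V = 0; hence the absolute values of
  \<open>R\<close> in the estimates.\<close>

locale compact_potential =
  fixes V :: "real ^ 'd \<Rightarrow> real" and s M R :: real
  assumes s_pos: "s > 0"
    and V_measurable [measurable]: "V \<in> borel_measurable borel"
    and V_nonneg: "V x \<ge> 0"
    and V_le: "V x \<le> M"
    and V_support: "V x \<noteq> 0 \<Longrightarrow> norm x \<le> R"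
begin

definition a :: "real ^ 'd \<Rightarrow> real" where
  "a \<xi> = norm \<xi> powr (2 * s)"

definition \<sigma> :: "real ^ 'd \<Rightarrow> real" where
  "\<sigma> \<xi> = 1 / sqrt (a \<xi> + 1)"

text \<open>Parametrising the form domain by \<open>k = (a + 1)\<^sup>1\<^sup>/\<^sup>2 \<F> u\<close> with \<open>k\<close> ranging over all of \<open>L\<^sup>2\<close> makes all forms bounded:
  the operator \<open>A E\<close> below represents the form of \<open>H\<^sub>s - E\<close>.\<close>

definition S :: "'d L2 \<Rightarrow> 'd L2" where
  "S k = mult_L2 (\<lambda>\<xi>. of_real (\<sigma> \<xi>)) k"

definition state :: "'d L2 \<Rightarrow> 'd L2" where
  "state k = inv_fourier_L2 (S k)"

definition VL :: "'d L2 \<Rightarrow> 'd L2" where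
  "VL u = mult_L2 (\<lambda>x. of_real (V x)) u"

text \<open>The kinetic part is
  \<open>\<sigma> (a - E) \<sigma> = 1 - (1 + E) \<sigma>\<^sup>2\<close>, bounded although
  \<open>a\<close> is not.\<close>

definition A :: "real \<Rightarrow> 'd L2 \<Rightarrow> 'd L2" where
  "A E k = k - of_real (1 + E) \<cdot> S (S k) - S (fourier_L2 (VL (state k)))"

definition P :: "'d L2 \<Rightarrow> real" where
  "P k = inner (VL (state k)) (state k)"

lemma a_measurable [measurable]: "a \<in> borel_measurable borel"
  unfolding a_def by measurable

lemma a_nonneg [simp]: "a \<xi> \<ge> 0"
  by (simp add: a_def)

lemma a1_pos [simp]: "a \<xi> + 1 > 0"
  using a_nonneg[of \<xi>] by linarith

lemma \<sigma>_measurable [measurable]: "\<sigma> \<in> borel_measurable borel"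
  unfolding \<sigma>_def by measurable

lemma \<sigma>_pos [simp]: "\<sigma> \<xi> > 0"
  by (simp add: \<sigma>_def)

lemma \<sigma>_le_1 [simp]: "\<sigma> \<xi> \<le> 1"
  by (simp add: \<sigma>_def)

lemma \<sigma>_square: "\<sigma> \<xi> * \<sigma> \<xi> = 1 / (a \<xi> + 1)"
  by (simp add: \<sigma>_def)

lemma bm_\<sigma>: "bounded_measurable (\<lambda>\<xi>. of_real (\<sigma> \<xi>))"
  by (rule bounded_measurableI[where C = 1]) (simp_all add: abs_of_pos)

lemma M_nonneg: "M \<ge> 0"
  using V_nonneg V_le order_trans by blast

lemma bm_V: "bounded_measurable (\<lambda>x. of_real (V x))"
  by (rule bounded_measurableI[where C = M]) (simp_all add: V_nonneg V_le)

lemma bounded_linear_S: "bounded_linear S"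
  unfolding S_def[abs_def] by (rule bounded_linear_mult_L2[OF bm_\<sigma>])

lemma bounded_linear_VL: "bounded_linear VL"
  unfolding VL_def[abs_def] by (rule bounded_linear_mult_L2[OF bm_V])

lemma bounded_linear_state: "bounded_linear state"
  unfolding state_def[abs_def]
  by (rule bounded_linear_compose[OF bounded_linear_inv_fourier_L2 bounded_linear_S])

lemma bounded_linear_A: "bounded_linear (A E)"
  unfolding A_def[abs_def]
  by (intro bounded_linear_sub bounded_linear_ident bounded_linear_compose[OF bounded_linear_scale_L2]
      bounded_linear_compose[OF bounded_linear_S] bounded_linear_compose[OF bounded_linear_fourier_L2]
      bounded_linear_compose[OF bounded_linear_VL] bounded_linear_state bounded_linear_S)

lemmas S_add = linear_add[OF bounded_linear.linear[OF bounded_linear_S]]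
lemmas S_diff = linear_diff[OF bounded_linear.linear[OF bounded_linear_S]]
lemmas state_diff = linear_diff[OF bounded_linear.linear[OF bounded_linear_state]]
lemmas VL_diff = linear_diff[OF bounded_linear.linear[OF bounded_linear_VL]]
lemmas A_add = linear_add[OF bounded_linear.linear[OF bounded_linear_A]]
lemmas A_scaleR = linear_scale[OF bounded_linear.linear[OF bounded_linear_A]]

lemma S_scale: "S (c \<cdot> k) = c \<cdot> S k"
  by (simp add: S_def mult_L2_scale bm_\<sigma>)

lemma norm_S_le: "norm (S k) \<le> norm k"
  using norm_mult_L2_le[of "\<lambda>\<xi>. of_real (\<sigma> \<xi>)" 1 k] by (simp add: S_def abs_of_pos)

lemma norm_state [simp]: "norm (state k) = norm (S k)"
  by (simp add: state_def)

lemma norm_VL_le: "norm (VL u) \<le> M * norm u"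
  unfolding VL_def by (rule norm_mult_L2_le) (simp_all add: V_nonneg V_le)

lemma cinner_S: "cinner (S k) l = cinner k (S l)"
  using cinner_mult_L2_right[OF bm_\<sigma>, of k l] by (simp add: S_def)

lemma cinner_VL: "cinner (VL k) l = cinner k (VL l)"
  using cinner_mult_L2_right[OF bm_V, of k l] by (simp add: VL_def)

lemma cinner_A: "cinner (A E k) l = cinner k (A E l)"
proof -
  have "cinner (S (fourier_L2 (VL (state k)))) l = cinner (VL (state k)) (state l)"
    by (simp add: state_def cinner_S cinner_fourier_L2_left)
  moreover have "cinner k (S (fourier_L2 (VL (state l)))) = cinner (state k) (VL (state l))"
    by (simp add: state_def cinner_S[symmetric] cinner_inv_fourier_L2_left)
  ultimately show ?thesis
    by (simp add: A_def cinner_diff_left cinner_diff_right cinner_scale_left cinner_scale_right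
        cinner_S cinner_VL)
qed

lemma inner_A: "inner (A E k) l = inner k (A E l)"
  by (simp add: inner_L2_def cinner_A)

text \<open>Since \<open>a = 1 / \<sigma>\<^sup>2 - 1\<close>, the kinetic energy of
  \<open>state k\<close> is \<open>(norm k)\<^sup>2 - (norm (S k))\<^sup>2\<close>; moreover
  \<open>norm (S k)\<close> is the norm of the state and \<open>P k\<close> its potential
  energy.\<close>

lemma form_A: "inner (A E k) k = (norm k)\<^sup>2 - (1 + E) * (norm (S k))\<^sup>2 - P k"
proof -
  have "cinner (S (fourier_L2 (VL (state k)))) k = cinner (VL (state k)) (state k)"
    by (simp add: state_def cinner_S cinner_fourier_L2_left)
  moreover have "cinner (S (S k)) k = cinner (S k) (S k)"
    by (simp add: cinner_S)
  ultimately show ?thesis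
    by (simp add: A_def inner_L2_def P_def cinner_diff_left cinner_scale_left norm_L2_sq)
qed

lemma P_le: "P k \<le> M * (norm (S k))\<^sup>2"
proof -
  have "P k \<le> norm (VL (state k)) * norm (state k)"
    unfolding P_def by (rule norm_cauchy_schwarz)
  also have "\<dots> \<le> (M * norm (state k)) * norm (state k)"
    by (intro mult_right_mono norm_VL_le) simp
  finally show ?thesis
    by (simp add: power2_eq_square mult.assoc)
qed

lemma norm_S_pos:
  assumes "k \<noteq> 0"
  shows "norm (S k) > 0"
proof (rule ccontr)
  assume "\<not> norm (S k) > 0"
  then have "S k = 0" by simp
  obtain f where f: "square_integrable f" "k = to_L2 f"
    using L2_cases by metis
  have "to_L2 (\<lambda>\<xi>. of_real (\<sigma> \<xi>) * f \<xi>) = to_L2 (\<lambda>_. 0)"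
    using \<open>S k = 0\<close> by (simp add: S_def f bmult_to_L2 bm_\<sigma> zero_to_L2)
  then have "AE \<xi> in lborel. of_real (\<sigma> \<xi>) * f \<xi> = 0"
    by (subst (asm) to_L2_eq_iff) (auto intro: square_integrable_mult bm_\<sigma> f square_integrable_zero)
  then have "AE \<xi> in lborel. f \<xi> = 0"
    by eventually_elim (simp add: less_imp_neq[OF \<sigma>_pos, symmetric])
  then have "k = 0"
    unfolding f zero_to_L2 by (intro to_L2_cong f square_integrable_zero)
  with assms show False by simp
qed

subsection \<open>Eigenvectors from the form\<close>

text \<open>1 + |\<xi>|^2 is at most twice the larger of 1 and |\<xi>|^2, whence the constant. This
  compares the Sobolev weight with the graph norm of the operator.\<close>

lemma weight_le: "(1 + (norm \<xi>)\<^sup>2) powr (2 * s) \<le> 2 powr (2 * s) * (1 + (a \<xi>)\<^sup>2)"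
proof (cases "norm \<xi> \<le> 1")
  case True
  then have "1 + (norm \<xi>)\<^sup>2 \<le> 2"
    by (simp add: power_le_one)
  then have "(1 + (norm \<xi>)\<^sup>2) powr (2 * s) \<le> 2 powr (2 * s)"
    using s_pos by (intro powr_mono2) (auto simp: add_nonneg_nonneg)
  also have "\<dots> \<le> 2 powr (2 * s) * (1 + (a \<xi>)\<^sup>2)"
    by (rule mult_right_le_one_le[of _ 1, simplified] | simp add: mult_le_cancel_left1)+
  finally show ?thesis .
next
  case False
  then have 1: "1 \<le> (norm \<xi>)\<^sup>2"
    by (simp add: one_le_power)
  then have "(1 + (norm \<xi>)\<^sup>2) powr (2 * s) \<le> (2 * (norm \<xi>)\<^sup>2) powr (2 * s)"
    using s_pos by (intro powr_mono2) auto
  also have "\<dots> = 2 powr (2 * s) * ((norm \<xi>)\<^sup>2) powr (2 * s)"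
    by (simp add: powr_mult)
  also have "((norm \<xi>)\<^sup>2) powr (2 * s) = (a \<xi>)\<^sup>2"
    by (simp add: a_def power2_eq_square powr_mult)
  also have "2 powr (2 * s) * (a \<xi>)\<^sup>2 \<le> 2 powr (2 * s) * (1 + (a \<xi>)\<^sup>2)"
    by (intro mult_left_mono) auto
  finally show ?thesis .
qed

text \<open>With f representing k, g = \<sigma> f the transform of the state and W that of V times
  the state, \<open>A E k = 0\<close> reads f - (1 + E) \<sigma> g = \<sigma> W. Cancelling \<sigma>
  gives the eigenvalue equation in Fourier space, and with it the regularity of the state.\<close>

lemma eigenvector:
  assumes A0: "A E k = 0"
  shows "state k \<in> eigenspace (sobolev (2 * s)) (schroedinger s V) E"
proof -
  define u where "u = state k"
  have Fu: "fourier_L2 u = S k"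
    by (simp add: u_def state_def)
  obtain f where f: "square_integrable f" "k = to_L2 f"
    using L2_cases by metis
  obtain W where W: "square_integrable W" "fourier_L2 (VL u) = to_L2 W"
    using L2_cases by metis
  define g where "g \<xi> = of_real (\<sigma> \<xi>) * f \<xi>" for \<xi>
  have g: "square_integrable g" "S k = to_L2 g"
    using f by (auto simp: g_def[abs_def] S_def bmult_to_L2 bm_\<sigma> square_integrable_mult)
  have sg: "square_integrable (\<lambda>\<xi>. of_real (\<sigma> \<xi>) * g \<xi>)" "S (S k) = to_L2 (\<lambda>\<xi>. of_real (\<sigma> \<xi>) * g \<xi>)"
    and sW: "square_integrable (\<lambda>\<xi>. of_real (\<sigma> \<xi>) * W \<xi>)"
        "S (to_L2 W) = to_L2 (\<lambda>\<xi>. of_real (\<sigma> \<xi>) * W \<xi>)"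
    using g W by (auto simp: S_def bmult_to_L2 bm_\<sigma> square_integrable_mult)
  have "to_L2 (\<lambda>\<xi>. f \<xi> - of_real (1 + E) * (of_real (\<sigma> \<xi>) * g \<xi>)) = k - of_real (1 + E) \<cdot> S (S k)"
    unfolding sg(2) scale_to_L2[OF sg(1)]
    by (subst f(2)) (rule diff_to_L2[OF f(1) square_integrable_scale[OF sg(1)], symmetric])
  also have "\<dots> = S (to_L2 W)"
    using A0 by (simp add: A_def W(2)[symmetric] u_def)
  finally have "to_L2 (\<lambda>\<xi>. f \<xi> - of_real (1 + E) * (of_real (\<sigma> \<xi>) * g \<xi>))
      = to_L2 (\<lambda>\<xi>. of_real (\<sigma> \<xi>) * W \<xi>)"
    by (simp only: sW(2))
  then have AE1: "AE \<xi> in lborel. f \<xi> - of_real (1 + E) * (of_real (\<sigma> \<xi>) * g \<xi>) = of_real (\<sigma> \<xi>) * W \<xi>"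
    by (subst (asm) to_L2_eq_iff) (auto intro!: square_integrable_diff square_integrable_scale f sg sW)
  \<comment> \<open>Here f is rewritten as \<sigma> (a + 1) g, after which the positive factor
    \<sigma> cancels.\<close>
  have AE2: "AE \<xi> in lborel. of_real (a \<xi>) * g \<xi> = W \<xi> + of_real E * g \<xi>"
    using AE1
  proof eventually_elim
    case (elim \<xi>)
    have "complex_of_real (\<sigma> \<xi> * \<sigma> \<xi> * (a \<xi> + 1)) = 1"
      unfolding \<sigma>_square using a1_pos[of \<xi>] by (simp del: a1_pos)
    then have 1: "of_real (\<sigma> \<xi>) * (of_real (a \<xi>) + 1) * g \<xi> = f \<xi>"
      by (simp add: g_def algebra_simps) (metis distrib_right mult.assoc mult.commute mult_1)
    have "of_real (\<sigma> \<xi>) * ((of_real (a \<xi>) + 1) * g \<xi> - of_real (1 + E) * g \<xi>) = of_real (\<sigma> \<xi>) * W \<xi>"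
      using elim unfolding 1[symmetric] by (simp add: algebra_simps)
    then have "(of_real (a \<xi>) + 1) * g \<xi> - of_real (1 + E) * g \<xi> = W \<xi>"
      by (simp add: less_imp_neq[OF \<sigma>_pos, symmetric])
    then show ?case
      by (simp add: algebra_simps)
  qed
  have sR: "square_integrable (\<lambda>\<xi>. W \<xi> + of_real E * g \<xi>)"
    by (intro square_integrable_add square_integrable_scale W g)
  note [measurable] = square_integrableD(1)[OF g(1)] square_integrableD(1)[OF sR]
  \<comment> \<open>Membership in the operator domain is read off from the equation: a g agrees
    almost everywhere with a square-integrable function.\<close>
  have ag: "square_integrable (\<lambda>\<xi>. of_real (a \<xi>) * g \<xi>)"
  proof -
    have "(\<integral>\<^sup>+ \<xi>. ennreal ((cmod (of_real (a \<xi>) * g \<xi>))\<^sup>2) \<partial>lborel)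
        = (\<integral>\<^sup>+ \<xi>. ennreal ((cmod (W \<xi> + of_real E * g \<xi>))\<^sup>2) \<partial>lborel)"
      by (rule nn_integral_cong_AE) (use AE2 in eventually_elim, simp)
    then show ?thesis
      using sR by (simp add: square_integrable_def)
  qed
  have Fa: "mult_L2 (\<lambda>\<xi>. of_real (norm \<xi> powr (2 * s))) (fourier_L2 u)
      = fourier_L2 (VL u) + of_real E \<cdot> fourier_L2 u"
  proof -
    have "mult_L2 (\<lambda>\<xi>. of_real (a \<xi>)) (to_L2 g) = to_L2 (\<lambda>\<xi>. of_real (a \<xi>) * g \<xi>)"
      by (intro mult_to_L2 g ag) measurable
    also have "\<dots> = to_L2 (\<lambda>\<xi>. W \<xi> + of_real E * g \<xi>)"
      by (intro to_L2_cong ag sR AE2)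
    also have "\<dots> = fourier_L2 (VL u) + of_real E \<cdot> fourier_L2 u"
      by (simp add: W Fu g scale_to_L2 add_to_L2 square_integrable_scale)
    finally show ?thesis
      by (simp add: a_def Fu g)
  qed
  \<comment> \<open>The description in \<open>frac_laplacian\<close> is unique because the transform
    is injective.\<close>
  have "frac_laplacian s u = VL u + of_real E \<cdot> u"
    unfolding frac_laplacian_def Fa
  proof (rule the_equality)
    show "fourier_L2 (VL u + of_real E \<cdot> u) = fourier_L2 (VL u) + of_real E \<cdot> fourier_L2 u"
      by (simp add: fourier_L2_add fourier_L2_scale)
    then show "w = VL u + of_real E \<cdot> u" if "fourier_L2 w
        = fourier_L2 (VL u) + of_real E \<cdot> fourier_L2 u" for w
      using that by (metis inv_fourier_fourier_L2)
  qed
  then have H: "schroedinger s V u = of_real E \<cdot> u"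
    by (simp add: schroedinger_def VL_def)
  have "u \<in> sobolev (2 * s)"
  proof -
    have rg: "AE \<xi> in lborel. rep_L2 (fourier_L2 u) \<xi> = g \<xi>"
      unfolding Fu g(2) by (rule rep_to_L2[OF g(1)])
    have "(\<integral>\<^sup>+ \<xi>. ennreal ((1 + (norm \<xi>)\<^sup>2) powr (2 * s) * (cmod (rep_L2 (fourier_L2 u) \<xi>))\<^sup>2) \<partial>lborel)
        \<le> (\<integral>\<^sup>+ \<xi>. ennreal (2 powr (2 * s)) * (ennreal ((cmod (g \<xi>))\<^sup>2)
            + ennreal ((cmod (of_real (a \<xi>) * g \<xi>))\<^sup>2)) \<partial>lborel)"
    proof (rule nn_integral_mono_AE, use rg in eventually_elim)
      case (elim \<xi>)
      have "(1 + (norm \<xi>)\<^sup>2) powr (2 * s) * (cmod (g \<xi>))\<^sup>2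
          \<le> 2 powr (2 * s) * (1 + (a \<xi>)\<^sup>2) * (cmod (g \<xi>))\<^sup>2"
        by (intro mult_right_mono weight_le) simp
      also have "\<dots> = 2 powr (2 * s) * ((cmod (g \<xi>))\<^sup>2 + (cmod (of_real (a \<xi>) * g \<xi>))\<^sup>2)"
        by (simp add: norm_mult power_mult_distrib algebra_simps)
      finally show ?case
        unfolding elim
        by (simp add: ennreal_mult[symmetric] ennreal_plus[symmetric] del: ennreal_plus)
    qed
    also have "\<dots> = ennreal (2 powr (2 * s)) * ((\<integral>\<^sup>+ \<xi>. ennreal ((cmod (g \<xi>))\<^sup>2) \<partial>lborel)
        + (\<integral>\<^sup>+ \<xi>. ennreal ((cmod (of_real (a \<xi>) * g \<xi>))\<^sup>2) \<partial>lborel))"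
      by (simp add: nn_integral_cmult nn_integral_add)
    also have "\<dots> < \<infinity>"
      using g(1) ag by (simp add: square_integrable_def ennreal_mult_less_top)
    finally show ?thesis
      by (simp add: sobolev_def)
  qed
  with H show ?thesis
    by (simp add: eigenspace_def u_def)
qed

subsection \<open>Compactness of the potential\<close>

text \<open>A genuine function representing the transform of V u, defined at every point, so that
  pointwise bounds and equicontinuity make sense. It exists because V u is integrable.\<close>

definition VF :: "'d L2 \<Rightarrow> real ^ 'd \<Rightarrow> complex" where
  "VF u = fourier_integral (\<lambda>x. of_real (V x) * rep_L2 u x)"

lemma square_integrable_V: "square_integrable (\<lambda>x. complex_of_real (V x))"
proof (rule square_integrableI)
  show "integrable lborel (\<lambda>x. (cmod (complex_of_real (V x)))\<^sup>2)"
  proof (rule Bochner_Integration.integrable_bound)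
    show "integrable lborel (\<lambda>x. M\<^sup>2 * indicator (cball 0 R) x :: real)"
      by (intro integrable_mult_right integrable_real_indicator emeasure_compact_finite) auto
    show "AE x in lborel. norm ((cmod (complex_of_real (V x)))\<^sup>2)
        \<le> norm (M\<^sup>2 * indicator (cball 0 R) x :: real)"
      using V_support by (intro AE_I2) (auto simp: indicator_def V_nonneg V_le intro!: power_mono)
  qed measurable
qed measurable

lemma integrable_V_mult:
  assumes "square_integrable f"
  shows "integrable lborel (\<lambda>x. of_real (V x) * f x)"
  by (rule integrable_mult_sq[OF square_integrable_V assms])

definition CV :: real where
  "CV = (2 * pi) powr (- real CARD('d) / 2) * norm (to_L2 (\<lambda>x. complex_of_real (V x)) :: 'd L2)"

lemma CV_nonneg: "CV \<ge> 0"
  by (simp add: CV_def)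

lemma integral_V_le:
  "(2 * pi) powr (- real CARD('d) / 2) * (\<integral>x. cmod (of_real (V x) * rep_L2 u x) \<partial>lborel) \<le> CV * norm u"
proof -
  let ?f = "\<lambda>x. complex_of_real (cmod (rep_L2 u x))"
  have m: "rep_L2 u \<in> borel_measurable borel"
    by (rule square_integrableD(1)[OF square_integrable_rep])
  have f: "square_integrable ?f"
    using m by (intro square_integrable_bound[OF square_integrable_rep[of u], where C = 1]) auto
  have "(norm (to_L2 ?f))\<^sup>2 = (norm (to_L2 (rep_L2 u)))\<^sup>2"
    by (simp only: norm_L2_to_L2[OF f] norm_L2_to_L2[OF square_integrable_rep] norm_of_real
        abs_norm_cancel)
  then have nf: "norm (to_L2 ?f) = norm u"
    by (simp add: power2_eq_iff_nonneg)
  have "complex_of_real (\<integral>x. cmod (of_real (V x) * rep_L2 u x) \<partial>lborel)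
      = (\<integral>x. complex_of_real (V x) * cnj (?f x) \<partial>lborel)"
    by (simp add: norm_mult V_nonneg flip: integral_complex_of_real)
  also have "\<dots> = cinner (to_L2 (\<lambda>x. complex_of_real (V x))) (to_L2 ?f)"
    by (simp only: cinner_to_L2[OF square_integrable_V f])
  finally have "cmod (complex_of_real (\<integral>x. cmod (of_real (V x) * rep_L2 u x) \<partial>lborel))
      \<le> norm (to_L2 (\<lambda>x. complex_of_real (V x)) :: 'd L2) * norm (to_L2 ?f)"
    by (simp only: cinner_Cauchy_Schwarz)
  then have "(\<integral>x. cmod (of_real (V x) * rep_L2 u x) \<partial>lborel)
      \<le> norm (to_L2 (\<lambda>x. complex_of_real (V x)) :: 'd L2) * norm u"
    unfolding nf norm_of_real by linarith
  then show ?thesis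
    unfolding CV_def mult.assoc by (rule mult_left_mono) simp
qed

lemma VF_bound: "cmod (VF u \<xi>) \<le> CV * norm u"
  unfolding VF_def
  using fourier_integral_bound[OF integrable_V_mult[OF square_integrable_rep]] integral_V_le
      by (rule order_trans)

text \<open>On the support of V, where |x| \<le> R, the phases at two frequencies differ by at most
  R times their distance. Compact support in x thus becomes equicontinuity in frequency.\<close>

lemma VF_Lipschitz: "cmod (VF u \<xi> - VF u \<eta>) \<le> CV * norm u * \<bar>R\<bar> * norm (\<xi> - \<eta>)"
proof -
  let ?f = "\<lambda>x. of_real (V x) * rep_L2 u x"
  let ?c = "(2 * pi) powr (- real CARD('d) / 2)"
  note int = integrable_V_mult[OF square_integrable_rep, of u]
  have pt: "cmod (cis (- (x \<bullet> \<xi>)) * ?f x - cis (- (x \<bullet> \<eta>)) * ?f x)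
      \<le> \<bar>R\<bar> * norm (\<xi> - \<eta>) * cmod (?f x)" for x
  proof (cases "V x = 0")
    case False
    have "cmod (cis (- (x \<bullet> \<xi>)) - cis (- (x \<bullet> \<eta>))) \<le> \<bar>x \<bullet> (\<xi> - \<eta>)\<bar>"
      using norm_cis_diff_le[of "- (x \<bullet> \<xi>)" "- (x \<bullet> \<eta>)"]
          by (simp add: inner_diff_right abs_minus_commute)
    also have "\<dots> \<le> norm x * norm (\<xi> - \<eta>)"
      by (rule Cauchy_Schwarz_ineq2)
    also have "\<dots> \<le> \<bar>R\<bar> * norm (\<xi> - \<eta>)"
      using V_support[OF False] by (intro mult_right_mono) auto
    finally have "cmod (cis (- (x \<bullet> \<xi>)) - cis (- (x \<bullet> \<eta>))) * cmod (?f x)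
        \<le> \<bar>R\<bar> * norm (\<xi> - \<eta>) * cmod (?f x)"
      by (rule mult_right_mono) simp
    then show ?thesis
      by (simp only: left_diff_distrib[symmetric] norm_mult)
  qed simp
  have "VF u \<xi> - VF u \<eta> = of_real ?c * (\<integral>x. cis (- (x \<bullet> \<xi>)) * ?f x - cis (- (x \<bullet> \<eta>)) * ?f x \<partial>lborel)"
    unfolding VF_def fourier_integral_def right_diff_distrib[symmetric]
    by (subst Bochner_Integration.integral_diff[OF integrable_cis_mult(1)[OF int]
        integrable_cis_mult(1)[OF int]]) simp
  then have "cmod (VF u \<xi> - VF u \<eta>) = ?c * cmod
      (\<integral>x. cis (- (x \<bullet> \<xi>)) * ?f x - cis (- (x \<bullet> \<eta>)) * ?f x \<partial>lborel)"
    by (simp add: norm_mult)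
  also have "\<dots> \<le> ?c * (\<integral>x. cmod (cis (- (x \<bullet> \<xi>)) * ?f x - cis (- (x \<bullet> \<eta>)) * ?f x) \<partial>lborel)"
    by (intro mult_left_mono integral_norm_bound) simp
  also have "\<dots> \<le> ?c * (\<integral>x. \<bar>R\<bar> * norm (\<xi> - \<eta>) * cmod (?f x) \<partial>lborel)"
    using pt by (intro mult_left_mono integral_mono integrable_norm Bochner_Integration.integrable_diff
        integrable_cis_mult int integrable_mult_right) auto
  also have "\<dots> = (?c * (\<integral>x. cmod (?f x) \<partial>lborel)) * (\<bar>R\<bar> * norm (\<xi> - \<eta>))"
    by simp
  also have "\<dots> \<le> (CV * norm u) * (\<bar>R\<bar> * norm (\<xi> - \<eta>))"
    by (intro mult_right_mono integral_V_le) simp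
  finally show ?thesis
    by (simp add: mult_ac)
qed

lemma fourier_VL: "fourier_L2 (VL u) = to_L2 (VF u)"
  and square_integrable_VF: "square_integrable (VF u)"
proof -
  note sq = square_integrable_mult[OF bm_V square_integrable_rep, of u]
  note int = integrable_V_mult[OF square_integrable_rep, of u]
  show "square_integrable (VF u)"
    unfolding VF_def by (rule square_integrable_fourier_integral[OF int sq])
  have "VL u = to_L2 (\<lambda>x. of_real (V x) * rep_L2 u x)"
    by (simp add: VL_def mult_L2_def)
  then show "fourier_L2 (VL u) = to_L2 (VF u)"
    unfolding VF_def by (simp add: fourier_to_L2[OF int sq])
qed

text \<open>The argument of Arzela and Ascoli: a diagonal sequence converges on a countable dense
  set, and the common Lipschitz constant carries the Cauchy property to every point.\<close>

lemma VF_convergent_subsequence: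
  assumes B: "\<And>j. norm (u j) \<le> B"
  obtains r where "strict_mono (r :: nat \<Rightarrow> nat)" "\<And>\<xi>. convergent (\<lambda>n. VF (u (r n)) \<xi>)"
proof -
  obtain D :: "(real ^ 'd) set" where D: "countable D" "\<And>X. open X \<Longrightarrow> X \<noteq> {} \<Longrightarrow> \<exists>d\<in>D. d \<in> X"
    using countable_dense_setE by blast
  have B0: "B \<ge> 0"
    using B[of 0] norm_ge_zero order_trans by blast
  have bd: "cmod (VF (u n) \<xi>) \<le> CV * B" for n \<xi>
    using VF_bound[of "u n" \<xi>] mult_left_mono[OF B[of n] CV_nonneg] by linarith
  obtain r where r: "strict_mono (r :: nat \<Rightarrow> nat)" "\<And>\<xi>. \<xi> \<in> D \<Longrightarrow> \<exists>l. (\<lambda>n. VF (u (r n)) \<xi>) \<longlonglongrightarrow> l"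
    using function_convergent_subsequence[OF D(1), of "\<lambda>n. VF (u n)" "CV * B"] bd by blast
  \<comment> \<open>The summand 1 keeps L positive, so that the radius e / (4 L) below makes
    sense.\<close>
  define L where "L = CV * B * \<bar>R\<bar> + 1"
  have L: "L > 0"
    using CV_nonneg B0 by (simp add: L_def add_nonneg_pos)
  have Lip: "cmod (VF (u n) \<xi> - VF (u n) \<eta>) \<le> L * norm (\<xi> - \<eta>)" for n \<xi> \<eta>
  proof -
    have "CV * norm (u n) * \<bar>R\<bar> \<le> CV * B * \<bar>R\<bar>"
      by (intro mult_right_mono mult_left_mono B CV_nonneg) simp
    then have "CV * norm (u n) * \<bar>R\<bar> * norm (\<xi> - \<eta>) \<le> L * norm (\<xi> - \<eta>)"
      by (intro mult_right_mono) (auto simp: L_def)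
    then show ?thesis
      using VF_Lipschitz order_trans by blast
  qed
  have "Cauchy (\<lambda>n. VF (u (r n)) \<xi>)" for \<xi>
  proof (rule CauchyI)
    fix e :: real assume e: "e > 0"
    obtain \<eta> where \<eta>: "\<eta> \<in> D" "dist \<xi> \<eta> < e / (4 * L)"
      using D(2)[of "ball \<xi> (e / (4 * L))"] divide_pos_pos[OF e, of "4 * L"] L by fastforce
    obtain l where "(\<lambda>n. VF (u (r n)) \<eta>) \<longlonglongrightarrow> l"
      using r(2) \<eta>(1) by blast
    then have "Cauchy (\<lambda>n. VF (u (r n)) \<eta>)"
      by (rule LIMSEQ_imp_Cauchy)
    then obtain N where N: "\<And>m n. m \<ge> N \<Longrightarrow> n \<ge> N \<Longrightarrow> cmod (VF (u (r m)) \<eta> - VF (u (r n)) \<eta>) < e / 2"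
      using CauchyD[of _ "e / 2"] e by (metis half_gt_zero)
    have near: "cmod (VF (u n) \<xi> - VF (u n) \<eta>) \<le> e / 4" for n
    proof -
      have "L * norm (\<xi> - \<eta>) \<le> L * (e / (4 * L))"
        using \<eta>(2) L by (intro mult_left_mono) (auto simp: dist_norm)
      then show ?thesis
        using Lip[of n \<xi> \<eta>] L by simp
    qed
    show "\<exists>N. \<forall>m\<ge>N. \<forall>n\<ge>N. cmod (VF (u (r m)) \<xi> - VF (u (r n)) \<xi>) < e"
    proof (intro exI[of _ N] allI impI)
      fix m n assume mn: "m \<ge> N" "n \<ge> N"
      have "VF (u (r m)) \<xi> - VF (u (r n)) \<xi> = (VF (u (r m)) \<xi> - VF (u (r m)) \<eta>)
          + (VF (u (r m)) \<eta> - VF (u (r n)) \<eta>) - (VF (u (r n)) \<xi> - VF (u (r n)) \<eta>)"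
        by simp
      then have "cmod (VF (u (r m)) \<xi> - VF (u (r n)) \<xi>) \<le> cmod (VF (u (r m)) \<xi> - VF (u (r m)) \<eta>)
          + cmod (VF (u (r m)) \<eta> - VF (u (r n)) \<eta>) + cmod (VF (u (r n)) \<xi> - VF (u (r n)) \<eta>)"
        using norm_triangle_ineq4 norm_triangle_ineq by (smt (verit, best))
      then show "cmod (VF (u (r m)) \<xi> - VF (u (r n)) \<xi>) < e"
        using near[of "r m"] near[of "r n"] N[OF mn] by linarith
    qed
  qed
  then show ?thesis
    using that r(1) Cauchy_convergent by blast
qed

definition cutoff :: "real \<Rightarrow> real ^ 'd \<Rightarrow> complex" where
  "cutoff \<rho> \<xi> = of_real (indicator (cball 0 \<rho>) \<xi>)"

lemma cutoff_measurable [measurable]: "cutoff \<rho> \<in> borel_measurable borel"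
proof -
  have [measurable]: "cball 0 \<rho> \<in> sets (borel :: (real ^ 'd) measure)"
    by simp
  show ?thesis
    unfolding cutoff_def[abs_def] by measurable
qed

lemma cnj_cutoff: "cnj (cutoff \<rho> \<xi>) = cutoff \<rho> \<xi>"
  by (simp add: cutoff_def)

lemma bm_cutoff: "bounded_measurable (cutoff \<rho>)"
  by (rule bounded_measurableI[where C = 1]) (simp_all add: cutoff_def indicator_def)

text \<open>On a ball the uniform bound \<open>CV * B\<close> is square-integrable, so pointwise
  convergence improves to convergence in norm; on the whole space this domination is lost, which is
  why the cutoff is there.\<close>

lemma cutoff_Cauchy:
  assumes B: "\<And>j :: nat. norm (u j) \<le> B" and conv: "\<And>\<xi>. convergent (\<lambda>n. VF (u n) \<xi>)"
  shows "Cauchy (\<lambda>n. mult_L2 (cutoff \<rho>) (fourier_L2 (VL (u n))))"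
proof -
  note [measurable] = square_integrableD(1)[OF square_integrable_VF]
  define l where "l \<xi> = lim (\<lambda>n. VF (u n) \<xi>)" for \<xi>
  have [measurable]: "l \<in> borel_measurable borel"
    unfolding l_def by (rule borel_measurable_lim_metric) measurable
  have lim: "(\<lambda>n. VF (u n) \<xi>) \<longlonglongrightarrow> l \<xi>" for \<xi>
    using conv by (simp add: l_def convergent_LIMSEQ_iff)
  have bd: "cmod (VF (u n) \<xi>) \<le> CV * B" for n \<xi>
    using VF_bound[of "u n" \<xi>] mult_left_mono[OF B[of n] CV_nonneg] by linarith
  have B0: "0 \<le> CV * B"
    using bd[of 0 0] norm_ge_zero order_trans by blast
  have sqc: "square_integrable (cutoff \<rho>)"
  proof (rule square_integrableI)
    have "(cmod (cutoff \<rho> \<xi>))\<^sup>2 = indicator (cball 0 \<rho>) \<xi>" for \<xi>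
      by (simp add: cutoff_def indicator_def)
    then show "integrable lborel (\<lambda>\<xi>. (cmod (cutoff \<rho> \<xi>))\<^sup>2)"
      by (simp only:) (intro integrable_real_indicator emeasure_compact_finite, auto)
  qed measurable
  have "(\<lambda>n. to_L2 (\<lambda>\<xi>. cutoff \<rho> \<xi> * VF (u n) \<xi>)) \<longlonglongrightarrow> to_L2 (\<lambda>\<xi>. cutoff \<rho> \<xi> * l \<xi>)"
  proof (rule L2_dominated_convergence(2)[where g = "\<lambda>\<xi>. of_real (CV * B) * cutoff \<rho> \<xi>"])
    show "square_integrable (\<lambda>\<xi>. cutoff \<rho> \<xi> * VF (u n) \<xi>)" for n
      by (rule square_integrable_mult[OF bm_cutoff square_integrable_VF])
    show "square_integrable (\<lambda>\<xi>. of_real (CV * B) * cutoff \<rho> \<xi>)"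
      by (rule square_integrable_scale[OF sqc])
    show "cmod (cutoff \<rho> \<xi> * VF (u n) \<xi>) \<le> cmod (of_real (CV * B) * cutoff \<rho> \<xi>)" for n \<xi>
      unfolding norm_mult norm_of_real abs_of_nonneg[OF B0]
      using mult_right_mono[OF bd norm_ge_zero[of "cutoff \<rho> \<xi>"]] by (simp add: mult.commute)
    show "(\<lambda>n. cutoff \<rho> \<xi> * VF (u n) \<xi>) \<longlonglongrightarrow> cutoff \<rho> \<xi> * l \<xi>" for \<xi>
      by (intro tendsto_intros lim)
  qed measurable
  then have "Cauchy (\<lambda>n. to_L2 (\<lambda>\<xi>. cutoff \<rho> \<xi> * VF (u n) \<xi>))"
    by (rule LIMSEQ_imp_Cauchy)
  then show ?thesis
    by (simp add: fourier_VL bmult_to_L2 bm_cutoff square_integrable_VF)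
qed

text \<open>High frequencies contribute little because the symbol \<open>\<sigma>\<close> decays; low frequencies
  contribute a convergent sequence by dominated convergence.\<close>

lemma P_split:
  assumes "\<rho> > 0"
  shows "P k \<le> norm (mult_L2 (cutoff \<rho>) (fourier_L2 (VL (state k)))) * norm k
      + M * \<rho> powr (- s) * (norm k)\<^sup>2"
proof -
  let ?F = "fourier_L2 (VL (state k))"
  let ?c = "\<lambda>\<xi>. (1 - cutoff \<rho> \<xi>) * of_real (\<sigma> \<xi>)"
  have bm1: "bounded_measurable (\<lambda>\<xi>. 1 - cutoff \<rho> \<xi>)"
    by (rule bounded_measurableI[where C = 1]) (simp_all add: cutoff_def indicator_def)
  have hi: "cmod (?c \<xi>) \<le> \<rho> powr (- s)" for \<xi>
  proof (cases "norm \<xi> \<le> \<rho>")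
    case False
    have "\<rho> powr s \<le> norm \<xi> powr s"
      using False assms s_pos by (intro powr_mono2) auto
    also have "\<dots> = sqrt (a \<xi>)"
      by (simp add: a_def powr_half_sqrt[symmetric] powr_powr)
    also have "\<dots> \<le> sqrt (a \<xi> + 1)"
      by simp
    finally have "\<sigma> \<xi> \<le> 1 / \<rho> powr s"
      unfolding \<sigma>_def using assms by (intro divide_left_mono) (auto intro: mult_pos_pos)
    then show ?thesis
      using False by (simp add: cutoff_def norm_mult abs_of_pos powr_minus divide_inverse)
  qed (simp add: cutoff_def)
  have "S k = mult_L2 (cutoff \<rho>) (S k) + mult_L2 ?c k"
  proof -
    have "mult_L2 ?c k = mult_L2 (\<lambda>\<xi>. 1 - cutoff \<rho> \<xi>) (S k)"
      unfolding S_def by (rule mult_L2_mult[OF bm1 bm_\<sigma>, symmetric])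
    moreover have "S k = mult_L2 (cutoff \<rho>) (S k) + mult_L2 (\<lambda>\<xi>. 1 - cutoff \<rho> \<xi>) (S k)"
      by (rule L2_cases[of "S k"])
        (simp add: bmult_to_L2 bm_cutoff bm1 add_to_L2 square_integrable_mult flip: distrib_right)
    ultimately show ?thesis by simp
  qed
  moreover have "P k = Re (cinner ?F (S k))"
    by (simp add: P_def inner_L2_def state_def cinner_fourier_L2_left)
  ultimately have "P k = Re (cinner ?F (mult_L2 (cutoff \<rho>) (S k))) + Re (cinner ?F (mult_L2 ?c k))"
    by (metis cinner_add_right plus_complex.sel(1))
  also have "cinner ?F (mult_L2 (cutoff \<rho>) (S k)) = cinner (mult_L2 (cutoff \<rho>) ?F) (S k)"
    by (simp only: cinner_mult_L2_right[OF bm_cutoff] cnj_cutoff)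
  also have "Re (cinner (mult_L2 (cutoff \<rho>) ?F) (S k)) \<le> norm (mult_L2 (cutoff \<rho>) ?F) * norm k"
    using complex_Re_le_cmod cinner_Cauchy_Schwarz norm_S_le
    by (meson mult_left_mono norm_ge_zero order_trans)
  also have "Re (cinner ?F (mult_L2 ?c k)) \<le> M * \<rho> powr (- s) * (norm k)\<^sup>2"
  proof -
    have "Re (cinner ?F (mult_L2 ?c k)) \<le> norm ?F * norm (mult_L2 ?c k)"
      using complex_Re_le_cmod cinner_Cauchy_Schwarz order_trans by blast
    also have "\<dots> \<le> (M * norm k) * (\<rho> powr (- s) * norm k)"
    proof (intro mult_mono)
      have "norm ?F \<le> M * norm (S k)"
        using norm_VL_le[of "state k"] by simp
      also have "\<dots> \<le> M * norm k"
        by (intro mult_left_mono norm_S_le M_nonneg)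
      finally show "norm ?F \<le> M * norm k" .
      show "norm (mult_L2 ?c k) \<le> \<rho> powr (- s) * norm k"
        by (rule norm_mult_L2_le[OF _ hi]) measurable
    qed (auto simp: M_nonneg)
    finally show ?thesis
      by (simp add: power2_eq_square mult_ac)
  qed
  finally show ?thesis by simp
qed

text \<open>Relative compactness of the potential, in a form that avoids weak limits: along a
  subsequence the potential energy of differences becomes small. This is what the minimising
  sequences need in order to be Cauchy.\<close>

lemma P_compact:
  fixes k :: "nat \<Rightarrow> 'd L2"
  assumes B: "\<And>j. norm (k j) \<le> B"
  obtains r where "strict_mono (r :: nat \<Rightarrow> nat)"
    "\<And>e. e > 0 \<Longrightarrow> \<exists>N. \<forall>m\<ge>N. \<forall>n\<ge>N. P (k (r m) - k (r n)) < e"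
proof -
  have B0: "B \<ge> 0"
    using B[of 0] norm_ge_zero order_trans by blast
  have Bu: "norm (state (k j)) \<le> B" for j
    using B[of j] norm_S_le[of "k j"] by simp
  obtain r where r: "strict_mono (r :: nat \<Rightarrow> nat)" "\<And>\<xi>. convergent (\<lambda>n. VF (state (k (r n))) \<xi>)"
    using VF_convergent_subsequence[of "\<lambda>j. state (k j)" B, OF Bu] by blast
  have "\<exists>N. \<forall>m\<ge>N. \<forall>n\<ge>N. P (k (r m) - k (r n)) < e" if e: "e > 0" for e
  proof -
    define C where "C = 2 * B + 1"
    have C: "C > 0" "norm (k m - k n) \<le> C" for m n
      using norm_triangle_ineq4[of "k m" "k n"] B[of m] B[of n] B0 by (auto simp: C_def)
    define D where "D = 2 * M * C\<^sup>2 + 1"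
    have D: "D > 0"
      using M_nonneg by (simp add: D_def add_nonneg_pos)
    \<comment> \<open>Chosen so that the high frequencies contribute at most
      \<open>M * C\<^sup>2 * (e / D)\<close>, which is less than e / 2 by the choice of D; the low
      frequencies receive the other half.\<close>
    define \<rho> where "\<rho> = (e / D) powr (- 1 / s)"
    have \<rho>: "\<rho> > 0" "\<rho> powr (- s) = e / D"
      using e D s_pos by (auto simp: \<rho>_def powr_powr)
    have "Cauchy (\<lambda>n. mult_L2 (cutoff \<rho>) (fourier_L2 (VL (state (k (r n))))))"
      by (rule cutoff_Cauchy[OF Bu r(2)])
    then obtain N where N: "\<And>m n. m \<ge> N \<Longrightarrow> n \<ge> N \<Longrightarrow>
        norm (mult_L2 (cutoff \<rho>) (fourier_L2 (VL (state (k (r m)))))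
            - mult_L2 (cutoff \<rho>) (fourier_L2 (VL (state (k (r n)))))) < e / (2 * C)"
      using CauchyD[of _ "e / (2 * C)"] e C(1) by (metis divide_pos_pos mult_pos_pos zero_less_numeral)
    show ?thesis
    proof (intro exI[of _ N] allI impI)
      fix m n assume mn: "m \<ge> N" "n \<ge> N"
      let ?\<kappa> = "k (r m) - k (r n)"
      have "mult_L2 (cutoff \<rho>) (fourier_L2 (VL (state ?\<kappa>)))
          = mult_L2 (cutoff \<rho>) (fourier_L2 (VL (state (k (r m)))))
              - mult_L2 (cutoff \<rho>) (fourier_L2 (VL (state (k (r n)))))"
        by (simp add: state_diff VL_diff linear_diff[OF bounded_linear.linear[OF bounded_linear_fourier_L2]] mult_L2_diff[OF bm_cutoff])
      then have 1: "norm (mult_L2 (cutoff \<rho>) (fourier_L2 (VL (state ?\<kappa>)))) * norm ?\<kappa> \<le> e / (2 * C) * C"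
        using N[OF mn] C e by (intro mult_mono) auto
      have "M * (norm ?\<kappa>)\<^sup>2 \<le> M * C\<^sup>2"
        by (intro mult_left_mono power_mono C(2) M_nonneg) simp
      then have 2: "M * (norm ?\<kappa>)\<^sup>2 * (e / D) \<le> M * C\<^sup>2 * (e / D)"
        using e D by (intro mult_right_mono) auto
      have "M * C\<^sup>2 * (e / D) < e / 2"
        using e D by (simp add: D_def field_simps)
      moreover have "e / (2 * C) * C = e / 2"
        using C(1) by simp
      moreover have "M * (e / D) * (norm ?\<kappa>)\<^sup>2 = M * (norm ?\<kappa>)\<^sup>2 * (e / D)"
        by simp
      ultimately show "P ?\<kappa> < e"
        using 1 2 P_split[OF \<rho>(1), of ?\<kappa>] unfolding \<rho>(2) by linarith
    qed
  qed
  then show ?thesis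
    using that r(1) by blast
qed

end

subsection \<open>Minimisation\<close>

definition csubspace :: "'d::finite L2 set \<Rightarrow> bool" where
  "csubspace Y \<longleftrightarrow> 0 \<in> Y \<and> (\<forall>x\<in>Y. \<forall>y\<in>Y. x + y \<in> Y) \<and> (\<forall>c. \<forall>x\<in>Y. c \<cdot> x \<in> Y)"

lemma csubspace_add: "csubspace Y \<Longrightarrow> x \<in> Y \<Longrightarrow> y \<in> Y \<Longrightarrow> x + y \<in> Y"
  and csubspace_scale: "csubspace Y \<Longrightarrow> x \<in> Y \<Longrightarrow> c \<cdot> x \<in> Y"
  by (auto simp: csubspace_def)

lemma csubspace_scaleR: "csubspace Y \<Longrightarrow> x \<in> Y \<Longrightarrow> r *\<^sub>R x \<in> Y"
  by (simp add: scaleR_L2_def csubspace_scale)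

lemma zero_of_quadratic_nonneg:
  fixes b c :: real
  assumes "\<And>t. 0 \<le> 2 * t * b + t\<^sup>2 * c"
  shows "b = 0"
proof (rule ccontr)
  assume b: "b \<noteq> 0"
  \<comment> \<open>The quadratic is evaluated at t = - b / d; as d exceeds |c|, the linear term
    wins whatever the sign of c.\<close>
  define d where "d = \<bar>c\<bar> + 1"
  have d: "d > 0" "c < 2 * d"
    by (auto simp: d_def)
  have "0 \<le> 2 * (- b / d) * b + (- b / d)\<^sup>2 * c"
    by (rule assms)
  also have "\<dots> = (b / d)\<^sup>2 * (c - 2 * d)"
    using d by (simp add: power2_eq_square field_simps)
  also have "\<dots> < 0"
    using b d by (intro mult_pos_neg) auto
  finally show False by simp
qed

context compact_potential
begin

definition form :: "real \<Rightarrow> 'd L2 \<Rightarrow> real" where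
  "form E k = inner (A E k) k"

lemma form_eq: "form E k = (norm k)\<^sup>2 - (1 + E) * (norm (S k))\<^sup>2 - P k"
  unfolding form_def by (rule form_A)

lemma form_shift: "form E k = form 0 k - E * (norm (S k))\<^sup>2"
  by (simp add: form_eq algebra_simps)

lemma form_scaleR: "form E (r *\<^sub>R k) = r\<^sup>2 * form E k"
  by (simp add: form_def A_scaleR power2_eq_square)

lemma form_expand: "form E (k + t *\<^sub>R y) = form E k + 2 * t * inner (A E k) y + t\<^sup>2 * form E y"
proof -
  have "inner (A E y) k = inner (A E k) y"
    by (metis inner_A inner_commute)
  then show ?thesis
    by (simp add: form_def A_add A_scaleR inner_add_left inner_add_right power2_eq_square distrib_left)
qed

lemma form_parallelogram: "form E (x - y) + form E (x + y) = 2 * form E x + 2 * form E y"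
  using form_expand[of E x 1 y] form_expand[of E x "-1" y] by simp

lemma form_lower: "form 0 k \<ge> - (M * (norm (S k))\<^sup>2)"
proof -
  have "(norm (S k))\<^sup>2 \<le> (norm k)\<^sup>2"
    by (intro power_mono norm_S_le) simp
  moreover have "form 0 k = (norm k)\<^sup>2 - (norm (S k))\<^sup>2 - P k"
    by (simp add: form_eq)
  ultimately show ?thesis
    using P_le[of k] by linarith
qed

text \<open>Negativity of E provides the gap: without the potential, the form of H_s - E is
  \<open>(norm k)\<^sup>2 - (1 + E) * (norm (S k))\<^sup>2\<close>. Since
  \<open>norm (S k) \<le> norm k\<close>, this is at least - E or 1 times
  \<open>(norm k)\<^sup>2\<close>, according to the sign of 1 + E.\<close>

lemma form_coercive:
  assumes "E < 0"
  shows "min 1 (- E) * (norm k)\<^sup>2 \<le> form E k + P k"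
proof (cases "1 + E \<ge> 0")
  case True
  have "(norm (S k))\<^sup>2 \<le> (norm k)\<^sup>2"
    by (intro power_mono norm_S_le) simp
  then have "(1 + E) * (norm (S k))\<^sup>2 \<le> (1 + E) * (norm k)\<^sup>2"
    using True by (rule mult_left_mono)
  moreover have "min 1 (- E) * (norm k)\<^sup>2 \<le> (- E) * (norm k)\<^sup>2"
    by (intro mult_right_mono) auto
  ultimately show ?thesis
    by (simp add: form_eq algebra_simps)
next
  case False
  then have "(1 + E) * (norm (S k))\<^sup>2 \<le> 0"
    by (simp add: mult_nonpos_nonneg)
  moreover have "min 1 (- E) * (norm k)\<^sup>2 \<le> 1 * (norm k)\<^sup>2"
    by (intro mult_right_mono) auto
  ultimately show ?thesis
    by (simp add: form_eq)
qed

lemma tendsto_form: "k \<longlonglongrightarrow> l \<Longrightarrow> (\<lambda>j. form E (k j)) \<longlonglongrightarrow> form E l"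
  unfolding form_def by (intro tendsto_inner bounded_linear.tendsto[OF bounded_linear_A])

lemma minimizer:
  assumes Y: "csubspace Y" "closed Y" and y: "y \<in> Y" "form 0 y < 0"
  obtains E k where "E < 0" "k \<in> Y" "k \<noteq> 0" "form E k = 0" "\<And>z. z \<in> Y \<Longrightarrow> form E z \<ge> 0"
proof -
  \<comment> \<open>The Rayleigh quotient of \<open>state z\<close>, whose norm is
    \<open>norm (S z)\<close> and not \<open>norm z\<close>.\<close>
  define Q where "Q z = form 0 z / (norm (S z))\<^sup>2" for z
  define E where "E = (INF z\<in>Y - {0}. Q z)"
  have Npos: "(norm (S z))\<^sup>2 > 0" if "z \<noteq> 0" for z
    using norm_S_pos[OF that] by simp
  have "y \<noteq> 0"
    using y by (auto simp: form_def)
  have bdd: "bdd_below (Q ` (Y - {0}))"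
  proof (rule bdd_belowI2)
    fix z assume "z \<in> Y - {0}"
    then show "- M \<le> Q z"
      using form_lower[of z] Npos[of z] by (simp add: Q_def field_simps)
  qed
  have E_le: "E * (norm (S z))\<^sup>2 \<le> form 0 z" if "z \<in> Y" for z
  proof (cases "z = 0")
    case False
    have "E \<le> Q z"
      unfolding E_def using bdd that False by (intro cINF_lower) auto
    then show ?thesis
      using Npos[OF False] by (simp add: Q_def field_simps)
  qed (use linear_0[OF bounded_linear.linear[OF bounded_linear_S]] in \<open>auto simp: form_def\<close>)
  have "E \<le> Q y"
    unfolding E_def using bdd y \<open>y \<noteq> 0\<close> by (intro cINF_lower) auto
  also have "Q y < 0"
    using y(2) Npos[OF \<open>y \<noteq> 0\<close>] by (simp add: Q_def divide_neg_pos)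
  finally have E: "E < 0" .
  have nonneg: "form E z \<ge> 0" if "z \<in> Y" for z
    using E_le[OF that] by (simp add: form_shift[of E])
  have "\<exists>z\<in>Y. norm (S z) = 1 \<and> form E z < 1 / Suc j" for j :: nat
  proof -
    have "Inf (Q ` (Y - {0})) < E + 1 / Suc j"
      by (simp add: E_def)
    moreover have "Q ` (Y - {0}) \<noteq> {}"
      using y \<open>y \<noteq> 0\<close> by blast
    ultimately have "\<exists>q\<in>Q ` (Y - {0}). q < E + 1 / Suc j"
      by (rule cInf_lessD[rotated, simplified Bex_def[symmetric]])
    then obtain z where z: "z \<in> Y" "z \<noteq> 0" "Q z < E + 1 / Suc j"
      by auto
    define x where "x = (1 / norm (S z)) *\<^sub>R z"
    have n: "norm (S z) > 0"
      by (rule norm_S_pos[OF z(2)])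
    have "x \<in> Y"
      unfolding x_def by (rule csubspace_scaleR[OF Y(1) z(1)])
    moreover have Sx: "norm (S x) = 1"
      using n by (simp add: x_def linear_scale[OF bounded_linear.linear[OF bounded_linear_S]])
    moreover have "form E x < 1 / Suc j"
    proof -
      have "form 0 x = Q z"
        by (simp add: x_def form_scaleR Q_def power_divide)
      then show ?thesis
        using z(3) Sx by (simp add: form_shift[of E x])
    qed
    ultimately show ?thesis by blast
  qed
  then obtain z where z: "\<And>j. z j \<in> Y" "\<And>j. norm (S (z j)) = 1" "\<And>j. form E (z j) < 1 / Suc j"
    by metis
  define \<delta> where "\<delta> = min 1 (- E)"
  have \<delta>: "\<delta> > 0"
    using E by (simp add: \<delta>_def)
  \<comment> \<open>Normalisation bounds only the states; coercivity turns this into a bound on the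
    parameters, with form at most 1 and potential energy at most M.\<close>
  have bound: "norm (z j) \<le> sqrt ((1 + M) / \<delta>)" for j
  proof (rule real_le_rsqrt)
    have "1 / real (Suc j) \<le> 1"
      by simp
    then have "form E (z j) \<le> 1"
      using z(3)[of j] by linarith
    then have "\<delta> * (norm (z j))\<^sup>2 \<le> 1 + M"
      using form_coercive[OF E, of "z j"] P_le[of "z j"] by (simp add: \<delta>_def z(2))
    then show "(norm (z j))\<^sup>2 \<le> (1 + M) / \<delta>"
      using \<delta> by (simp add: field_simps)
  qed
  obtain r where r: "strict_mono (r :: nat \<Rightarrow> nat)"
      "\<And>e. e > 0 \<Longrightarrow> \<exists>N. \<forall>m\<ge>N. \<forall>n\<ge>N. P (z (r m) - z (r n)) < e"
    using P_compact[of z, OF bound] by blast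
  have "Cauchy (\<lambda>n. z (r n))"
  proof (rule CauchyI)
    fix e :: real assume e: "e > 0"
    \<comment> \<open>Half of \<open>\<delta> * e\<^sup>2\<close> is for the form and half for the
      potential energy. The parallelogram identity doubles both form values, so each of them may use
      a quarter of the first half.\<close>
    have e2: "\<delta> * e\<^sup>2 / 2 > 0"
      using \<delta> e by simp
    obtain N1 where N1: "\<And>m n. m \<ge> N1 \<Longrightarrow> n \<ge> N1 \<Longrightarrow> P (z (r m) - z (r n)) < \<delta> * e\<^sup>2 / 2"
      using r(2)[OF e2] by blast
    obtain N2 :: nat where N2: "4 / (\<delta> * e\<^sup>2 / 2) < N2"
      using reals_Archimedean2 by blast
    have small: "form E (z (r n)) \<le> (\<delta> * e\<^sup>2 / 2) / 4" if "n \<ge> N2" for n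
    proof -
      have "real N2 \<le> real (Suc (r n))"
        using that seq_suble[OF r(1), of n] by simp
      then have "4 / (\<delta> * e\<^sup>2 / 2) < real (Suc (r n))"
        using N2 by linarith
      then have "1 / real (Suc (r n)) < (\<delta> * e\<^sup>2 / 2) / 4"
        using e2 by (simp add: field_simps)
      then show ?thesis
        using z(3)[of "r n"] by linarith
    qed
    show "\<exists>N. \<forall>m\<ge>N. \<forall>n\<ge>N. norm (z (r m) - z (r n)) < e"
    proof (intro exI[of _ "max N1 N2"] allI impI)
      fix m n assume mn: "max N1 N2 \<le> m" "max N1 N2 \<le> n"
      let ?x = "z (r m)" and ?y = "z (r n)"
      have "form E (?x + ?y) \<ge> 0"
        by (intro nonneg csubspace_add[OF Y(1)] z)
      then have "form E (?x - ?y) \<le> \<delta> * e\<^sup>2 / 2"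
        using form_parallelogram[of E ?x ?y] small[of m] small[of n] mn by simp
      moreover have "P (?x - ?y) < \<delta> * e\<^sup>2 / 2"
        using mn by (intro N1) auto
      ultimately have "\<delta> * (norm (?x - ?y))\<^sup>2 < \<delta> * e\<^sup>2"
        using form_coercive[OF E, of "?x - ?y"] unfolding \<delta>_def by linarith
      then have "(norm (?x - ?y))\<^sup>2 < e\<^sup>2"
        using \<delta> by simp
      then show "norm (?x - ?y) < e"
        using e by (simp add: power2_less_imp_less)
    qed
  qed
  then obtain k where k: "(\<lambda>n. z (r n)) \<longlonglongrightarrow> k"
    using Cauchy_convergent convergent_def by blast
  have kY: "k \<in> Y"
    using closed_sequentially[OF Y(2) _ k] z(1) by blast
  \<comment> \<open>The normalisation of the states survives the limit and excludes k = 0.\<close>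
  have "(\<lambda>n. norm (S (z (r n)))) \<longlonglongrightarrow> norm (S k)"
    by (intro tendsto_norm bounded_linear.tendsto[OF bounded_linear_S k])
  then have "norm (S k) = 1"
    by (simp add: z(2) LIMSEQ_const_iff)
  then have "k \<noteq> 0"
    using linear_0[OF bounded_linear.linear[OF bounded_linear_S]] by auto
  have "(\<lambda>n. form E (z n)) \<longlonglongrightarrow> 0"
    by (rule tendsto_sandwich[OF _ _ tendsto_const LIMSEQ_Suc[OF lim_1_over_n]])
      (use nonneg[OF z(1)] z(3) in \<open>auto intro!: always_eventually less_imp_le\<close>)
  then have "(\<lambda>n. form E (z (r n))) \<longlonglongrightarrow> 0"
    using LIMSEQ_subseq_LIMSEQ[OF _ r(1)] by (fastforce simp: o_def)
  with tendsto_form[OF k, of E] have "form E k = 0"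
    by (rule LIMSEQ_unique)
  with that E kY \<open>k \<noteq> 0\<close> nonneg show ?thesis
    by blast
qed

text \<open>At k the non-negative form attains its minimum 0 on Y, so its first variation vanishes.
  Real variations give only the real part of the product; the variation along
  \<open>\<i> \<cdot> y\<close> gives the imaginary part.\<close>

lemma Euler_Lagrange:
  assumes Y: "csubspace Y" and k: "k \<in> Y" "form E k = 0" and nonneg: "\<And>z. z \<in> Y \<Longrightarrow> form E z \<ge> 0"
    and y: "y \<in> Y"
  shows "cinner (A E k) y = 0"
proof -
  have zero: "inner (A E k) w = 0" if w: "w \<in> Y" for w
  proof (rule zero_of_quadratic_nonneg)
    fix t :: real
    have "0 \<le> form E (k + t *\<^sub>R w)"
      by (intro nonneg csubspace_add[OF Y] csubspace_scaleR[OF Y] k w)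
    then show "0 \<le> 2 * t * inner (A E k) w + t\<^sup>2 * form E w"
      by (simp add: form_expand k)
  qed
  have "inner (A E k) y = 0" "inner (A E k) (\<i> \<cdot> y) = 0"
    by (intro zero csubspace_scale[OF Y] y)+
  then show ?thesis
    by (simp add: inner_L2_def cinner_scale_right complex_eq_iff)
qed

text \<open>Orthogonality of the states rather than of their parameters:
  \<open>cinner (S y) (S k)\<close> is the inner product of \<open>state y\<close> with
  \<open>state k\<close>.\<close>

definition orth :: "nat \<Rightarrow> (nat \<Rightarrow> 'd L2) \<Rightarrow> 'd L2 set" where
  "orth m ks = {y. \<forall>i<m. cinner (S y) (S (ks i)) = 0}"

lemma csubspace_orth: "csubspace (orth m ks)"
  by (auto simp: csubspace_def orth_def S_add S_scale cinner_add_left cinner_scale_left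
      linear_0[OF bounded_linear.linear[OF bounded_linear_S]])

lemma closed_orth: "closed (orth m ks)"
proof -
  have "closed {y. cinner (S y) (S (ks i)) = 0}" for i
  proof (rule closed_Collect_eq)
    show "continuous_on UNIV (\<lambda>y. cinner (S y) (S (ks i)))"
      using bounded_linear_compose[OF bounded_bilinear.bounded_linear_left[OF bounded_bilinear_cinner] bounded_linear_S]
      by (rule linear_continuous_on)
  qed simp
  moreover have "orth m ks = (\<Inter>i\<in>{..<m}. {y. cinner (S y) (S (ks i)) = 0})"
    by (auto simp: orth_def)
  ultimately show ?thesis
    by (simp add: closed_INT)
qed

lemma A_shift: "A E k = A E' k + of_real (E' - E) \<cdot> S (S k)"
  by (simp add: A_def algebra_simps flip: L2.scale_left_distrib)

text \<open>The minimiser satisfies its equation only against \<open>orth m ks\<close>. Against an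
  earlier eigenvector it holds as well, by symmetry of \<open>A E\<close> and orthogonality of the
  states, and the two kinds of vectors together span the space.\<close>

lemma next_eigenvector:
  assumes ks: "\<And>i. i < m \<Longrightarrow> ks i \<noteq> 0" "\<And>i. i < m \<Longrightarrow> A (Es i) (ks i) = 0"
      "\<And>i j. i < m \<Longrightarrow> j < m \<Longrightarrow> i \<noteq> j \<Longrightarrow> cinner (S (ks i)) (S (ks j)) = 0"
    and y: "y \<in> orth m ks" "form 0 y < 0"
  obtains E k where "E < 0" "k \<in> orth m ks" "k \<noteq> 0" "A E k = 0"
proof -
  obtain E k where E: "E < 0" and k: "k \<in> orth m ks" "k \<noteq> 0" "form E k = 0"
      "\<And>z. z \<in> orth m ks \<Longrightarrow> form E z \<ge> 0"
    using minimizer[OF csubspace_orth closed_orth y] by blast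
  have orth0: "cinner (A E k) z = 0" if "z \<in> orth m ks" for z
    by (rule Euler_Lagrange[OF csubspace_orth k(1,3,4) that])
  have ki: "cinner (A E k) (ks i) = 0" if "i < m" for i
  proof -
    have "cinner (A E k) (ks i) = cinner k (A E (ks i))"
      by (rule cinner_A)
    also have "A E (ks i) = of_real (Es i - E) \<cdot> S (S (ks i))"
      using A_shift[of E "ks i" "Es i"] ks(2)[OF that] by simp
    also have "cinner k \<dots> = of_real (Es i - E) * cinner (S k) (S (ks i))"
      by (simp add: cinner_scale_right cinner_S)
    also have "\<dots> = 0"
      using k(1) that by (simp add: orth_def)
    finally show ?thesis .
  qed
  have "A E k = 0"
  proof (rule cinner_ext)
    fix h
    \<comment> \<open>The Gram-Schmidt coefficients of h for the product of the states.\<close>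
    define c where "c i = cinner (S h) (S (ks i)) / cinner (S (ks i)) (S (ks i))" for i
    define h' where "h' = h - (\<Sum>i<m. c i \<cdot> ks i)"
    have nz: "cinner (S (ks i)) (S (ks i)) \<noteq> 0" if "i < m" for i
      using norm_S_pos[OF ks(1)[OF that]] by (simp add: cinner_self)
    have "h' \<in> orth m ks"
      unfolding orth_def
    proof (intro CollectI allI impI)
      fix j assume j: "j < m"
      have "cinner (S (\<Sum>i<m. c i \<cdot> ks i)) (S (ks j)) = (\<Sum>i<m. c i * cinner (S (ks i)) (S (ks j)))"
        by (simp add: linear_sum[OF bounded_linear.linear[OF bounded_linear_S]] S_scale
            cinner_sum_left cinner_scale_left)
      also have "\<dots> = (\<Sum>i<m. if i = j then c j * cinner (S (ks j)) (S (ks j)) else 0)"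
        using ks(3) j by (intro sum.cong) auto
      also have "\<dots> = c j * cinner (S (ks j)) (S (ks j))"
        using j by simp
      also have "\<dots> = cinner (S h) (S (ks j))"
        using nz[OF j] by (simp add: c_def)
      finally show "cinner (S h') (S (ks j)) = 0"
        by (simp add: h'_def S_diff cinner_diff_left)
    qed
    then have "cinner (A E k) h' = 0"
      by (rule orth0)
    then have "cinner (A E k) h = cinner (A E k) (\<Sum>i<m. c i \<cdot> ks i)"
      by (simp add: h'_def cinner_diff_right)
    also have "\<dots> = 0"
      by (simp add: cinner_sum_right cinner_scale_right ki)
    finally show "cinner (A E k) h = cinner 0 h" by simp
  qed
  with that E k show ?thesis by blast
qed

text \<open>The trial hypothesis ranges over all families \<open>ks\<close>, because the
  eigenvectors to which the next trial state must be orthogonal arise only in the course of the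
  induction.\<close>

lemma negative_eigenvectors:
  assumes trial: "\<And>m ks. m < N \<Longrightarrow> \<exists>y\<in>orth m ks. form 0 y < 0"
  shows "\<exists>ks Es. (\<forall>i<N. ks i \<noteq> 0 \<and> Es i < 0 \<and> A (Es i) (ks i) = 0) \<and>
    (\<forall>i<N. \<forall>j<N. i \<noteq> j \<longrightarrow> cinner (S (ks i)) (S (ks j)) = 0)"
  using trial
proof (induction N)
  case (Suc m)
  then obtain ks Es where IH: "\<And>i. i < m \<Longrightarrow> ks i \<noteq> 0 \<and> Es i < 0 \<and> A (Es i) (ks i) = 0"
      "\<And>i j. i < m \<Longrightarrow> j < m \<Longrightarrow> i \<noteq> j \<Longrightarrow> cinner (S (ks i)) (S (ks j)) = 0"
    by (metis less_SucI)
  obtain y where y: "y \<in> orth m ks" "form 0 y < 0"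
    using Suc.prems[of m ks] by auto
  obtain E k where E: "E < 0" "k \<in> orth m ks" "k \<noteq> 0" "A E k = 0"
    using next_eigenvector[of m ks Es y] IH y by blast
  have o: "cinner (S k) (S (ks i)) = 0" "cinner (S (ks i)) (S k) = 0" if "i < m" for i
    using E(2) that cinner_commute[of "S (ks i)" "S k"] by (auto simp: orth_def)
  show ?case
  proof (intro exI[of _ "ks(m := k)"] exI[of _ "Es(m := E)"] conjI allI impI)
    fix i j assume "i < Suc m" "j < Suc m" "i \<noteq> j"
    then show "cinner (S ((ks(m := k)) i)) (S ((ks(m := k)) j)) = 0"
      using IH(2) o by (auto simp: less_Suc_eq)
  qed (use IH E in \<open>auto simp: less_Suc_eq\<close>)
qed simp

end

subsection \<open>Counting eigenvalues\<close>

lemma enat_card_le_edim: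
  assumes "finite B" "B \<subseteq> X" "L2.independent B"
  shows "enat (card B) \<le> edim X"
  unfolding edim_def by (rule SUP_upper) (use assms in auto)

lemma independent_if_orthogonal:
  assumes "finite B" "0 \<notin> B" and orth: "\<And>u w. u \<in> B \<Longrightarrow> w \<in> B \<Longrightarrow> u \<noteq> w \<Longrightarrow> cinner u w = 0"
  shows "L2.independent (B :: 'd::finite L2 set)"
  unfolding L2.independent_explicit_finite_subsets
proof (intro allI impI ballI)
  fix T c v
  assume T: "T \<subseteq> B" "finite T" and 0: "(\<Sum>v\<in>T. c v \<cdot> v) = 0" and v: "v \<in> T"
  have "0 = cinner (\<Sum>v\<in>T. c v \<cdot> v) v"
    by (simp add: 0)
  also have "\<dots> = (\<Sum>w\<in>T. c w * cinner w v)"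
    by (simp add: cinner_sum_left cinner_scale_left)
  also have "\<dots> = (\<Sum>w\<in>T. if w = v then c v * cinner v v else 0)"
    using orth T v by (intro sum.cong) auto
  also have "\<dots> = c v * cinner v v"
    using T v by simp
  finally show "c v = 0"
    using v T assms(2) by (auto simp: cinner_self)
qed

text \<open>Several of the eigenvectors may share an eigenvalue, so the indices are grouped by
  eigenvalue. Each group is independent within its eigenspace and the group sizes add up to N; this
  finite sum is dominated by the possibly infinite one.\<close>

lemma num_neg_eigenvalues_ge:
  fixes us :: "nat \<Rightarrow> 'd::finite L2"
  assumes eig: "\<And>i. i < N \<Longrightarrow> us i \<in> eigenspace D H (Es i)" "\<And>i. i < N \<Longrightarrow> Es i < 0" "\<And>i. i < N \<Longrightarrow> us i \<noteq> 0"
    and orth: "\<And>i j. i < N \<Longrightarrow> j < N \<Longrightarrow> i \<noteq> j \<Longrightarrow> cinner (us i) (us j) = 0"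
  shows "num_neg_eigenvalues D H \<ge> enat N"
proof -
  define F where "F = Es ` {..<N}"
  define I where "I \<mu> = {i. i < N \<and> Es i = \<mu>}" for \<mu>
  have inj: "inj_on us {..<N}"
  proof (rule inj_onI, rule ccontr)
    fix i j assume ij: "i \<in> {..<N}" "j \<in> {..<N}" "us i = us j" "i \<noteq> j"
    then have "cinner (us i) (us i) = 0"
      using orth[of i j] by simp
    then show False
      using eig(3)[of i] ij by (simp add: cinner_self)
  qed
  have "enat (card (I \<mu>)) \<le> edim (eigenspace D H \<mu>)" for \<mu>
  proof -
    have "card (I \<mu>) = card (us ` I \<mu>)"
      by (rule card_image[symmetric]) (rule inj_on_subset[OF inj], auto simp: I_def)
    also have "enat \<dots> \<le> edim (eigenspace D H \<mu>)"
    proof (rule enat_card_le_edim)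
      show "L2.independent (us ` I \<mu>)"
        by (rule independent_if_orthogonal) (use eig(3) orth in \<open>auto simp: I_def\<close>)
    qed (use eig(1) in \<open>auto simp: I_def\<close>)
    finally show ?thesis by simp
  qed
  then have "(\<Sum>\<mu>\<in>F. enat (card (I \<mu>))) \<le> (\<Sum>\<mu>\<in>F. edim (eigenspace D H \<mu>))"
    by (intro sum_mono)
  moreover have "(\<Sum>\<mu>\<in>F. enat (card (I \<mu>))) = enat N"
  proof -
    have "(\<Sum>\<mu>\<in>F. card (I \<mu>)) = card (\<Union>\<mu>\<in>F. I \<mu>)"
      by (rule card_UN_disjoint[symmetric]) (auto simp: F_def I_def)
    also have "(\<Union>\<mu>\<in>F. I \<mu>) = {..<N}"
      by (auto simp: F_def I_def)
    finally show ?thesis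
      by (simp flip: of_nat_eq_enat of_nat_sum)
  qed
  moreover have "(\<Sum>\<mu>\<in>F. edim (eigenspace D H \<mu>)) \<le> num_neg_eigenvalues D H"
    unfolding num_neg_eigenvalues_def
  proof (subst infsum_finite[symmetric], simp add: F_def, rule infsum_mono_neutral)
    show "edim (eigenspace D H \<mu>) \<le> 0" if "\<mu> \<in> F - {\<mu>. \<mu> < 0 \<and> eigenvalue D H \<mu>}" for \<mu>
      using that eig by (auto simp: F_def eigenvalue_def)
  qed (auto intro!: nonneg_summable_on_complete)
  ultimately show ?thesis
    by simp
qed

subsection \<open>Moments\<close>

lemma polynomial_coeff_zero:
  fixes c :: "nat \<Rightarrow> complex"
  assumes "\<And>t :: real. (\<Sum>i\<le>p. c i * of_real t ^ i) = 0" "i \<le> p"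
  shows "c i = 0"
proof (rule ccontr)
  assume "c i \<noteq> 0"
  then have "finite {z. (\<Sum>i\<le>p. c i * z ^ i) = 0}"
    using polyfun_finite_roots[of c p] assms(2) by blast
  moreover have "range complex_of_real \<subseteq> {z. (\<Sum>i\<le>p. c i * z ^ i) = 0}"
    using assms(1) by auto
  moreover have "infinite (range complex_of_real)"
    by (simp add: finite_image_iff inj_on_def infinite_UNIV_char_0)
  ultimately show False
    using finite_subset by blast
qed

text \<open>A product of linear forms, with repetitions, is the shape on which polarisation
  works.\<close>

lemma monomial_as_product:
  fixes \<alpha> :: "'d::finite \<Rightarrow> nat"
  obtains ys :: "(real ^ 'd) list" where "length ys = sum \<alpha> UNIV"
    "\<And>x. monomial \<alpha> x = (\<Prod>y\<leftarrow>ys. x \<bullet> y)"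
proof -
  obtain js :: "'d list" where js: "set js = UNIV" "distinct js"
    using finite_distinct_list[of "UNIV :: 'd set"] by auto
  define ys where "ys = concat (map (\<lambda>j. replicate (\<alpha> j) (axis j 1 :: real ^ 'd)) js)"
  have "length ys = sum_list (map \<alpha> js)"
    by (simp add: ys_def length_concat o_def)
  also have "\<dots> = sum \<alpha> UNIV"
    using js by (simp add: sum_list_distinct_conv_sum_set)
  finally have "length ys = sum \<alpha> UNIV" .
  moreover have "monomial \<alpha> x = (\<Prod>y\<leftarrow>ys. x \<bullet> y)" for x
  proof -
    have "(\<Prod>y\<leftarrow>concat (map (\<lambda>j. replicate (\<alpha> j) (axis j 1 :: real ^ 'd)) ls). x \<bullet> y)
        = (\<Prod>j\<leftarrow>ls. (x $ j) ^ \<alpha> j)" for ls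
      by (induction ls) (auto simp: inner_axis)
    then show ?thesis
      using js prod.distinct_set_conv_list[OF js(2), of "\<lambda>j. (x $ j) ^ \<alpha> j"]
          by (simp add: ys_def monomial_def)
  qed
  ultimately show ?thesis
    using that by blast
qed

lemma continuous_prod_list_inner:
  "continuous_on UNIV (\<lambda>x :: 'a::real_inner. \<Prod>y\<leftarrow>ys. x \<bullet> y)"
  by (induction ys) (auto intro!: continuous_intros)

lemma continuous_AE_zero:
  fixes f :: "'a::euclidean_space \<Rightarrow> complex"
  assumes f: "continuous_on UNIV f" and U: "open U" and AE: "AE x in lborel. x \<in> U \<longrightarrow> f x = 0"
    and x: "x \<in> U"
  shows "f x = 0"
proof (rule ccontr)
  assume nz: "f x \<noteq> 0"
  let ?W = "U \<inter> f -` (- {0})"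
  have "open ?W"
    using U f by (intro open_Int open_vimage) auto
  moreover have "negligible ?W"
  proof -
    have "?W \<in> null_sets lborel"
      using AE \<open>open ?W\<close> by (subst AE_iff_null_sets) (auto elim!: eventually_mono)
    then show ?thesis
      by (simp add: negligible_iff_null_sets null_sets_completionI)
  qed
  ultimately show False
    using open_not_negligible[of ?W] nz x by auto
qed

context compact_potential
begin

lemma integrable_continuous_V:
  assumes g: "continuous_on UNIV g"
  shows "integrable lborel (\<lambda>x. g x * complex_of_real (V x))"
proof -
  have [measurable]: "g \<in> borel_measurable borel"
    using g by (rule borel_measurable_continuous_onI)
  have "compact (g ` cball 0 R)"
    by (intro compact_continuous_image continuous_on_subset[OF g]) auto
  then have "bounded (g ` cball 0 R)"
    by (rule compact_imp_bounded)
  then obtain K where K: "\<And>x. x \<in> cball 0 R \<Longrightarrow> cmod (g x) \<le> K"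
    unfolding bounded_iff by blast
  show ?thesis
  proof (rule Bochner_Integration.integrable_bound)
    show "integrable lborel (\<lambda>x. (K * M) * indicator (cball 0 R) x :: real)"
      by (intro integrable_mult_right integrable_real_indicator emeasure_compact_finite) auto
    have "cmod (g x * complex_of_real (V x)) \<le> norm ((K * M) * indicator (cball 0 R) x :: real)" for x
    proof (cases "V x = 0")
      case False
      then have x: "x \<in> cball 0 R"
        using V_support by simp
      have "cmod (g x) * V x \<le> K * M"
        using K[OF x] norm_ge_zero[of "g x"] by (intro mult_mono V_le V_nonneg) linarith+
      then show ?thesis
        using x by (simp add: norm_mult V_nonneg)
    qed simp
    then show "AE x in lborel. cmod (g x * complex_of_real (V x))
        \<le> norm ((K * M) * indicator (cball 0 R) x :: real)"
      by simp
  qed measurable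
qed

text \<open>Up to the normalisation and the factor (-i)^m, this is the m-th derivative at the origin
  of the Fourier integral of g V in direction \<eta>.\<close>

definition moment :: "(real ^ 'd \<Rightarrow> complex) \<Rightarrow> nat \<Rightarrow> real ^ 'd \<Rightarrow> complex" where
  "moment g m \<eta> = (\<integral>x. of_real ((x \<bullet> \<eta>) ^ m) * (g x * of_real (V x)) \<partial>lborel)"

lemma integrable_moment:
  assumes "continuous_on UNIV g"
  shows "integrable lborel (\<lambda>x. of_real ((x \<bullet> \<eta>) ^ m) * (g x * complex_of_real (V x)))"
  using integrable_continuous_V[of "\<lambda>x. of_real ((x \<bullet> \<eta>) ^ m) * g x"] assms
  by (simp add: mult.assoc continuous_intros)

lemma moment_scaleR: "moment g m (r *\<^sub>R \<eta>) = of_real (r ^ m) * moment g m \<eta>"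
  by (simp add: moment_def power_mult_distrib mult.assoc)

text \<open>Continuity later upgrades vanishing for almost every direction to vanishing for all. The
  compact support of V provides the dominating function.\<close>

lemma continuous_moment:
  assumes g: "continuous_on UNIV g"
  shows "continuous_on UNIV (moment g m)"
proof (rule continuous_at_imp_continuous_on, safe)
  fix \<eta> :: "real ^ 'd"
  have [measurable]: "g \<in> borel_measurable borel"
    using g by (rule borel_measurable_continuous_onI)
  show "isCont (moment g m) \<eta>"
  proof (rule continuous_at_sequentiallyI)
    fix h assume h: "h \<longlonglongrightarrow> \<eta>"
    then obtain B where B: "\<And>k. norm (h k) \<le> B"
      using convergent_imp_Bseq convergentI BseqE by metis
    have "(\<lambda>k. \<integral>x. of_real ((x \<bullet> h k) ^ m) * (g x * of_real (V x)) \<partial>lborel)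
        \<longlonglongrightarrow> (\<integral>x. of_real ((x \<bullet> \<eta>) ^ m) * (g x * of_real (V x)) \<partial>lborel)"
    proof (rule integral_dominated_convergence[where w = "\<lambda>x. (\<bar>R\<bar> * B) ^ m * cmod
        (g x * of_real (V x))"])
      show "AE x in lborel. (\<lambda>k. of_real ((x \<bullet> h k) ^ m) * (g x * complex_of_real (V x)))
          \<longlonglongrightarrow> of_real ((x \<bullet> \<eta>) ^ m) * (g x * of_real (V x))"
        by (intro AE_I2 tendsto_intros h)
      have "cmod (of_real ((x \<bullet> h k) ^ m) * (g x * complex_of_real (V x)))
          \<le> (\<bar>R\<bar> * B) ^ m * cmod (g x * of_real (V x))" for k x
      proof (cases "V x = 0")
        case False
        then have "norm x \<le> \<bar>R\<bar>"
          using V_support by force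
        then have "norm x * norm (h k) \<le> \<bar>R\<bar> * B"
          by (intro mult_mono B) auto
        then have "\<bar>x \<bullet> h k\<bar> \<le> \<bar>R\<bar> * B"
          using Cauchy_Schwarz_ineq2[of x "h k"] by linarith
        then have "\<bar>x \<bullet> h k\<bar> ^ m \<le> (\<bar>R\<bar> * B) ^ m"
          by (intro power_mono) auto
        then show ?thesis
          unfolding norm_mult[of "of_real _"]
              by (intro mult_right_mono) (auto simp: power_abs norm_power)
      qed simp
      then show "AE x in lborel. cmod (of_real ((x \<bullet> h k) ^ m) * (g x * complex_of_real (V x)))
          \<le> (\<bar>R\<bar> * B) ^ m * cmod (g x * of_real (V x))" for k
        by simp
      show "integrable lborel (\<lambda>x. (\<bar>R\<bar> * B) ^ m * cmod (g x * complex_of_real (V x)))"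
        by (intro integrable_mult_right integrable_norm integrable_continuous_V g)
    qed measurable
    then show "(\<lambda>k. moment g m (h k)) \<longlonglongrightarrow> moment g m \<eta>"
      by (simp add: moment_def)
  qed
qed

text \<open>The exponential is expanded to order m along the ray through \<eta>. The lower terms
  integrate to zero by assumption, so multiplication by t^(-m), with t = 1 / (k + 1), isolates the
  term of order m up to an error of order t.\<close>

lemma fourier_Taylor:
  assumes g: "continuous_on UNIV g" and low: "\<And>j. j < m \<Longrightarrow> moment g j \<eta> = 0"
  shows "(\<lambda>k. of_real (real (Suc k) ^ m) * fourier_integral (\<lambda>x. g x * of_real (V x))
      ((1 / Suc k) *\<^sub>R \<eta>))
    \<longlonglongrightarrow> of_real ((2 * pi) powr (- real CARD('d) / 2)) * ((- \<i>) ^ m / fact m * moment g m \<eta>)"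
proof -
  let ?\<phi> = "\<lambda>x. g x * complex_of_real (V x)"
  let ?c = "complex_of_real ((2 * pi) powr (- real CARD('d) / 2))"
  define K where "K = cmod ?c * (\<integral>x. cmod (of_real ((x \<bullet> \<eta>) ^ Suc m) * ?\<phi> x) \<partial>lborel)"
  have int: "integrable lborel ?\<phi>"
    by (rule integrable_continuous_V[OF g])
  have main: "cmod (fourier_integral ?\<phi> (t *\<^sub>R \<eta>)
      - ?c * ((- \<i>) ^ m / fact m * moment g m \<eta>) * of_real (t ^ m)) \<le> t ^ Suc m * K"
    if t: "t \<ge> 0" for t :: real
  proof -
    define T where "T x = (\<Sum>j\<le>m. (\<i> * of_real (- (t * (x \<bullet> \<eta>)))) ^ j / fact j)" for x
    have Teq: "T x * ?\<phi> x = (\<Sum>j\<le>m. ((- \<i>) ^ j / fact j * of_real (t ^ j)) * (of_real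
        ((x \<bullet> \<eta>) ^ j) * ?\<phi> x))" for x
      unfolding T_def sum_distrib_right
      by (intro sum.cong refl) (simp add: power_mult_distrib power_minus[of "\<i> * _"] power_minus[of \<i>])
    have intT: "integrable lborel (\<lambda>x. T x * ?\<phi> x)"
      unfolding Teq by (intro Bochner_Integration.integrable_sum integrable_mult_right
          integrable_moment g)
    have "(\<integral>x. T x * ?\<phi> x \<partial>lborel) = (\<Sum>j\<le>m. ((- \<i>) ^ j / fact j * of_real (t ^ j)) * moment g j \<eta>)"
      unfolding Teq moment_def
      by (subst Bochner_Integration.integral_sum)
          (auto intro!: integrable_mult_right integrable_moment g simp del: of_real_power)
    also have "\<dots> = ((- \<i>) ^ m / fact m * of_real (t ^ m)) * moment g m \<eta>"
      using low by (subst sum.remove[of _ m]) (auto intro!: sum.neutral)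
    finally have IT: "(\<integral>x. T x * ?\<phi> x \<partial>lborel)
        = ((- \<i>) ^ m / fact m * of_real (t ^ m)) * moment g m \<eta>" .
    have intc: "integrable lborel (\<lambda>x. cis (- (x \<bullet> (t *\<^sub>R \<eta>))) * ?\<phi> x)"
      by (rule integrable_cis_mult(1)[OF int])
    have "fourier_integral ?\<phi> (t *\<^sub>R \<eta>) - ?c * ((- \<i>) ^ m / fact m * moment g m \<eta>) * of_real (t ^ m)
        = ?c * ((\<integral>x. cis (- (x \<bullet> (t *\<^sub>R \<eta>))) * ?\<phi> x \<partial>lborel) - (\<integral>x. T x * ?\<phi> x \<partial>lborel))"
      unfolding fourier_integral_def IT by (simp add: algebra_simps)
    also have "\<dots> = ?c * (\<integral>x. cis (- (x \<bullet> (t *\<^sub>R \<eta>))) * ?\<phi> x - T x * ?\<phi> x \<partial>lborel)"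
      by (subst Bochner_Integration.integral_diff[OF intc intT]) simp
    finally have "cmod (fourier_integral ?\<phi> (t *\<^sub>R \<eta>)
        - ?c * ((- \<i>) ^ m / fact m * moment g m \<eta>) * of_real (t ^ m))
        = cmod ?c * cmod (\<integral>x. cis (- (x \<bullet> (t *\<^sub>R \<eta>))) * ?\<phi> x - T x * ?\<phi> x \<partial>lborel)"
      by (simp only: norm_mult)
    also have "\<dots> \<le> cmod ?c * (\<integral>x. cmod (cis (- (x \<bullet> (t *\<^sub>R \<eta>))) * ?\<phi> x - T x * ?\<phi> x) \<partial>lborel)"
      by (intro mult_left_mono integral_norm_bound) simp
    also have "\<dots> \<le> cmod ?c * (\<integral>x. t ^ Suc m * cmod (of_real ((x \<bullet> \<eta>) ^ Suc m) * ?\<phi> x) \<partial>lborel)"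
    proof (intro mult_left_mono integral_mono integrable_norm Bochner_Integration.integrable_diff
        intc intT
        integrable_mult_right integrable_moment g)
      fix x
      let ?y = "- (t * (x \<bullet> \<eta>))"
      have "cmod (cis (- (x \<bullet> (t *\<^sub>R \<eta>))) - T x) \<le> \<bar>?y\<bar> ^ Suc m / fact (Suc m)"
        using iexp_approx1[of ?y m] by (simp add: T_def cis_conv_exp)
      \<comment> \<open>The factorial is dropped; only the power of t in the remainder
        matters.\<close>
      also have "\<dots> \<le> \<bar>?y\<bar> ^ Suc m / 1"
        using fact_ge_1[of "Suc m", where 'a=real] by (intro divide_left_mono) auto
      also have "\<dots> = t ^ Suc m * cmod (of_real ((x \<bullet> \<eta>) ^ Suc m))"
        using t by (simp add: abs_mult power_mult_distrib norm_power norm_mult)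
      finally have "cmod (cis (- (x \<bullet> (t *\<^sub>R \<eta>))) - T x) * cmod (?\<phi> x)
          \<le> t ^ Suc m * cmod (of_real ((x \<bullet> \<eta>) ^ Suc m)) * cmod (?\<phi> x)"
        by (rule mult_right_mono) simp
      then show "cmod (cis (- (x \<bullet> (t *\<^sub>R \<eta>))) * ?\<phi> x - T x * ?\<phi> x)
          \<le> t ^ Suc m * cmod (of_real ((x \<bullet> \<eta>) ^ Suc m) * ?\<phi> x)"
        unfolding left_diff_distrib[symmetric] norm_mult[of _ "?\<phi> x"] mult.assoc .
    qed simp
    also have "\<dots> = t ^ Suc m * K"
      by (simp only: K_def integral_mult_right_zero mult.left_commute)
    finally show ?thesis .
  qed
  define L where "L = ?c * ((- \<i>) ^ m / fact m * moment g m \<eta>)"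
  have "(\<lambda>k. of_real (real (Suc k) ^ m) * fourier_integral ?\<phi> ((1 / Suc k) *\<^sub>R \<eta>) - L) \<longlonglongrightarrow> 0"
  proof (rule Lim_null_comparison)
    have "cmod (of_real (real (Suc k) ^ m) * fourier_integral ?\<phi> ((1 / Suc k) *\<^sub>R \<eta>) - L)
        \<le> (1 / Suc k) * K" for k
    proof -
      have "of_real (real (Suc k) ^ m) * of_real ((1 / real (Suc k)) ^ m) = (1 :: complex)"
        unfolding of_real_mult[symmetric] power_mult_distrib[symmetric] by simp
      then have "of_real (real (Suc k) ^ m) * fourier_integral ?\<phi> ((1 / Suc k) *\<^sub>R \<eta>) - L
          = of_real (real (Suc k) ^ m) * (fourier_integral ?\<phi> ((1 / Suc k) *\<^sub>R \<eta>)
              - L * of_real ((1 / Suc k) ^ m))"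
        by (simp add: right_diff_distrib)
      then have "cmod (of_real (real (Suc k) ^ m) * fourier_integral ?\<phi> ((1 / Suc k) *\<^sub>R \<eta>) - L)
          = real (Suc k) ^ m * cmod (fourier_integral ?\<phi> ((1 / Suc k) *\<^sub>R \<eta>)
              - L * of_real ((1 / Suc k) ^ m))"
        by (simp only: norm_mult norm_of_real power_abs abs_of_nat)
      also have "\<dots> \<le> real (Suc k) ^ m * ((1 / Suc k) ^ Suc m * K)"
        unfolding L_def by (intro mult_left_mono main) auto
      also have "\<dots> = (1 / Suc k) * K"
        by (simp add: power_divide)
      finally show ?thesis .
    qed
    then show "\<forall>\<^sub>F k in sequentially. cmod (of_real (real (Suc k) ^ m) * fourier_integral ?\<phi>
        ((1 / Suc k) *\<^sub>R \<eta>) - L) \<le> (1 / Suc k) * K"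
      by (intro always_eventually allI)
    have "(\<lambda>k. (1 / Suc k) * K) \<longlonglongrightarrow> 0 * K"
      by (intro tendsto_intros LIMSEQ_Suc[OF lim_1_over_n])
    then show "(\<lambda>k. (1 / Suc k) * K) \<longlonglongrightarrow> 0" by simp
  qed
  then show ?thesis
    unfolding L_def by (simp only: LIM_zero_iff)
qed

text \<open>Rescaling by \<open>1 / (k + 1)\<close> turns the integrability of \<open>\<bar>\<Phi>\<bar>\<^sup>2 / a\<close> near the origin into the vanishing, by
  Fatou's lemma, of the first non-zero Taylor polynomial of \<open>\<Phi>\<close> at the origin.\<close>

lemma moment_zero:
  assumes g: "continuous_on UNIV g"
    and fin: "(\<integral>\<^sup>+ \<xi>. ennreal ((cmod (fourier_integral (\<lambda>x. g x * of_real (V x)) \<xi>))\<^sup>2 / a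
        \<xi>) \<partial>lborel) < \<infinity>"
    and m: "real CARD('d) + 2 * real m \<le> 2 * s"
  shows "moment g m \<eta> = 0"
  using m
proof (induction m arbitrary: \<eta> rule: less_induct)
  case (less m)
  define \<Phi> where "\<Phi> = fourier_integral (\<lambda>x. g x * complex_of_real (V x))"
  have [measurable]: "g \<in> borel_measurable borel"
    using g by (rule borel_measurable_continuous_onI)
  have [measurable]: "\<Phi> \<in> borel_measurable borel"
    unfolding \<Phi>_def by measurable
  have [measurable]: "ball 0 r \<in> sets (borel :: (real ^ 'd) measure)" for r
    by simp
  define \<Psi> where "\<Psi> \<xi> = ennreal ((cmod (\<Phi> \<xi>))\<^sup>2 / a \<xi>)" for \<xi>
  have [measurable]: "\<Psi> \<in> borel_measurable borel"
    unfolding \<Psi>_def by measurable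
  define c where "c = complex_of_real ((2 * pi) powr (- real CARD('d) / 2)) * ((- \<i>) ^ m / fact m)"
  have c: "c \<noteq> 0" by (simp add: c_def)
  have low: "moment g j \<eta> = 0" if "j < m" for j \<eta>
    using that less.prems by (intro less.IH) auto
  have lim: "(\<lambda>k. of_real (real (Suc k) ^ m) * \<Phi> ((1 / Suc k) *\<^sub>R \<eta>)) \<longlonglongrightarrow> c * moment g m \<eta>" for \<eta>
    using fourier_Taylor[OF g low, of m \<eta>] by (simp add: \<Phi>_def c_def mult.assoc)
  define f where "f k \<eta> = ennreal ((cmod (of_real (real (Suc k) ^ m) * \<Phi>
      ((1 / Suc k) *\<^sub>R \<eta>)))\<^sup>2 / a \<eta>) * indicator (ball 0 1) \<eta>"
    for k :: nat and \<eta>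
  have [measurable]: "f k \<in> borel_measurable borel" for k
    unfolding f_def by measurable
  have f_le: "(\<integral>\<^sup>+ \<eta>. f k \<eta> \<partial>lborel) \<le> (\<integral>\<^sup>+ \<xi>. \<Psi> \<xi> * indicator (ball 0 (1 / Suc k)) \<xi> \<partial>lborel)" for k
  proof -
    define t where "t = 1 / real (Suc k)"
    have t: "0 < t" "t \<le> 1"
      by (auto simp: t_def)
    have pt: "f k \<eta> \<le> ennreal (\<bar>t\<bar> ^ DIM(real ^ 'd)) * (\<Psi> (0 + t *\<^sub>R \<eta>) * indicator (ball 0 t)
        (0 + t *\<^sub>R \<eta>))" for \<eta>
    proof -
      have at: "a (t *\<^sub>R \<eta>) = t powr (2 * s) * a \<eta>"
        using t by (simp add: a_def powr_mult)
      have "(real (Suc k) ^ m)\<^sup>2 = t powr (- (2 * real m))"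
      proof -
        have "t powr (- (2 * real m)) = inverse (t powr real (m * 2))"
          by (simp add: powr_minus mult.commute)
        also have "\<dots> = inverse (t ^ (m * 2))"
          using t by (subst powr_realpow) auto
        also have "\<dots> = (real (Suc k) ^ m)\<^sup>2"
          unfolding power_mult t_def by (simp add: power_divide)
        finally show ?thesis by simp
      qed
      then have sq: "(cmod (of_real (real (Suc k) ^ m) * \<Phi> (t *\<^sub>R \<eta>)))\<^sup>2
          = t powr (- (2 * real m)) * (cmod (\<Phi> (t *\<^sub>R \<eta>)))\<^sup>2"
        by (simp only: norm_mult power_mult_distrib norm_of_real power_abs abs_of_nat)
      \<comment> \<open>The hypothesis relating m and s enters here: as t \<le> 1, the factor t^(2s
        - 2m) from rescaling is absorbed by the Jacobian t^d.\<close>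
      have "t powr (2 * s - 2 * real m) \<le> t powr real CARD('d)"
        using t less.prems by (intro powr_mono') auto
      then have "t powr (2 * s) * t powr (- (2 * real m)) \<le> t ^ CARD('d)"
        using t by (simp add: powr_add[symmetric] powr_realpow)
      then have "t powr (2 * s) * t powr (- (2 * real m)) * ((cmod (\<Phi> (t *\<^sub>R \<eta>)))\<^sup>2 / (t powr
          (2 * s) * a \<eta>))
          \<le> t ^ CARD('d) * ((cmod (\<Phi> (t *\<^sub>R \<eta>)))\<^sup>2 / (t powr (2 * s) * a \<eta>))"
        by (intro mult_right_mono) auto
      then have "(cmod (of_real (real (Suc k) ^ m) * \<Phi> (t *\<^sub>R \<eta>)))\<^sup>2 / a \<eta>
          \<le> t ^ CARD('d) * ((cmod (\<Phi> (t *\<^sub>R \<eta>)))\<^sup>2 / a (t *\<^sub>R \<eta>))"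
        unfolding sq at using t by (simp add: field_simps)
      then have "ennreal ((cmod (of_real (real (Suc k) ^ m) * \<Phi> (t *\<^sub>R \<eta>)))\<^sup>2 / a \<eta>)
          \<le> ennreal (t ^ CARD('d)) * \<Psi> (t *\<^sub>R \<eta>)"
        using t by (simp add: \<Psi>_def ennreal_mult[symmetric] ennreal_leI)
      moreover have "t *\<^sub>R \<eta> \<in> ball 0 t \<longleftrightarrow> \<eta> \<in> ball 0 1"
        using t by (simp add: mult_less_cancel_left1)
      ultimately show ?thesis
        unfolding f_def t_def[symmetric] using t by (cases "\<eta> \<in> ball 0 1") (simp_all add: indicator_def)
    qed
    have "(\<integral>\<^sup>+ \<eta>. f k \<eta> \<partial>lborel) \<le> (\<integral>\<^sup>+ \<eta>. ennreal
        (\<bar>t\<bar> ^ DIM(real ^ 'd)) * (\<Psi> (0 + t *\<^sub>R \<eta>) * indicator (ball 0 t) (0 + t *\<^sub>R \<eta>)) \<partial>lborel)"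
      by (intro nn_integral_mono pt)
    also have "\<dots> = ennreal (\<bar>t\<bar> ^ DIM(real ^ 'd)) * (\<integral>\<^sup>+ \<eta>. \<Psi> (0 + t *\<^sub>R \<eta>) * indicator (ball 0 t)
        (0 + t *\<^sub>R \<eta>) \<partial>lborel)"
      by (intro nn_integral_cmult) measurable
    also have "\<dots> = (\<integral>\<^sup>+ \<xi>. \<Psi> \<xi> * indicator (ball 0 t) \<xi> \<partial>lborel)"
      using t by (intro nn_integral_lborel_affine[symmetric]) auto
    finally show ?thesis by (simp add: t_def)
  qed
  have "(\<lambda>k. \<integral>\<^sup>+ \<xi>. \<Psi> \<xi> * indicator (ball 0 (1 / Suc k)) \<xi> \<partial>lborel) \<longlonglongrightarrow> (\<integral>\<^sup>+ (\<xi> :: real ^ 'd). 0 \<partial>lborel)"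
  proof (rule nn_integral_dominated_convergence[where w = \<Psi>])
    show "(\<integral>\<^sup>+ \<xi>. \<Psi> \<xi> \<partial>lborel) < \<infinity>"
      using fin by (simp add: \<Psi>_def \<Phi>_def)
    show "AE \<xi> in lborel. \<Psi> \<xi> * indicator (ball 0 (1 / Suc k)) \<xi> \<le> \<Psi> \<xi>" for k
      by (intro AE_I2) (simp add: indicator_def)
    show "AE \<xi> in lborel. (\<lambda>k. \<Psi> \<xi> * indicator (ball 0 (1 / Suc k)) \<xi>) \<longlonglongrightarrow> 0"
    proof (rule AE_I2)
      fix \<xi> :: "real ^ 'd"
      show "(\<lambda>k. \<Psi> \<xi> * indicator (ball 0 (1 / Suc k)) \<xi>) \<longlonglongrightarrow> 0"
      \<comment> \<open>The shrinking balls always contain the origin, but there \<open>a\<close> is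
        0 and division by zero makes \<open>\<Psi>\<close> vanish.\<close>
      proof (cases "\<xi> = 0")
        case False
        obtain N :: nat where N: "1 / norm \<xi> < N"
          using reals_Archimedean2 by blast
        have "\<Psi> \<xi> * indicator (ball 0 (1 / Suc k)) \<xi> = 0" if "k \<ge> N" for k
        proof -
          have "1 / norm \<xi> < real (Suc k)"
            using N that by simp
          then have "1 / real (Suc k) < norm \<xi>"
            using False by (simp add: field_simps)
          then show ?thesis by simp
        qed
        then show ?thesis
          by (intro tendsto_eventually eventually_sequentiallyI[of N]) auto
      qed (simp add: \<Psi>_def a_def)
    qed
  qed measurable
  then have to0: "(\<lambda>k. \<integral>\<^sup>+ \<xi>. \<Psi> \<xi> * indicator (ball 0 (1 / Suc k)) \<xi> \<partial>lborel) \<longlonglongrightarrow> 0"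
    by (simp only: nn_integral_const mult_zero_left)
  have "(\<integral>\<^sup>+ \<eta>. ennreal ((cmod (c * moment g m \<eta>))\<^sup>2 / a \<eta>) * indicator (ball 0 1) \<eta> \<partial>lborel)
      = (\<integral>\<^sup>+ \<eta>. liminf (\<lambda>k. f k \<eta>) \<partial>lborel)"
  proof (rule nn_integral_cong)
    fix \<eta> :: "real ^ 'd"
    have "(\<lambda>k. (cmod (of_real (real (Suc k) ^ m) * \<Phi> ((1 / Suc k) *\<^sub>R \<eta>)))\<^sup>2 / a \<eta>)
        \<longlonglongrightarrow> (cmod (c * moment g m \<eta>))\<^sup>2 / a \<eta>"
      using tendsto_mult[OF tendsto_power[OF tendsto_norm[OF lim[of \<eta>]], of 2]
          tendsto_const[of "inverse (a \<eta>)"]]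
      by (simp only: divide_inverse)
    then have "(\<lambda>k. f k \<eta>) \<longlonglongrightarrow> ennreal ((cmod (c * moment g m \<eta>))\<^sup>2 / a \<eta>) * indicator (ball 0 1) \<eta>"
      unfolding f_def by (cases "\<eta> \<in> ball 0 1") (auto simp: indicator_def intro!: tendsto_ennrealI)
    then show "ennreal ((cmod (c * moment g m \<eta>))\<^sup>2 / a \<eta>) * indicator (ball 0 1) \<eta>
        = liminf (\<lambda>k. f k \<eta>)"
      by (metis lim_imp_Liminf trivial_limit_sequentially)
  qed
  also have "\<dots> \<le> liminf (\<lambda>k. \<integral>\<^sup>+ \<eta>. f k \<eta> \<partial>lborel)"
    by (rule nn_integral_liminf) measurable
  also have "\<dots> \<le> liminf (\<lambda>k. \<integral>\<^sup>+ \<xi>. \<Psi> \<xi> * indicator (ball 0 (1 / Suc k)) \<xi> \<partial>lborel)"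
    by (intro Liminf_mono always_eventually allI f_le)
  also have "\<dots> = 0"
    using to0 by (metis lim_imp_Liminf trivial_limit_sequentially)
  finally have int0: "(\<integral>\<^sup>+ \<eta>. ennreal ((cmod (c * moment g m \<eta>))\<^sup>2 / a \<eta>) * indicator (ball 0 1)
      \<eta> \<partial>lborel) = 0"
    by simp
  have [measurable]: "moment g m \<in> borel_measurable borel"
    by (rule borel_measurable_continuous_onI[OF continuous_moment[OF g]])
  have "AE \<eta> in lborel. ennreal ((cmod (c * moment g m \<eta>))\<^sup>2 / a \<eta>) * indicator (ball 0 1) \<eta> = 0"
    using int0 by (subst (asm) nn_integral_0_iff_AE) measurable
  \<comment> \<open>Where \<open>a\<close> is 0, division by zero gives 0 and the integral carries
    no information; the origin is therefore discarded as a null set.\<close>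
  moreover have "AE \<eta> in lborel. \<eta> \<noteq> (0 :: real ^ 'd)"
    by (rule AE_lborel_singleton)
  ultimately have AE0: "AE \<eta> in lborel. \<eta> \<in> ball 0 1 \<longrightarrow> moment g m \<eta> = 0"
  proof eventually_elim
    case (elim \<eta>)
    have "a \<eta> > 0"
      using elim(2) by (simp add: a_def)
    then show ?case
      using elim(1) c by (auto simp: indicator_def ennreal_eq_0_iff divide_le_0_iff zero_less_mult_iff)
  qed
  have ball: "moment g m \<eta> = 0" if "\<eta> \<in> ball 0 1" for \<eta>
    by (rule continuous_AE_zero[OF continuous_moment[OF g] open_ball AE0 that])
  \<comment> \<open>By homogeneity of the moment, vanishing on the unit ball extends to every
    direction.\<close>
  define r where "r = 1 / (norm \<eta> + 1)"
  have n1: "norm \<eta> + 1 > 0"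
    by (simp add: add_nonneg_pos)
  then have r: "r > 0" "r *\<^sub>R \<eta> \<in> ball 0 1"
    by (auto simp: r_def)
  have "of_real (r ^ m) * moment g m \<eta> = 0"
    using ball[OF r(2)] by (simp add: moment_scaleR)
  then show "moment g m \<eta> = 0"
    using r(1) by simp
qed

text \<open>Polarisation: replacing \<eta> by t y + \<eta> in the integral with exponent p + 1 gives
  a polynomial in t that vanishes identically. Its coefficient of t is a positive multiple of the
  integral with one factor turned into the linear form of y. Factors are split off one at a
  time.\<close>

lemma polarized_moment_zero:
  assumes g: "continuous_on UNIV g" and zero: "\<And>\<eta>. moment g (p + length ys) \<eta> = 0"
  shows "(\<integral>x. of_real ((x \<bullet> \<eta>) ^ p * (\<Prod>y\<leftarrow>ys. x \<bullet> y)) * (g x * of_real (V x)) \<partial>lborel) = 0"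
  using zero
proof (induction ys arbitrary: p \<eta>)
  case (Cons y ys)
  let ?w = "\<lambda>x. complex_of_real (\<Prod>y\<leftarrow>ys. x \<bullet> y) * (g x * of_real (V x))"
  have wint: "integrable lborel (\<lambda>x. of_real (q x) * ?w x)" if "continuous_on UNIV q"
      for q :: "real ^ 'd \<Rightarrow> real"
  proof -
    have "continuous_on UNIV (\<lambda>x. of_real (q x) * (complex_of_real (\<Prod>y\<leftarrow>ys. x \<bullet> y) * g x))"
      by (intro continuous_intros that g continuous_on_of_real continuous_prod_list_inner)
    from integrable_continuous_V[OF this] show ?thesis
      by (simp add: mult.assoc)
  qed
  define c where "c k = of_nat (Suc p choose k) * (\<integral>x. of_real
      ((x \<bullet> y) ^ k * (x \<bullet> \<eta>) ^ (Suc p - k)) * ?w x \<partial>lborel)" for k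
  have "(\<Sum>k\<le>Suc p. c k * of_real t ^ k) = 0" for t :: real
  proof -
    have "0 = (\<integral>x. of_real ((x \<bullet> (t *\<^sub>R y + \<eta>)) ^ Suc p * (\<Prod>y\<leftarrow>ys. x \<bullet> y)) * (g x * of_real
        (V x)) \<partial>lborel)"
      using Cons.IH[of "Suc p" "t *\<^sub>R y + \<eta>"] Cons.prems by simp
    also have "\<dots> = (\<integral>x. (\<Sum>k\<le>Suc p. (of_nat (Suc p choose k) * of_real t ^ k) * (of_real
        ((x \<bullet> y) ^ k * (x \<bullet> \<eta>) ^ (Suc p - k)) * ?w x)) \<partial>lborel)"
    proof (rule Bochner_Integration.integral_cong[OF refl])
      fix x
      have "(x \<bullet> (t *\<^sub>R y + \<eta>)) ^ Suc p = (\<Sum>k\<le>Suc p.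
          (Suc p choose k) * (t * (x \<bullet> y)) ^ k * (x \<bullet> \<eta>) ^ (Suc p - k))"
        by (simp only: inner_add_right inner_scaleR_right binomial_ring)
      then show "of_real ((x \<bullet> (t *\<^sub>R y + \<eta>)) ^ Suc p * (\<Prod>y\<leftarrow>ys. x \<bullet> y)) * (g x * of_real (V x))
          = (\<Sum>k\<le>Suc p. (of_nat (Suc p choose k) * of_real t ^ k) * (of_real
              ((x \<bullet> y) ^ k * (x \<bullet> \<eta>) ^ (Suc p - k)) * ?w x))"
        by (simp only: of_real_mult of_real_sum sum_distrib_right)
          (intro sum.cong refl, simp add: power_mult_distrib mult_ac)
    qed
    also have "\<dots> = (\<Sum>k\<le>Suc p. (of_nat (Suc p choose k) * of_real t ^ k) * (\<integral>x. of_real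
        ((x \<bullet> y) ^ k * (x \<bullet> \<eta>) ^ (Suc p - k)) * ?w x \<partial>lborel))"
      by (subst Bochner_Integration.integral_sum)
        (auto intro!: integrable_mult_right wint continuous_intros simp del: of_real_mult of_real_power)
    finally show ?thesis
      by (simp add: c_def mult_ac)
  qed
  then have "c 1 = 0"
    by (rule polynomial_coeff_zero) simp
  moreover have "of_nat (Suc p choose 1) \<noteq> (0 :: complex)"
    by (simp del: of_nat_Suc)
  ultimately have "(\<integral>x. of_real ((x \<bullet> y) ^ 1 * (x \<bullet> \<eta>) ^ (Suc p - 1)) * ?w x \<partial>lborel) = 0"
    unfolding c_def mult_eq_0_iff by blast
  then show ?case
    by (simp add: mult_ac)
qed (simp add: moment_def)

lemma monomial_orthogonal:
  assumes g: "continuous_on UNIV g"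
    and fin: "(\<integral>\<^sup>+ \<xi>. ennreal ((cmod (fourier_integral (\<lambda>x. g x * of_real (V x)) \<xi>))\<^sup>2 / a
        \<xi>) \<partial>lborel) < \<infinity>"
    and \<alpha>: "real CARD('d) + 2 * real (sum \<alpha> UNIV) \<le> 2 * s"
  shows "(\<integral>x. of_real (monomial \<alpha> x) * (g x * of_real (V x)) \<partial>lborel) = 0"
proof -
  obtain ys :: "(real ^ 'd) list" where ys: "length ys = sum \<alpha> UNIV" "\<And>x. monomial \<alpha> x = (\<Prod>y\<leftarrow>ys. x \<bullet> y)"
    using monomial_as_product by blast
  have "moment g (0 + length ys) \<eta> = 0" for \<eta>
    using moment_zero[OF g fin] \<alpha> ys(1) by simp
  from polarized_moment_zero[OF g this, of 0] show ?thesis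
    by (simp add: ys(2))
qed

end

subsection \<open>The trial space\<close>

text \<open>Elimination of one unknown by the last equation. It serves to choose coefficients of a
  trial state orthogonal to fewer eigenvectors than there are coefficients.\<close>

lemma underdetermined_system:
  fixes M :: "nat \<Rightarrow> 'j \<Rightarrow> complex"
  assumes "finite J" "m < card J"
  shows "\<exists>c. (\<exists>j\<in>J. c j \<noteq> 0) \<and> (\<forall>i<m. (\<Sum>j\<in>J. c j * M i j) = 0)"
  using assms
proof (induction m arbitrary: J M)
  case 0
  then obtain j where "j \<in> J"
    by (metis all_not_in_conv card.empty less_nat_zero_code)
  then show ?case
    by (intro exI[of _ "\<lambda>_. 1"]) auto
next
  case (Suc m)
  show ?case
  proof (cases "\<forall>j\<in>J. M m j = 0")
    case True
    then show ?thesis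
      using Suc.IH[OF Suc.prems(1), of M] Suc.prems(2) by (auto simp: less_Suc_eq)
  next
    case False
    then obtain p where p: "p \<in> J" "M m p \<noteq> 0"
      by blast
    define J' where "J' = J - {p}"
    have J': "finite J'" "m < card J'" "J = insert p J'" "p \<notin> J'"
      using Suc.prems p by (auto simp: J'_def)
    obtain c where c: "\<exists>j\<in>J'. c j \<noteq> 0" "\<And>i. i < m \<Longrightarrow> (\<Sum>j\<in>J'. c j * (M i j - M m j / M m p * M i p)) = 0"
      using Suc.IH[OF J'(1,2), of "\<lambda>i j. M i j - M m j / M m p * M i p"] by blast
    \<comment> \<open>The value at p solves the last equation; the modified coefficients in the
      induction hypothesis are those left after substituting it into the others.\<close>
    define c' where "c' = c(p := - (\<Sum>j\<in>J'. c j * M m j) / M m p)"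
    have c'J: "(\<Sum>j\<in>J'. c' j * M i j) = (\<Sum>j\<in>J'. c j * M i j)" for i
      using J'(4) by (intro sum.cong) (auto simp: c'_def)
    have sum: "(\<Sum>j\<in>J. c' j * M i j) = (\<Sum>j\<in>J'. c j * M i j) - (\<Sum>j\<in>J'. c j * M m j) / M m p * M i p" for i
      using J' by (simp add: c'J) (simp add: c'_def)
    have "(\<Sum>j\<in>J. c' j * M i j) = 0" if "i < Suc m" for i
    proof (cases "i = m")
      case True
      then show ?thesis
        using p by (simp add: sum)
    next
      case False
      then have "i < m"
        using that by simp
      have "(\<Sum>j\<in>J. c' j * M i j) = (\<Sum>j\<in>J'. c j * (M i j - M m j / M m p * M i p))"
        unfolding sum sum_divide_distrib sum_distrib_right sum_subtractf[symmetric]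
        by (intro sum.cong refl) (simp add: algebra_simps)
      then show ?thesis
        using c(2)[OF \<open>i < m\<close>] by simp
    qed
    moreover have "\<exists>j\<in>J. c' j \<noteq> 0"
      using c(1) J' by (auto simp: c'_def)
    ultimately show ?thesis by blast
  qed
qed

section \<open>Birman-Schwinger trial states\<close>

context compact_potential
begin

definition w :: "real ^ 'd \<Rightarrow> real" where
  "w x = sqrt (V x)"

definition wL :: "'d L2 \<Rightarrow> 'd L2" where
  "wL f = mult_L2 (\<lambda>x. of_real (w x)) f"

lemma w_measurable [measurable]: "w \<in> borel_measurable borel"
  unfolding w_def by measurable

lemma w_square: "w x * w x = V x"
  by (simp add: w_def V_nonneg)

lemma bm_w: "bounded_measurable (\<lambda>x. of_real (w x))"
  by (rule bounded_measurableI[where C = "sqrt M"]) (simp_all add: w_def V_nonneg V_le)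

lemma wL_wL: "wL (wL u) = VL u"
  unfolding wL_def VL_def mult_L2_mult[OF bm_w bm_w] by (simp add: w_square flip: of_real_mult)

lemma cinner_wL: "cinner (wL u) f = cinner u (wL f)"
  using cinner_mult_L2_right[OF bm_w, of u f] by (simp add: wL_def)

lemma bounded_linear_wL: "bounded_linear wL"
  unfolding wL_def[abs_def] by (rule bounded_linear_mult_L2[OF bm_w])

text \<open>For f = g w one has w f = g V, which is integrable. The L^2 transform is then given by
  an actual Fourier integral, the object to which the results on moments apply.\<close>

lemma
  assumes g: "continuous_on UNIV g"
  shows square_integrable_mult_w: "square_integrable (\<lambda>x. g x * of_real (w x))"
    and fourier_wL: "fourier_L2 (wL (to_L2 (\<lambda>x. g x * of_real (w x))))
        = to_L2 (fourier_integral (\<lambda>x. g x * of_real (V x)))"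
    and square_integrable_fourier_mult_V: "square_integrable
        (fourier_integral (\<lambda>x. g x * of_real (V x)))"
    and norm_to_L2_mult_w: "of_real ((norm (to_L2 (\<lambda>x. g x * of_real (w x))))\<^sup>2)
        = (\<integral>x. cnj (g x) * (g x * of_real (V x)) \<partial>lborel)"
proof -
  have [measurable]: "g \<in> borel_measurable borel"
    using g by (rule borel_measurable_continuous_onI)
  have sq: "complex_of_real ((cmod (g x * of_real (w x)))\<^sup>2) = cnj (g x) * (g x * of_real (V x))" for x
  proof -
    have "(cmod (g x * of_real (w x)))\<^sup>2 = (cmod (g x))\<^sup>2 * V x"
      by (simp add: norm_mult power_mult_distrib power2_eq_square[of "w x"] w_square)
    then show ?thesis
      by (simp only: of_real_mult complex_norm_square) (simp add: mult_ac)
  qed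
  have "continuous_on UNIV (\<lambda>x. cnj (g x) * g x)"
    by (intro continuous_intros g)
  then have int: "integrable lborel (\<lambda>x. complex_of_real ((cmod (g x * of_real (w x)))\<^sup>2))"
    unfolding sq mult.assoc[symmetric] by (rule integrable_continuous_V)
  show sqw: "square_integrable (\<lambda>x. g x * of_real (w x))"
    by (rule square_integrableI) (use int in \<open>simp_all only: complex_of_real_integrable_eq, measurable\<close>)
  have V: "of_real (w x) * (g x * of_real (w x)) = g x * complex_of_real (V x)" for x
    by (simp add: w_square[symmetric])
  have sqV: "square_integrable (\<lambda>x. g x * complex_of_real (V x))"
    using square_integrable_mult[OF bm_w sqw] by (simp only: V)
  note intV = integrable_continuous_V[OF g]
  have "wL (to_L2 (\<lambda>x. g x * of_real (w x))) = to_L2 (\<lambda>x. g x * of_real (V x))"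
    unfolding wL_def by (simp only: bmult_to_L2[OF bm_w sqw] V)
  then show "fourier_L2 (wL (to_L2 (\<lambda>x. g x * of_real (w x))))
      = to_L2 (fourier_integral (\<lambda>x. g x * of_real (V x)))"
    by (simp add: fourier_to_L2[OF intV sqV])
  show "square_integrable (fourier_integral (\<lambda>x. g x * of_real (V x)))"
    by (rule square_integrable_fourier_integral[OF intV sqV])
  show "of_real ((norm (to_L2 (\<lambda>x. g x * of_real (w x))))\<^sup>2)
      = (\<integral>x. cnj (g x) * (g x * of_real (V x)) \<partial>lborel)"
    by (simp only: norm_L2_to_L2[OF sqw] sq[symmetric] integral_complex_of_real)
qed

definition N :: "real \<Rightarrow> 'd L2 \<Rightarrow> real" where
  "N \<epsilon> f = Re (cinner (mult_L2 (\<lambda>\<xi>. of_real (1 / (a \<xi> + \<epsilon>))) (fourier_L2 (wL f))) (fourier_L2 (wL f)))"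

text \<open>\<open>state (T \<epsilon> f)\<close> is \<open>((-\<Delta>)\<^sup>s + \<epsilon>)\<^sup>-\<^sup>1 (V\<^sup>1\<^sup>/\<^sup>2 f)\<close>, and \<open>N \<epsilon> f\<close> is the form of the
  Birman--Schwinger operator at energy \<open>-\<epsilon>\<close>.\<close>

definition T :: "real \<Rightarrow> 'd L2 \<Rightarrow> 'd L2" where
  "T \<epsilon> f = mult_L2 (\<lambda>\<xi>. of_real (sqrt (a \<xi> + 1) / (a \<xi> + \<epsilon>))) (fourier_L2 (wL f))"

lemma bm_resolvent:
  assumes "\<epsilon> > 0"
  shows "bounded_measurable (\<lambda>\<xi>. of_real (1 / (a \<xi> + \<epsilon>)))"
proof (rule bounded_measurableI)
  fix \<xi>
  have "1 / (a \<xi> + \<epsilon>) \<le> 1 / \<epsilon>"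
    using assms a_nonneg[of \<xi>] by (intro divide_left_mono) (auto simp: add_nonneg_pos)
  then show "cmod (of_real (1 / (a \<xi> + \<epsilon>))) \<le> 1 / \<epsilon>"
    using assms by (simp only: norm_of_real) (simp add: add_nonneg_pos abs_of_pos)
qed measurable

lemma bm_T:
  assumes "\<epsilon> > 0" "\<epsilon> \<le> 1"
  shows "bounded_measurable (\<lambda>\<xi>. of_real (sqrt (a \<xi> + 1) / (a \<xi> + \<epsilon>)))"
proof (rule bounded_measurableI)
  fix \<xi>
  have al: "a \<xi> + \<epsilon> > 0"
    using assms by (simp add: add_nonneg_pos)
  have "\<epsilon> * sqrt (a \<xi> + 1) \<le> \<epsilon> * (a \<xi> + 1)"
    using assms real_sqrt_le_mono[of "a \<xi> + 1" "(a \<xi> + 1)\<^sup>2"] self_le_power[of "a \<xi> + 1" 2]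
    by (intro mult_left_mono) auto
  also have "\<dots> \<le> a \<xi> + \<epsilon>"
    using assms mult_right_mono[OF assms(2) a_nonneg, of \<xi>] by (simp add: algebra_simps)
  finally have "sqrt (a \<xi> + 1) / (a \<xi> + \<epsilon>) \<le> 1 / \<epsilon>"
    using al assms by (simp add: field_simps)
  moreover have "0 \<le> sqrt (a \<xi> + 1) / (a \<xi> + \<epsilon>)"
    using al by (intro divide_nonneg_pos) auto
  ultimately show "cmod (of_real (sqrt (a \<xi> + 1) / (a \<xi> + \<epsilon>))) \<le> 1 / \<epsilon>"
    by (simp only: norm_of_real abs_of_nonneg)
qed measurable

lemma
  assumes G: "square_integrable G" "fourier_L2 (wL f) = to_L2 G" and \<epsilon>: "\<epsilon> > 0"
  shows N_eq: "N \<epsilon> f = (\<integral>\<xi>. (cmod (G \<xi>))\<^sup>2 / (a \<xi> + \<epsilon>) \<partial>lborel)"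
    and N_integrable: "integrable lborel (\<lambda>\<xi>. (cmod (G \<xi>))\<^sup>2 / (a \<xi> + \<epsilon>))"
proof -
  note sq = square_integrable_mult[OF bm_resolvent[OF \<epsilon>] G(1)]
  have eq: "(of_real (1 / (a \<xi> + \<epsilon>)) * G \<xi>) * cnj (G \<xi>) = of_real ((cmod (G \<xi>))\<^sup>2 / (a \<xi> + \<epsilon>))" for \<xi>
    by (simp only: mult.assoc complex_norm_square[symmetric]) simp
  show "N \<epsilon> f = (\<integral>\<xi>. (cmod (G \<xi>))\<^sup>2 / (a \<xi> + \<epsilon>) \<partial>lborel)"
    unfolding N_def G(2) bmult_to_L2[OF bm_resolvent[OF \<epsilon>] G(1)] cinner_to_L2[OF sq G(1)] eq
      integral_complex_of_real Re_complex_of_real ..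
  show "integrable lborel (\<lambda>\<xi>. (cmod (G \<xi>))\<^sup>2 / (a \<xi> + \<epsilon>))"
    using integrable_mult_sq[OF sq square_integrable_cnj[OF G(1)]]
    unfolding eq complex_of_real_integrable_eq .
qed

lemma N_antimono:
  assumes "0 < \<epsilon>" "\<epsilon> \<le> \<mu>"
  shows "N \<mu> f \<le> N \<epsilon> f"
proof -
  obtain G where G: "square_integrable G" "fourier_L2 (wL f) = to_L2 G"
    using L2_cases by metis
  have "(\<integral>\<xi>. (cmod (G \<xi>))\<^sup>2 / (a \<xi> + \<mu>) \<partial>lborel) \<le> (\<integral>\<xi>. (cmod (G \<xi>))\<^sup>2 / (a \<xi> + \<epsilon>) \<partial>lborel)"
    using assms by (intro integral_mono N_integrable[OF G] divide_left_mono)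
        (auto simp: add_nonneg_pos intro!: mult_pos_pos)
  then show ?thesis
    using assms by (simp add: N_eq[OF G])
qed

lemma tendsto_N:
  assumes "f \<longlonglongrightarrow> h" "\<epsilon> > 0"
  shows "(\<lambda>k. N \<epsilon> (f k)) \<longlonglongrightarrow> N \<epsilon> h"
  unfolding N_def
  by (intro tendsto_Re tendsto_cinner bounded_linear.tendsto[OF bounded_linear_mult_L2[OF bm_resolvent[OF assms(2)]]]
      bounded_linear.tendsto[OF bounded_linear_fourier_L2]
          bounded_linear.tendsto[OF bounded_linear_wL] assms)

lemma wL_scale: "wL (c \<cdot> f) = c \<cdot> wL f"
  by (simp add: wL_def mult_L2_scale bm_w)

lemma N_scale:
  assumes "\<epsilon> > 0"
  shows "N \<epsilon> (c \<cdot> f) = (cmod c)\<^sup>2 * N \<epsilon> f"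
proof -
  have "N \<epsilon> (c \<cdot> f) = Re ((c * cnj c) * cinner
      (mult_L2 (\<lambda>\<xi>. of_real (1 / (a \<xi> + \<epsilon>))) (fourier_L2 (wL f))) (fourier_L2 (wL f)))"
    unfolding N_def wL_scale fourier_L2_scale mult_L2_scale[OF bm_resolvent[OF assms]]
        cinner_scale_left cinner_scale_right
    by (simp add: mult_ac)
  also have "\<dots> = (cmod c)\<^sup>2 * N \<epsilon> f"
    unfolding complex_norm_square[symmetric] N_def by simp
  finally show ?thesis .
qed

lemma S_T:
  assumes "\<epsilon> > 0" "\<epsilon> \<le> 1"
  shows "S (T \<epsilon> f) = mult_L2 (\<lambda>\<xi>. of_real (1 / (a \<xi> + \<epsilon>))) (fourier_L2 (wL f))"
proof -
  have "complex_of_real (\<sigma> \<xi>) * of_real (sqrt (a \<xi> + 1) / (a \<xi> + \<epsilon>)) = of_real (1 / (a \<xi> + \<epsilon>))" for \<xi>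
  proof -
    have "sqrt (a \<xi> + 1) \<noteq> 0"
      using a1_pos[of \<xi>] by (simp del: a1_pos)
    then show ?thesis
      by (simp add: \<sigma>_def flip: of_real_mult)
  qed
  then show ?thesis
    unfolding S_def T_def mult_L2_mult[OF bm_\<sigma> bm_T[OF assms]] by (simp only:)
qed

text \<open>The form of (-\<Delta>)^s + \<epsilon> at the trial state equals
  \<open>N \<epsilon> f\<close>: in Fourier space the two terms combine by (a + 1) - (1 -
  \<epsilon>) = a + \<epsilon>, which cancels one of the two resolvent factors.\<close>

lemma form_T:
  assumes \<epsilon>: "\<epsilon> > 0" "\<epsilon> \<le> 1"
  shows "form (- \<epsilon>) (T \<epsilon> f) = N \<epsilon> f - P (T \<epsilon> f)"
proof -
  obtain G where G: "square_integrable G" "fourier_L2 (wL f) = to_L2 G"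
    using L2_cases by metis
  note sqT = square_integrable_mult[OF bm_T[OF \<epsilon>] G(1)]
  note sqR = square_integrable_mult[OF bm_resolvent[OF \<epsilon>(1)] G(1)]
  have al: "a \<xi> + \<epsilon> > 0" for \<xi>
    using \<epsilon> by (simp add: add_nonneg_pos)
  have "(norm (T \<epsilon> f))\<^sup>2 = (\<integral>\<xi>. (cmod (of_real (sqrt (a \<xi> + 1) / (a \<xi> + \<epsilon>)) * G \<xi>))\<^sup>2 \<partial>lborel)"
    unfolding T_def G(2) bmult_to_L2[OF bm_T[OF \<epsilon>] G(1)] by (rule norm_L2_to_L2[OF sqT])
  moreover have "(norm (S (T \<epsilon> f)))\<^sup>2 = (\<integral>\<xi>. (cmod (of_real (1 / (a \<xi> + \<epsilon>)) * G \<xi>))\<^sup>2 \<partial>lborel)"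
    unfolding S_T[OF \<epsilon>] G(2) bmult_to_L2[OF bm_resolvent[OF \<epsilon>(1)] G(1)] by (rule norm_L2_to_L2[OF sqR])
  ultimately have "(norm (T \<epsilon> f))\<^sup>2 - (1 - \<epsilon>) * (norm (S (T \<epsilon> f)))\<^sup>2
      = (\<integral>\<xi>. (cmod (of_real (sqrt (a \<xi> + 1) / (a \<xi> + \<epsilon>)) * G \<xi>))\<^sup>2
          - (1 - \<epsilon>) * (cmod (of_real (1 / (a \<xi> + \<epsilon>)) * G \<xi>))\<^sup>2 \<partial>lborel)"
    using square_integrableD(2)[OF sqT] square_integrableD(2)[OF sqR]
    by (simp del: of_real_divide)
  also have "\<dots> = (\<integral>\<xi>. (cmod (G \<xi>))\<^sup>2 / (a \<xi> + \<epsilon>) \<partial>lborel)"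
  proof (rule Bochner_Integration.integral_cong[OF refl])
    fix \<xi>
    have "(cmod (of_real (sqrt (a \<xi> + 1) / (a \<xi> + \<epsilon>)) * G \<xi>))\<^sup>2
        = (a \<xi> + 1) / (a \<xi> + \<epsilon>)\<^sup>2 * (cmod (G \<xi>))\<^sup>2"
      unfolding norm_mult norm_of_real power_mult_distrib power2_abs power_divide
          by (simp add: less_imp_le)
    moreover have "(cmod (of_real (1 / (a \<xi> + \<epsilon>)) * G \<xi>))\<^sup>2 = 1 / (a \<xi> + \<epsilon>)\<^sup>2 * (cmod (G \<xi>))\<^sup>2"
      unfolding norm_mult norm_of_real power_mult_distrib power2_abs power_divide by simp
    moreover have "(a \<xi> + 1) / (a \<xi> + \<epsilon>)\<^sup>2 - (1 - \<epsilon>) * (1 / (a \<xi> + \<epsilon>)\<^sup>2) = 1 / (a \<xi> + \<epsilon>)"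
    proof -
      have "(a \<xi> + 1) / (a \<xi> + \<epsilon>)\<^sup>2 - (1 - \<epsilon>) * (1 / (a \<xi> + \<epsilon>)\<^sup>2) = (a \<xi> + \<epsilon>) / (a \<xi> + \<epsilon>)\<^sup>2"
        by (simp add: diff_divide_distrib[symmetric])
      then show ?thesis
        using al[of \<xi>] by (simp add: power2_eq_square)
    qed
    ultimately show "(cmod (of_real (sqrt (a \<xi> + 1) / (a \<xi> + \<epsilon>)) * G \<xi>))\<^sup>2
          - (1 - \<epsilon>) * (cmod (of_real (1 / (a \<xi> + \<epsilon>)) * G \<xi>))\<^sup>2 = (cmod (G \<xi>))\<^sup>2 / (a \<xi> + \<epsilon>)"
      by (simp only: mult.assoc[symmetric] left_diff_distrib[symmetric]) simp
  qed
  also have "\<dots> = N \<epsilon> f"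
    by (rule N_eq[OF G \<epsilon>(1), symmetric])
  finally show ?thesis
    by (simp add: form_eq)
qed

text \<open>\<open>N \<epsilon> f\<close> is also the inner product of \<open>wL u\<close> with f
  for the trial state u, and the squared norm of \<open>wL u\<close> is its potential
  energy.\<close>

lemma N_square_le:
  assumes \<epsilon>: "\<epsilon> > 0" "\<epsilon> \<le> 1"
  shows "\<bar>N \<epsilon> f\<bar>\<^sup>2 \<le> P (T \<epsilon> f) * (norm f)\<^sup>2"
proof -
  define u where "u = state (T \<epsilon> f)"
  have "N \<epsilon> f = Re (cinner (fourier_L2 u) (fourier_L2 (wL f)))"
    unfolding N_def u_def state_def S_T[OF \<epsilon>] by simp
  also have "\<dots> = Re (cinner (wL u) f)"
    by (simp add: cinner_wL)
  finally have "\<bar>N \<epsilon> f\<bar> \<le> norm (wL u) * norm f"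
    using abs_Re_le_cmod[of "cinner (wL u) f"] cinner_Cauchy_Schwarz[of "wL u" f] by linarith
  then have "\<bar>N \<epsilon> f\<bar>\<^sup>2 \<le> (norm (wL u) * norm f)\<^sup>2"
    by (intro power_mono) auto
  also have "\<dots> = (norm (wL u))\<^sup>2 * (norm f)\<^sup>2"
    by (rule power_mult_distrib)
  also have "(norm (wL u))\<^sup>2 = P (T \<epsilon> f)"
    by (simp add: norm_L2_sq P_def inner_L2_def u_def[symmetric] cinner_wL wL_wL[symmetric])
  finally show ?thesis .
qed

text \<open>From \<open>(norm f)\<^sup>2 < N \<epsilon> f\<close> and \<open>N_square_le\<close> the
  potential energy exceeds \<open>N \<epsilon> f\<close>, so the form of H_s + \<epsilon> is
  negative; the form of H_s is smaller still.\<close>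

lemma trial_negative:
  assumes \<epsilon>: "\<epsilon> > 0" "\<epsilon> \<le> 1" and f: "f \<noteq> 0" "(norm f)\<^sup>2 < N \<epsilon> f"
  shows "form 0 (T \<epsilon> f) < 0"
proof -
  have nf: "(norm f)\<^sup>2 > 0"
    using f by simp
  then have "N \<epsilon> f > 0"
    using f by linarith
  then have "(norm f)\<^sup>2 * N \<epsilon> f < N \<epsilon> f * N \<epsilon> f"
    using f by (intro mult_strict_right_mono)
  also have "\<dots> \<le> P (T \<epsilon> f) * (norm f)\<^sup>2"
    using N_square_le[OF \<epsilon>, of f] by (simp add: power2_eq_square)
  finally have "N \<epsilon> f < P (T \<epsilon> f)"
    using nf by (simp add: mult.commute[of "(norm f)\<^sup>2"])
  then have "form (- \<epsilon>) (T \<epsilon> f) < 0"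
    by (simp add: form_T[OF \<epsilon>])
  moreover have "\<epsilon> * (norm (S (T \<epsilon> f)))\<^sup>2 \<ge> 0"
    using \<epsilon> by simp
  ultimately show ?thesis
    using form_shift[of "- \<epsilon>" "T \<epsilon> f"] by simp
qed

text \<open>In contrapositive form: a bound uniform in \<epsilon> passes by Fatou's lemma to
  \<integral>|G|^2 / a. Then g V is orthogonal to every monomial occurring in g, and summing these
  relations gives the squared norm of f.\<close>

lemma N_unbounded:
  fixes c :: "('d \<Rightarrow> nat) \<Rightarrow> complex"
  assumes deg: "\<And>\<alpha>. \<alpha> \<in> I \<Longrightarrow> real CARD('d) + 2 * real (sum \<alpha> UNIV) \<le> 2 * s"
    and f: "f = to_L2 (\<lambda>x. (\<Sum>\<alpha>\<in>I. c \<alpha> * of_real (monomial \<alpha> x)) * of_real (w x))"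
    and bd: "\<And>\<epsilon>. 0 < \<epsilon> \<Longrightarrow> \<epsilon> \<le> 1 \<Longrightarrow> N \<epsilon> f \<le> C"
  shows "f = 0"
proof -
  define g where "g x = (\<Sum>\<alpha>\<in>I. c \<alpha> * of_real (monomial \<alpha> x))" for x
  have g: "continuous_on UNIV g"
    unfolding g_def monomial_def by (intro continuous_intros)
  define G where "G = fourier_integral (\<lambda>x. g x * complex_of_real (V x))"
  have G: "square_integrable G" "fourier_L2 (wL f) = to_L2 G"
    unfolding G_def f g_def[symmetric] by (rule square_integrable_fourier_mult_V[OF g]
        fourier_wL[OF g])+
  note [measurable] = square_integrableD(1)[OF G(1)]
  have "(\<integral>\<^sup>+ \<xi>. ennreal ((cmod (G \<xi>))\<^sup>2 / a \<xi>) \<partial>lborel)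
      \<le> (\<integral>\<^sup>+ \<xi>. liminf (\<lambda>k. ennreal ((cmod (G \<xi>))\<^sup>2 / (a \<xi> + 1 / Suc k))) \<partial>lborel)"
  proof (rule nn_integral_mono)
    fix \<xi>
    show "ennreal ((cmod (G \<xi>))\<^sup>2 / a \<xi>) \<le> liminf (\<lambda>k. ennreal ((cmod (G \<xi>))\<^sup>2 / (a \<xi> + 1 / Suc k)))"
    \<comment> \<open>Where \<open>a\<close> is 0, the left-hand side is 0 by the convention for
      division by zero.\<close>
    proof (cases "a \<xi> = 0")
      case False
      have "(\<lambda>k. (cmod (G \<xi>))\<^sup>2 / (a \<xi> + 1 / Suc k)) \<longlonglongrightarrow> (cmod (G \<xi>))\<^sup>2 / (a \<xi> + 0)"
        using False by (intro tendsto_intros LIMSEQ_Suc[OF lim_1_over_n]) auto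
      then have "(\<lambda>k. ennreal ((cmod (G \<xi>))\<^sup>2 / (a \<xi> + 1 / Suc k))) \<longlonglongrightarrow> ennreal ((cmod (G \<xi>))\<^sup>2 / a \<xi>)"
        by (intro tendsto_ennrealI) simp
      then show ?thesis
        by (metis lim_imp_Liminf trivial_limit_sequentially order_refl)
    qed simp
  qed
  also have "\<dots> \<le> liminf (\<lambda>k. \<integral>\<^sup>+ \<xi>. ennreal ((cmod (G \<xi>))\<^sup>2 / (a \<xi> + 1 / Suc k)) \<partial>lborel)"
    by (rule nn_integral_liminf) measurable
  also have "\<dots> \<le> limsup (\<lambda>k. \<integral>\<^sup>+ \<xi>. ennreal ((cmod (G \<xi>))\<^sup>2 / (a \<xi> + 1 / Suc k)) \<partial>lborel)"
    by (rule Liminf_le_Limsup) simp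
  also have "\<dots> \<le> ennreal C"
  proof (intro Limsup_bounded always_eventually allI)
    fix k :: nat
    have "(\<integral>\<^sup>+ \<xi>. ennreal ((cmod (G \<xi>))\<^sup>2 / (a \<xi> + 1 / Suc k)) \<partial>lborel)
        = ennreal (\<integral>\<xi>. (cmod (G \<xi>))\<^sup>2 / (a \<xi> + 1 / Suc k) \<partial>lborel)"
      by (intro nn_integral_eq_integral N_integrable[OF G])
          (auto intro!: AE_I2 divide_nonneg_nonneg add_nonneg_nonneg)
    also have "\<dots> = ennreal (N (1 / Suc k) f)"
      by (simp add: N_eq[OF G])
    also have "\<dots> \<le> ennreal C"
      by (intro ennreal_leI bd) auto
    finally show "(\<integral>\<^sup>+ \<xi>. ennreal ((cmod (G \<xi>))\<^sup>2 / (a \<xi> + 1 / Suc k)) \<partial>lborel) \<le> ennreal C" .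
  qed
  finally have fin: "(\<integral>\<^sup>+ \<xi>. ennreal ((cmod (fourier_integral (\<lambda>x. g x * of_real (V x)) \<xi>))\<^sup>2 / a
      \<xi>) \<partial>lborel) < \<infinity>"
    unfolding G_def by (rule le_less_trans) simp
  have int: "integrable lborel (\<lambda>x. cnj (c \<alpha>) * (of_real
      (monomial \<alpha> x) * (g x * complex_of_real (V x))))" for \<alpha>
    using integrable_continuous_V[of "\<lambda>x. cnj (c \<alpha>) * (of_real (monomial \<alpha> x) * g x)"] g
    by (simp add: mult.assoc monomial_def continuous_intros)
  have "of_real ((norm f)\<^sup>2) = (\<integral>x. cnj (g x) * (g x * of_real (V x)) \<partial>lborel)"
    unfolding f g_def[symmetric] by (rule norm_to_L2_mult_w[OF g])
  also have "\<dots> = (\<integral>x. (\<Sum>\<alpha>\<in>I. cnj (c \<alpha>) * (of_real (monomial \<alpha> x) * (g x * of_real (V x)))) \<partial>lborel)"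
    by (simp add: g_def[of x for x, THEN arg_cong[where f = cnj]] sum_distrib_right mult.assoc)
  also have "\<dots> = (\<Sum>\<alpha>\<in>I. cnj (c \<alpha>) * (\<integral>x. of_real (monomial \<alpha> x) * (g x * of_real (V x)) \<partial>lborel))"
    by (subst Bochner_Integration.integral_sum[OF int]) simp
  also have "\<dots> = 0"
    using monomial_orthogonal[OF g fin deg] by simp
  finally show "f = 0"
    by simp
qed

text \<open>Isolates the properties of a basis of F_n on which the variational argument relies.
  Boundedness is required only for \<epsilon> up to 1, the range in which
  \<open>T \<epsilon>\<close> is used.\<close>

definition trial_family :: "nat \<Rightarrow> (nat \<Rightarrow> 'd L2) \<Rightarrow> bool" where
  "trial_family n b \<longleftrightarrow>
    (\<forall>c C. (\<forall>\<epsilon>. 0 < \<epsilon> \<longrightarrow> \<epsilon> \<le> 1 \<longrightarrow> N \<epsilon> (\<Sum>j<n. c j \<cdot> b j) \<le> C) \<longrightarrow> (\<Sum>j<n. c j \<cdot> b j) = 0) \<and>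
    (\<forall>c. (\<Sum>j<n. c j \<cdot> b j) = 0 \<longrightarrow> (\<forall>j<n. c j = 0))"

lemma
  assumes "trial_family n b"
  shows trial_family_bounded: "(\<And>\<epsilon>. 0 < \<epsilon> \<Longrightarrow> \<epsilon> \<le> 1 \<Longrightarrow> N \<epsilon> (\<Sum>j<n. c j \<cdot> b j) \<le> C) \<Longrightarrow> (\<Sum>j<n. c j \<cdot> b j) = 0"
    and trial_family_independent: "(\<Sum>j<n. c j \<cdot> b j) = 0 \<Longrightarrow> j < n \<Longrightarrow> c j = 0"
  using assms[unfolded trial_family_def, THEN conjunct1, rule_format, of c C]
    assms[unfolded trial_family_def, THEN conjunct2, rule_format, of c j] by simp_all

text \<open>Otherwise each \<epsilon> = 1 / (k + 1) has a normalised coefficient vector violating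
  the bound. A limit l of these vectors keeps N bounded for every \<epsilon>, which forces all its
  coefficients to vanish.\<close>

lemma uniform_trial:
  assumes b: "trial_family n b"
  shows "\<exists>\<epsilon>>0. \<epsilon> \<le> 1 \<and> (\<forall>c. (\<exists>j<n. c j \<noteq> 0) \<longrightarrow> (norm (\<Sum>j<n. c j \<cdot> b j))\<^sup>2 < N \<epsilon> (\<Sum>j<n. c j \<cdot> b j))"
proof (rule ccontr)
  define F where "F c = (\<Sum>j<n. c j \<cdot> b j)" for c
  assume neg: "\<not> ?thesis"
  have "\<exists>c. (\<Sum>j<n. cmod (c j)) = 1 \<and> N (1 / Suc k) (F c) \<le> (norm (F c))\<^sup>2" for k :: nat
  proof -
    have k: "0 < 1 / real (Suc k)" "1 / real (Suc k) \<le> 1"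
      by auto
    with neg have "\<not> (\<forall>c. (\<exists>j<n. c j \<noteq> 0) \<longrightarrow> (norm (F c))\<^sup>2 < N (1 / Suc k) (F c))"
      unfolding F_def by blast
    then obtain c where c: "\<exists>j<n. c j \<noteq> 0" "N (1 / Suc k) (F c) \<le> (norm (F c))\<^sup>2"
      unfolding not_all not_imp not_less by blast
    \<comment> \<open>The coefficients are normalised, not the vector \<open>F c\<close>: bounded
      coefficients have convergent subsequences, and their absolute sum stays 1 in the
      limit.\<close>
    define R where "R = (\<Sum>j<n. cmod (c j))"
    have "R \<noteq> 0"
      using c(1) by (auto simp: R_def sum_nonneg_eq_0_iff)
    then have R: "R > 0"
      unfolding R_def by (simp add: sum_nonneg less_le)
    define e where "e = complex_of_real (1 / R)"
    have ce: "cmod e = 1 / R"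
      using R by (simp add: e_def norm_divide)
    have Fe: "F (\<lambda>j. e * c j) = e \<cdot> F c"
      by (simp add: F_def L2.scale_sum_right)
    have "(\<Sum>j<n. cmod (e * c j)) = 1"
      using R by (simp add: norm_mult ce flip: sum_distrib_left sum_divide_distrib R_def)
    moreover have "N (1 / Suc k) (F (\<lambda>j. e * c j)) \<le> (norm (F (\<lambda>j. e * c j)))\<^sup>2"
      unfolding Fe N_scale[OF k(1)] norm_scale_L2 power_mult_distrib
      by (intro mult_left_mono c(2)) simp
    ultimately show ?thesis
      by (intro exI[of _ "\<lambda>j. e * c j"] conjI)
  qed
  then have "\<forall>k. \<exists>c. (\<Sum>j<n. cmod (c j)) = 1 \<and> N (1 / Suc k) (F c) \<le> (norm (F c))\<^sup>2"
    by (rule allI)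
  from choice[OF this]
  obtain c where c: "\<And>k. (\<Sum>j<n. cmod (c k j)) = 1" "\<And>k. N (1 / Suc k) (F (c k)) \<le> (norm (F (c k)))\<^sup>2"
    by blast
  have c1: "cmod (c k j) \<le> 1" if "j < n" for k j
    using member_le_sum[of j "{..<n}" "\<lambda>j. cmod (c k j)"] that c(1)[of k] by simp
  obtain r where r: "strict_mono (r :: nat \<Rightarrow> nat)" "\<And>j. j \<in> {..<n} \<Longrightarrow> \<exists>l. (\<lambda>k. c (r k) j) \<longlonglongrightarrow> l"
  proof (rule function_convergent_subsequence[of "{..<n}" c 1])
    show "norm (c k j) \<le> 1" if "j \<in> {..<n}" for k j
      using c1 that by simp
  qed (simp, erule that, blast)
  define l where "l j = lim (\<lambda>k. c (r k) j)" for j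
  have l: "(\<lambda>k. c (r k) j) \<longlonglongrightarrow> l j" if "j < n" for j
  proof -
    have "convergent (\<lambda>k. c (r k) j)"
      unfolding convergent_def using r(2)[of j] that by simp
    then show ?thesis
      unfolding l_def by (simp only: convergent_LIMSEQ_iff)
  qed
  have "(\<lambda>k. \<Sum>j<n. cmod (c (r k) j)) \<longlonglongrightarrow> (\<Sum>j<n. cmod (l j))"
    by (intro tendsto_sum tendsto_norm l) simp
  then have l1: "(\<Sum>j<n. cmod (l j)) = 1"
    by (simp add: c(1) LIMSEQ_const_iff)
  have blin: "bounded_linear (\<lambda>z. z \<cdot> u)" for u :: "'d L2"
    by (rule bounded_linear_intro[where K = "norm u"])
      (simp_all add: L2.scale_left_distrib scaleR_L2_def scaleR_conv_of_real)
  have Fl: "(\<lambda>k. F (c (r k))) \<longlonglongrightarrow> F l"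
    unfolding F_def by (intro tendsto_sum bounded_linear.tendsto[OF blin] l) simp
  define B where "B = (\<Sum>j<n. norm (b j))"
  have FB: "norm (F (c k)) \<le> B" for k
    unfolding F_def B_def
    by (rule sum_norm_le) (simp add: mult_left_le_one_le c1)
  have "N \<epsilon> (F l) \<le> B\<^sup>2" if \<epsilon>: "0 < \<epsilon>" "\<epsilon> \<le> 1" for \<epsilon>
  \<comment> \<open>For fixed \<epsilon>, monotonicity of N in \<epsilon> makes the violated
    inequality at 1 / (r k + 1) applicable as soon as that number is below \<epsilon>.\<close>
  proof (rule tendsto_upperbound[OF tendsto_N[OF Fl \<epsilon>(1)]])
    obtain K :: nat where K: "1 / \<epsilon> < K"
      using reals_Archimedean2[of "1 / \<epsilon>"] by (elim exE)
    show "\<forall>\<^sub>F k in sequentially. N \<epsilon> (F (c (r k))) \<le> B\<^sup>2"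
    proof (rule eventually_sequentiallyI[of K])
      fix k assume "k \<ge> K"
      then have "real K \<le> real (Suc (r k))"
        using seq_suble[OF r(1), of k] by simp
      then have "1 / \<epsilon> < real (Suc (r k))"
        using K by linarith
      then have "1 / real (Suc (r k)) \<le> \<epsilon>"
        using \<epsilon> by (simp add: field_simps)
      then have "N \<epsilon> (F (c (r k))) \<le> N (1 / Suc (r k)) (F (c (r k)))"
        by (intro N_antimono) auto
      also have "\<dots> \<le> (norm (F (c (r k))))\<^sup>2"
        by (rule c(2))
      also have "\<dots> \<le> B\<^sup>2"
        by (intro power_mono FB) simp
      finally show "N \<epsilon> (F (c (r k))) \<le> B\<^sup>2" .
    qed
  qed simp
  then have "F l = 0"
    unfolding F_def by (rule trial_family_bounded[OF b])
  then have "l j = 0" if "j < n" for j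
    using trial_family_independent[OF b _ that] unfolding F_def by simp
  with l1 show False by simp
qed

lemma T_sum:
  assumes "0 < \<epsilon>" "\<epsilon> \<le> 1"
  shows "T \<epsilon> (\<Sum>j\<in>J. c j \<cdot> b j) = (\<Sum>j\<in>J. c j \<cdot> T \<epsilon> (b j))"
proof -
  have "bounded_linear (T \<epsilon>)"
    unfolding T_def[abs_def]
    by (intro bounded_linear_compose[OF bounded_linear_mult_L2[OF bm_T[OF assms]]]
        bounded_linear_compose[OF bounded_linear_fourier_L2] bounded_linear_wL)
  moreover have "T \<epsilon> (c \<cdot> f) = c \<cdot> T \<epsilon> f" for c f
    unfolding T_def wL_scale fourier_L2_scale mult_L2_scale[OF bm_T[OF assms]] ..
  ultimately show ?thesis
    using linear_sum[OF bounded_linear.linear, of "T \<epsilon>" "\<lambda>j. c j \<cdot> b j" J] by simp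
qed

text \<open>Orthogonality to m states imposes m equations on n > m coefficients. They are linear
  because the same \<epsilon> serves every combination, and any non-zero solution is a negative
  trial state.\<close>

lemma trial_orthogonal:
  assumes b: "trial_family n b"
    and m: "m < n"
  shows "\<exists>y\<in>orth m ks. form 0 y < 0"
proof -
  obtain \<epsilon> where \<epsilon>: "0 < \<epsilon>" "\<epsilon> \<le> 1"
      and N: "\<forall>c. (\<exists>j<n. c j \<noteq> 0) \<longrightarrow> (norm (\<Sum>j<n. c j \<cdot> b j))\<^sup>2 < N \<epsilon> (\<Sum>j<n. c j \<cdot> b j)"
    using uniform_trial[OF b] by (elim exE conjE)
  have "m < card {..<n}"
    using m by simp
  from underdetermined_system[OF finite_lessThan this, of "\<lambda>i j. cinner (S (T \<epsilon> (b j))) (S (ks i))"]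
  obtain c where c: "\<exists>j\<in>{..<n}. c j \<noteq> 0" "\<And>i. i < m
      \<Longrightarrow> (\<Sum>j<n. c j * cinner (S (T \<epsilon> (b j))) (S (ks i))) = 0"
    by blast
  let ?f = "\<Sum>j<n. c j \<cdot> b j"
  have "?f \<noteq> 0"
    using c(1) trial_family_independent[OF b, of c] by auto
  moreover have "(norm ?f)\<^sup>2 < N \<epsilon> ?f"
    by (rule N[rule_format, OF c(1)[unfolded Bex_def lessThan_iff]])
  ultimately have "form 0 (T \<epsilon> ?f) < 0"
    by (rule trial_negative[OF \<epsilon>])
  moreover have "T \<epsilon> ?f \<in> orth m ks"
    unfolding orth_def T_sum[OF \<epsilon>]
    using c(2) by (simp add: linear_sum[OF bounded_linear.linear[OF bounded_linear_S]] S_scale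
        cinner_sum_left cinner_scale_left)
  ultimately show ?thesis by blast
qed

theorem num_neg_eigenvalues_ge_trial:
  assumes "trial_family n b"
  shows "num_neg_eigenvalues (sobolev (2 * s)) (schroedinger s V) \<ge> enat n"
proof -
  obtain ks Es where ks: "\<And>i. i < n \<Longrightarrow> ks i \<noteq> 0 \<and> Es i < 0 \<and> A (Es i) (ks i) = 0"
      "\<And>i j. i < n \<Longrightarrow> j < n \<Longrightarrow> i \<noteq> j \<Longrightarrow> cinner (S (ks i)) (S (ks j)) = 0"
    using negative_eigenvectors[of n, OF trial_orthogonal[OF assms]] by blast
  show ?thesis
  proof (rule num_neg_eigenvalues_ge[of n "\<lambda>i. state (ks i)" _ _ Es])
    show "state (ks i) \<noteq> 0" if "i < n" for i
      using norm_S_pos[of "ks i"] ks(1)[OF that] norm_state[of "ks i"] by force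
    show "cinner (state (ks i)) (state (ks j)) = 0" if "i < n" "j < n" "i \<noteq> j" for i j
      using ks(2)[OF that] by (simp add: state_def)
  qed (use ks(1) eigenvector in auto)
qed

end

subsection \<open>The space \<open>\<F>\<^sub>n\<close>\<close>

lemma finite_multiindices: "finite {\<alpha> :: 'd::finite \<Rightarrow> nat. sum \<alpha> UNIV \<le> n}"
proof (rule finite_subset)
  show "{\<alpha> :: 'd \<Rightarrow> nat. sum \<alpha> UNIV \<le> n} \<subseteq> Pi\<^sub>E UNIV (\<lambda>_. {..n})"
  proof
    fix \<alpha> :: "'d \<Rightarrow> nat"
    assume "\<alpha> \<in> {\<alpha>. sum \<alpha> UNIV \<le> n}"
    then have "\<alpha> j \<le> n" for j
      using member_le_sum[of j UNIV \<alpha>] by simp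
    then show "\<alpha> \<in> Pi\<^sub>E UNIV (\<lambda>_. {..n})"
      by auto
  qed
qed (auto intro: finite_PiE)

lemma (in compact_potential) F_space_representation:
  assumes "f \<in> F_space n w"
  shows "\<exists>c. f = to_L2 (\<lambda>x. (\<Sum>\<alpha>\<in>{\<alpha>. sum \<alpha> UNIV \<le> n}. c \<alpha> * of_real (monomial \<alpha> x)) * of_real (w x))"
  using assms unfolding F_space_def
proof (induction rule: L2.span_induct_alt)
  let ?I = "{\<alpha> :: 'd \<Rightarrow> nat. sum \<alpha> UNIV \<le> n}"
  have cont: "continuous_on UNIV (\<lambda>x. \<Sum>\<alpha>\<in>?I. c \<alpha> * complex_of_real (monomial \<alpha> x))" for c
    unfolding monomial_def by (intro continuous_intros)
  note sq = square_integrable_mult_w[OF cont]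
  {
    case base
    show ?case
      by (intro exI[of _ "\<lambda>_. 0"]) (simp add: zero_to_L2)
  next
    case (step c f g)
    obtain \<beta> where \<beta>: "sum \<beta> UNIV \<le> n" "f = to_L2 (\<lambda>x. of_real (monomial \<beta> x * w x))"
      using step by blast
    obtain d where d: "g = to_L2 (\<lambda>x. (\<Sum>\<alpha>\<in>?I. d \<alpha> * of_real (monomial \<alpha> x)) * of_real (w x))"
      using step by blast
    define e where "e \<alpha> = (if \<alpha> = \<beta> then c else 0)" for \<alpha>
    have mb: "continuous_on UNIV (\<lambda>x. complex_of_real (monomial \<beta> x))"
      unfolding monomial_def by (intro continuous_intros)
    have "(\<Sum>\<alpha>\<in>?I. e \<alpha> * of_real (monomial \<alpha> x))
        = (\<Sum>\<alpha>\<in>?I. if \<alpha> = \<beta> then c * of_real (monomial \<beta> x) else 0)" for x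
      by (intro sum.cong) (auto simp: e_def)
    then have e: "(\<Sum>\<alpha>\<in>?I. e \<alpha> * of_real (monomial \<alpha> x)) = c * complex_of_real (monomial \<beta> x)" for x
      using \<beta>(1) by (simp add: finite_multiindices)
    have "c \<cdot> f = to_L2 (\<lambda>x. (\<Sum>\<alpha>\<in>?I. e \<alpha> * of_real (monomial \<alpha> x)) * of_real (w x))"
      unfolding \<beta>(2) e using square_integrable_mult_w[OF mb] by (simp add: scale_to_L2 mult.assoc)
    then have "c \<cdot> f + g = to_L2 (\<lambda>x. (\<Sum>\<alpha>\<in>?I. (e \<alpha> + d \<alpha>) * of_real (monomial \<alpha> x)) * of_real (w x))"
      unfolding d by (simp only: add_to_L2[OF sq sq] distrib_right sum.distrib)
    then show ?case
      by (intro exI[of _ "\<lambda>\<alpha>. e \<alpha> + d \<alpha>"])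
  }
qed

theorem proposition4p1:
  fixes V v :: "real ^ 'd \<Rightarrow> real" and s :: real and n :: nat
  assumes s: "s \<ge> real CARD('d) / 2"
    and n: "n = nat \<lfloor>s - real CARD('d) / 2\<rfloor>"
    and V: "test_function V" "\<And>x. V x \<ge> 0"
    and v: "v = (\<lambda>x. sqrt (V x))"
  shows "num_neg_eigenvalues (sobolev (2 * s)) (schroedinger s V) \<ge> enat (L2.dim (F_space n v))"
proof -
  have "C_k 0 V" and comp: "compact (closure {x. V x \<noteq> 0})"
    using V(1) unfolding test_function_def by (rule conjunct1[THEN spec], rule conjunct2)
  then have cont: "continuous_on UNIV V"
    by (simp only: C_k.simps)
  obtain R where R: "\<And>x. x \<in> closure {x. V x \<noteq> 0} \<Longrightarrow> norm x \<le> R"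
    using compact_imp_bounded[OF comp] unfolding bounded_iff by blast
  have supp: "V x \<noteq> 0 \<Longrightarrow> norm x \<le> R" for x
    by (intro R subsetD[OF closure_subset]) simp
  have "bounded (V ` closure {x. V x \<noteq> 0})"
    by (intro compact_imp_bounded compact_continuous_image continuous_on_subset[OF cont] comp) auto
  then obtain M where M: "\<And>x. x \<in> closure {x. V x \<noteq> 0} \<Longrightarrow> \<bar>V x\<bar> \<le> M"
    unfolding bounded_iff by auto
  \<comment> \<open>M bounds V only on the closed support, which may be empty, so M itself may be
    negative.\<close>
  have Vle: "V x \<le> max 0 M" for x
  proof (cases "V x = 0")
    case False
    then have "\<bar>V x\<bar> \<le> M"
      by (intro M subsetD[OF closure_subset]) simp
    then show ?thesis by simp
  qed simp
  interpret compact_potential V s "max 0 M" R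
  proof
    show "s > 0"
      using s by (rule less_le_trans[rotated]) (simp add: zero_less_card_finite)
    show "V \<in> borel_measurable borel"
      by (rule borel_measurable_continuous_onI[OF cont])
    show "V x \<ge> 0" "V x \<le> max 0 M" for x
      by (rule V(2) Vle)+
    show "norm x \<le> R" if "V x \<noteq> 0" for x
      using that by (rule supp)
  qed
  have vw: "v = w"
    by (rule ext) (simp add: v w_def)
  let ?I = "{\<alpha> :: 'd \<Rightarrow> nat. sum \<alpha> UNIV \<le> n}"
  have deg: "real CARD('d) + 2 * real (sum \<alpha> UNIV) \<le> 2 * s" if "\<alpha> \<in> ?I" for \<alpha>
  proof -
    \<comment> \<open>The conversion of the floor to a natural number is faithful because s \<ge>
      d/2.\<close>
    have "real n \<le> s - real CARD('d) / 2"
      using s unfolding n by (simp add: of_nat_nat)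
    moreover have "real (sum \<alpha> UNIV) \<le> real n"
      using that by (simp only: mem_Collect_eq of_nat_le_iff)
    ultimately show ?thesis by linarith
  qed
  obtain B where B: "B \<subseteq> F_space n v" "L2.independent B" "card B = L2.dim (F_space n v)"
    by (rule L2.basis_exists[of "F_space n v"])
  \<comment> \<open>An independent subset of the span of finitely many vectors is finite, so the
    basis can be enumerated and \<open>card B\<close> is a genuine dimension rather than a default
    0.\<close>
  have "finite B"
  proof -
    have "finite {to_L2 (\<lambda>x. of_real (monomial \<alpha> x * v x)) | \<alpha>. sum \<alpha> UNIV \<le> n}"
      by (rule finite_image_set[OF finite_multiindices])
    from L2.independent_span_bound[OF this B(2) B(1)[unfolded F_space_def]] show ?thesis
      by (rule conjunct1)
  qed
  from ex_bij_betw_nat_finite[OF this]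
  obtain b where b: "bij_betw b {..<card B} B"
    unfolding atLeast0LessThan by (elim exE)
  show ?thesis
    unfolding B(3)[symmetric]
  proof (rule num_neg_eigenvalues_ge_trial, unfold trial_family_def, intro conjI allI impI)
    fix c :: "nat \<Rightarrow> complex" and C
    assume bd: "\<forall>\<epsilon>. 0 < \<epsilon> \<longrightarrow> \<epsilon> \<le> 1 \<longrightarrow> N \<epsilon> (\<Sum>j<card B. c j \<cdot> b j) \<le> C"
    have "(\<Sum>j<card B. c j \<cdot> b j) \<in> F_space n w"
      unfolding F_space_def
      by (intro L2.span_sum L2.span_scale) (use b B(1) in \<open>auto simp: bij_betw_def vw F_space_def\<close>)
    then obtain e where "(\<Sum>j<card B. c j \<cdot> b j)
        = to_L2 (\<lambda>x. (\<Sum>\<alpha>\<in>?I. e \<alpha> * of_real (monomial \<alpha> x)) * of_real (w x))"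
      using F_space_representation by blast
    then show "(\<Sum>j<card B. c j \<cdot> b j) = 0"
    proof (rule N_unbounded[where I = ?I and c = e and C = C, rotated])
      show "N \<epsilon> (\<Sum>j<card B. c j \<cdot> b j) \<le> C" if "0 < \<epsilon>" "\<epsilon> \<le> 1" for \<epsilon>
        using bd that by blast
    qed (rule deg)
  next
    fix c :: "nat \<Rightarrow> complex" and j
    assume 0: "(\<Sum>j<card B. c j \<cdot> b j) = 0" and j: "j < card B"
    \<comment> \<open>Independence of B concerns coefficients indexed by vectors, so c is
      transported along the enumeration.\<close>
    define u where "u x = c (the_inv_into {..<card B} b x)" for x
    have ub: "u (b j) = c j" if "j < card B" for j
      using b that by (simp add: u_def the_inv_into_f_f bij_betw_def)
    have "(\<Sum>x\<in>B. u x \<cdot> x) = (\<Sum>j<card B. u (b j) \<cdot> b j)"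
      by (rule sum.reindex_bij_betw[OF b, symmetric])
    also have "\<dots> = 0"
      using 0 by (simp add: ub)
    finally have "u (b j) = 0"
      using L2.independentD[OF B(2) \<open>finite B\<close> subset_refl] b j by (auto simp: bij_betw_def)
    then show "c j = 0"
      by (simp add: ub j)
  qed
qed

end
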